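(* Consider the scalar equation $\partial_tv=\partial_x(\mathsf E e[v])$ with $e=e(v,v_x)$ as in the context. Assume: there exist an open set $\Omega\subset\mathbb R^{3}$ and a family of nonconstant periodic traveling profiles $\underline v$, of period $\Upsilon$, smoothly parametrized (together with $\Upsilon$) by $(\mu,\lambda,c)\in\Omega$, such that $$\mathsf E(e+c\,q)[\underline v]=\lambda,\qquad \underline v\,\mathsf E e[\underline v]+\mathsf Le[\underline v]+c\,q(\underline v)=\mu ,\qquad q(v)=\tfrac12v^2.$$ Let $d(z)=\det(\mathbf f(\Upsilon;z)-\mathbf f(0;z))$ be the Evans function and $\theta(\mu,\lambda,c)$ the abbreviated action defined in the context. Then, for real $r$, $$d(r)=r^{3}\det(\mathrm{Hess}\,\theta)+o(r^{3})\quad(r\to0),\qquad d(r)<0\ \text{ for } r>0\text{ large enough},$$ where $\mathrm{Hess}\,\theta$ is the $3\times 3$ Hessian of $\theta$ at $(\mu,\lambda,c)$. If $\det(\mathrm{Hess}\,\theta)>0$, then the corresponding wave is spectrally unstable with respect to co-periodic perturbations.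
   Context: The energy $e=e(v,v_x)$ is smooth and strongly convex in $v_x$ ($\partial_{v_x}^2e>0$). Notation: $\mathsf Ee[v]=\partial_ve-\mathrm D_x(\partial_{v_x}e)$ (variational derivative, $\mathrm D_x$ the total derivative), $\mathsf Le[v]=v_x\partial_{v_x}e-e$. A profile $\underline v$ with parameters $(\mu,\lambda,c)$ gives the traveling wave $v(x,t)=\underline v(x-ct)$. Abbreviated action: $\theta(\mu,\lambda,c)=\int_0^\Upsilon\big(e(\underline v,\underline v_x)+\tfrac c2\underline v^2-\lambda\underline v+\mu\big)\,dx$. Linearization: $\mathbf a=\mathrm{Hess}(e+cq)[\underline v]$ is the second variational derivative: $\mathrm{Hess}\,e[\underline v]v=\partial_v^2e\,v+\partial^2_{vv_x}e\,v_x-\mathrm D_x(\partial^2_{vv_x}e\,v+\partial^2_{v_x}e\,v_x)$ with coefficients evaluated at $\underline v$, and $\mathrm{Hess}\,q=1$. Evans function: the third-order ODE $\partial_x(\mathbf a v)=z\,v$ is viewed as a first-order linear system for $(v,v_x,v_{xx})^{\mathsf T}$ with $\Upsilon$-periodic coefficients; $\mathbf f(\cdot;z)$ is its fundamental solution with $\mathbf f(0;z)=I_3$. The wave is spectrally stable with respect to co-periodic perturbations if the spectrum of $\partial_x\mathbf a$ in $L^2(\mathbb R/\Upsilon\mathbb Z)$ is purely imaginary, and spectrally unstable otherwise. *)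

theory Defs
  imports "HOL-Analysis.Analysis" "HOL-Library.Landau_Symbols"
begin

fun Ck_on :: "nat \<Rightarrow> 'a::real_normed_vector set \<Rightarrow> ('a \<Rightarrow> 'b::real_normed_vector) \<Rightarrow> bool" where
  "Ck_on 0 S f \<longleftrightarrow> continuous_on S f"
| "Ck_on (Suc k) S f \<longleftrightarrow>
     (\<forall>x\<in>S. f differentiable (at x)) \<and> (\<forall>h. Ck_on k S (\<lambda>x. frechet_derivative f (at x) h))"

text \<open>The set is meant to be open, and the domain finite-dimensional.\<close>

definition smooth_on :: "'a::real_normed_vector set \<Rightarrow> ('a \<Rightarrow> 'b::real_normed_vector) \<Rightarrow> bool" where
  "smooth_on S f \<longleftrightarrow> (\<forall>k. Ck_on k S f)"

definition pd_v :: "(real \<times> real \<Rightarrow> real) \<Rightarrow> real \<times> real \<Rightarrow> real" where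
  "pd_v e = (\<lambda>(v, p). deriv (\<lambda>s. e (s, p)) v)"

definition pd_vx :: "(real \<times> real \<Rightarrow> real) \<Rightarrow> real \<times> real \<Rightarrow> real" where
  "pd_vx e = (\<lambda>(v, p). deriv (\<lambda>s. e (v, s)) p)"

definition jet :: "(real \<Rightarrow> real) \<Rightarrow> real \<Rightarrow> real \<times> real" where
  "jet u x = (u x, deriv u x)"

definition var_deriv :: "(real \<times> real \<Rightarrow> real) \<Rightarrow> (real \<Rightarrow> real) \<Rightarrow> real \<Rightarrow> real" where
  "var_deriv e u x = pd_v e (jet u x) - deriv (\<lambda>y. pd_vx e (jet u y)) x"

definition legendre :: "(real \<times> real \<Rightarrow> real) \<Rightarrow> (real \<Rightarrow> real) \<Rightarrow> real \<Rightarrow> real" where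
  "legendre e u x = deriv u x * pd_vx e (jet u x) - e (jet u x)"

definition impulse :: "real \<Rightarrow> real" where
  "impulse v = v\<^sup>2 / 2"

definition add_impulse :: "(real \<times> real \<Rightarrow> real) \<Rightarrow> real \<Rightarrow> real \<times> real \<Rightarrow> real" where
  "add_impulse e c = (\<lambda>(v, p). e (v, p) + c * impulse v)"

text \<open>The parameter vector \<open>m\<close> is \<open>(\<mu>, \<lambda>, c)\<close>, in this order.\<close>

definition action ::
  "(real \<times> real \<Rightarrow> real) \<Rightarrow> (real^3 \<Rightarrow> real \<Rightarrow> real) \<Rightarrow> (real^3 \<Rightarrow> real) \<Rightarrow> real^3 \<Rightarrow> real" where
  "action e u \<Upsilon> m =
     integral {0..\<Upsilon> m} (\<lambda>x. e (jet (u m) x) + m $ 3 / 2 * (u m x)\<^sup>2 - m $ 2 * u m x + m $ 1)"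

definition partial :: "'n::finite \<Rightarrow> (real^'n \<Rightarrow> real) \<Rightarrow> real^'n \<Rightarrow> real" where
  "partial i g m = deriv (\<lambda>t. g (m + t *\<^sub>R axis i 1)) 0"

definition hessian :: "(real^'n::finite \<Rightarrow> real) \<Rightarrow> real^'n \<Rightarrow> real^'n^'n" where
  "hessian g m = (\<chi> i j. partial i (partial j g) m)"

text \<open>The second variational derivative of \<open>e\<close> at \<open>u\<close>, acting on complex-valued functions.\<close>

definition hess_op ::
  "(real \<times> real \<Rightarrow> real) \<Rightarrow> (real \<Rightarrow> real) \<Rightarrow> (real \<Rightarrow> complex) \<Rightarrow> real \<Rightarrow> complex" where
  "hess_op e u w x =
     of_real (pd_v (pd_v e) (jet u x)) * w x
     + of_real (pd_v (pd_vx e) (jet u x)) * vector_derivative w (at x)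
     - vector_derivative
         (\<lambda>y. of_real (pd_v (pd_vx e) (jet u y)) * w y
             + of_real (pd_vx (pd_vx e) (jet u y)) * vector_derivative w (at y)) (at x)"

text \<open>With \<open>\<alpha>\<close>, \<open>\<beta>\<close>, \<open>\<kappa>\<close> as below, \<open>hess_op e u w\<close> is \<open>(\<alpha> - \<beta>') w - \<kappa>' w' - \<kappa> w''\<close>. Differentiating once more
  and solving \<open>(hess_op e u w)' = z w\<close> for \<open>w'''\<close> gives the last row of the matrix
  (lemma \<open>companion_iff\<close>).\<close>

definition companion ::
  "(real \<times> real \<Rightarrow> real) \<Rightarrow> (real \<Rightarrow> real) \<Rightarrow> complex \<Rightarrow> real \<Rightarrow> complex^3^3" where
  "companion e u z x =
    (let \<alpha> = (\<lambda>y. pd_v (pd_v e) (jet u y));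
         \<beta> = (\<lambda>y. pd_v (pd_vx e) (jet u y));
         \<kappa> = (\<lambda>y. pd_vx (pd_vx e) (jet u y))
     in vector
       [vector [0, 1, 0],
        vector [0, 0, 1],
        vector [(of_real (deriv \<alpha> x - deriv (deriv \<beta>) x) - z) / of_real (\<kappa> x),
                of_real ((\<alpha> x - deriv \<beta> x - deriv (deriv \<kappa>) x) / \<kappa> x),
                of_real (- 2 * deriv \<kappa> x / \<kappa> x)]])"

lemma companion_iff:
  fixes e u z
  defines "\<alpha> \<equiv> \<lambda>y. pd_v (pd_v e) (jet u y)"
    and "\<beta> \<equiv> \<lambda>y. pd_v (pd_vx e) (jet u y)"
    and "\<kappa> \<equiv> \<lambda>y. pd_vx (pd_vx e) (jet u y)"
  assumes \<alpha>: "\<And>y. \<alpha> field_differentiable at y"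
    and \<beta>: "\<And>y. \<beta> field_differentiable at y" "\<And>y. deriv \<beta> field_differentiable at y"
    and \<kappa>: "\<And>y. \<kappa> field_differentiable at y" "\<And>y. deriv \<kappa> field_differentiable at y"
    and \<kappa>0: "\<And>y. \<kappa> y \<noteq> 0"
    and w: "\<And>y. (w has_vector_derivative w1 y) (at y)"
    and w1: "\<And>y. (w1 has_vector_derivative w2 y) (at y)"
  shows "(hess_op e u w has_vector_derivative z * w x) (at x) \<longleftrightarrow>
    (w2 has_vector_derivative (companion e u z x *v vector [w x, w1 x, w2 x]) $ 3) (at x)"
proof -
  have ofr: "((\<lambda>y. complex_of_real (f y)) has_vector_derivative of_real (deriv f y)) (at y)"
    if "f field_differentiable at y" for f y
    using that
    by (intro has_vector_derivative_of_real)
       (simp add: DERIV_deriv_iff_field_differentiable)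
  note d\<alpha> = ofr[OF \<alpha>] and d\<beta> = ofr[OF \<beta>(1)] ofr[OF \<beta>(2)] and d\<kappa> = ofr[OF \<kappa>(1)] ofr[OF \<kappa>(2)]
  have vw: "vector_derivative w (at y) = w1 y" for y
    using w by (rule vector_derivative_at)
  have inner: "vector_derivative (\<lambda>y. of_real (\<beta> y) * w y + of_real (\<kappa> y) * w1 y) (at y)
      = of_real (\<beta> y) * w1 y + of_real (deriv \<beta> y) * w y
        + (of_real (\<kappa> y) * w2 y + of_real (deriv \<kappa> y) * w1 y)" for y
    by (intro vector_derivative_at has_vector_derivative_add has_vector_derivative_mult d\<beta> d\<kappa> w w1)
  have H: "hess_op e u w = (\<lambda>y. (of_real (\<alpha> y) - of_real (deriv \<beta> y)) * w y
      - of_real (deriv \<kappa> y) * w1 y - of_real (\<kappa> y) * w2 y)"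
    unfolding hess_op_def vw
    using inner by (auto simp: \<alpha>_def \<beta>_def \<kappa>_def algebra_simps fun_eq_iff)
  define G where "G = (\<lambda>y. (of_real (\<alpha> y) - of_real (deriv \<beta> y)) * w y - of_real (deriv \<kappa> y) * w1 y)"
  define G' where "G' = (of_real (\<alpha> x) - of_real (deriv \<beta> x)) * w1 x
      + (of_real (deriv \<alpha> x) - of_real (deriv (deriv \<beta>) x)) * w x
      - (of_real (deriv \<kappa> x) * w2 x + of_real (deriv (deriv \<kappa>) x) * w1 x)"
  have dG: "(G has_vector_derivative G') (at x)"
    unfolding G_def G'_def
    by (intro has_vector_derivative_diff has_vector_derivative_mult d\<alpha> d\<beta> d\<kappa> w w1)
  have HG: "hess_op e u w = (\<lambda>y. G y - of_real (\<kappa> y) * w2 y)"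
    unfolding H G_def ..
  define s where "s = (companion e u z x *v vector [w x, w1 x, w2 x]) $ 3"
  have s: "of_real (\<kappa> x) * s = G' - of_real (deriv \<kappa> x) * w2 x - z * w x"
    unfolding s_def companion_def Let_def G'_def matrix_vector_mult_def
    using \<kappa>0[of x]
    by (simp add: sum_3 \<alpha>_def \<beta>_def \<kappa>_def field_simps)
  show ?thesis
    unfolding s_def[symmetric]
  proof
    assume h: "(hess_op e u w has_vector_derivative z * w x) (at x)"
    have dp: "((\<lambda>y. of_real (\<kappa> y) * w2 y) has_vector_derivative G' - z * w x) (at x)"
      using has_vector_derivative_diff[OF dG h] by (simp add: HG)
    have "((\<lambda>y. inverse (\<kappa> y)) has_real_derivative - (inverse (\<kappa> x) * deriv \<kappa> x * inverse (\<kappa> x))) (at x)"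
      using \<kappa>(1) \<kappa>0 by (intro DERIV_inverse') (simp_all add: DERIV_deriv_iff_field_differentiable)
    from has_vector_derivative_mult[OF has_vector_derivative_of_real[OF this] dp]
    have "((\<lambda>y. complex_of_real (inverse (\<kappa> y)) * (of_real (\<kappa> y) * w2 y)) has_vector_derivative
        of_real (inverse (\<kappa> x)) * (G' - z * w x)
        + of_real (- (inverse (\<kappa> x) * deriv \<kappa> x * inverse (\<kappa> x))) * (of_real (\<kappa> x) * w2 x)) (at x)" .
    moreover have "(\<lambda>y. complex_of_real (inverse (\<kappa> y)) * (of_real (\<kappa> y) * w2 y)) = w2"
      using \<kappa>0 by (auto simp: fun_eq_iff)
    moreover have "of_real (inverse (\<kappa> x)) * (G' - z * w x)
        + of_real (- (inverse (\<kappa> x) * deriv \<kappa> x * inverse (\<kappa> x))) * (of_real (\<kappa> x) * w2 x) = s"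
    proof -
      have "G' - z * w x = of_real (\<kappa> x) * s + of_real (deriv \<kappa> x) * w2 x"
        using s by simp
      then show ?thesis using \<kappa>0[of x] by (simp add: field_simps)
    qed
    ultimately show "(w2 has_vector_derivative s) (at x)" by simp
  next
    assume "(w2 has_vector_derivative s) (at x)"
    from has_vector_derivative_diff[OF dG has_vector_derivative_mult[OF d\<kappa>(1) this]]
    show "(hess_op e u w has_vector_derivative z * w x) (at x)"
      by (simp add: HG s)
  qed
qed

definition fundamental_solution :: "(real \<Rightarrow> complex^'n^'n) \<Rightarrow> real \<Rightarrow> complex^'n^'n" where
  "fundamental_solution A =
     (THE F. F 0 = mat 1 \<and> (\<forall>x. (F has_vector_derivative A x ** F x) (at x)))"

definition evans :: "(real \<times> real \<Rightarrow> real) \<Rightarrow> real \<Rightarrow> (real \<Rightarrow> real) \<Rightarrow> real \<Rightarrow> complex \<Rightarrow> complex" where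
  "evans e c u P z =
    (let F = fundamental_solution (companion (add_impulse e c) u z) in det (F P - F 0))"

text \<open>Elements of \<open>L\<^sup>2(\<real>/P\<int>)\<close> are represented by periodic functions on the line, equality being
  equality almost everywhere.\<close>

definition L2_per :: "real \<Rightarrow> (real \<Rightarrow> complex) set" where
  "L2_per P = {f. f \<in> borel_measurable borel \<and> (\<forall>x. f (x + P) = f x)
                  \<and> set_integrable lborel {0..P} (\<lambda>x. (cmod (f x))\<^sup>2)}"

definition L2_norm_per :: "real \<Rightarrow> (real \<Rightarrow> complex) \<Rightarrow> real" where
  "L2_norm_per P f = sqrt (set_lebesgue_integral lborel {0..P} (\<lambda>x. (cmod (f x))\<^sup>2))"

text \<open>For \<open>g\<close> in \<open>L2_per P\<close> the following says that \<open>f\<close> is the absolutely continuous representative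
  of a function with weak derivative \<open>g\<close>.\<close>

definition weak_deriv :: "(real \<Rightarrow> complex) \<Rightarrow> (real \<Rightarrow> complex) \<Rightarrow> bool" where
  "weak_deriv f g \<longleftrightarrow> (\<forall>a b. a \<le> b \<longrightarrow> (g has_integral (f b - f a)) {a..b})"

text \<open>Each class in the Sobolev space \<open>H\<^sup>3(\<real>/P\<int>)\<close> is represented by its unique \<open>C\<^sup>2\<close> member.\<close>

definition H3_per :: "real \<Rightarrow> (real \<Rightarrow> complex) set" where
  "H3_per P = {w. (\<forall>x. w (x + P) = w x) \<and>
     (\<exists>w1 w2 w3. (\<forall>x. (w has_vector_derivative w1 x) (at x)) \<and>
                 (\<forall>x. (w1 has_vector_derivative w2 x) (at x)) \<and>
                 weak_deriv w2 w3 \<and> w3 \<in> L2_per P)}"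

text \<open>The graph of the unbounded operator \<open>\<partial>\<^sub>x \<circ> hess_op e u\<close> on \<open>L\<^sup>2(\<real>/P\<int>)\<close> with domain \<open>H\<^sup>3(\<real>/P\<int>)\<close>.\<close>

definition lin_graph ::
  "(real \<times> real \<Rightarrow> real) \<Rightarrow> (real \<Rightarrow> real) \<Rightarrow> real \<Rightarrow> ((real \<Rightarrow> complex) \<times> (real \<Rightarrow> complex)) set" where
  "lin_graph e u P = {(w, g). w \<in> H3_per P \<and> g \<in> L2_per P \<and> weak_deriv (hess_op e u w) g}"

text \<open>For the graph \<open>T\<close> of an operator \<open>A\<close>: \<open>A - z\<close> is a bijection from the domain onto
  \<open>L\<^sup>2(\<real>/P\<int>)\<close> with bounded inverse. Unique existence is meaningful because the domain consists of
  genuine functions, one in each class.\<close>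

definition resolvent_set_per ::
  "real \<Rightarrow> ((real \<Rightarrow> complex) \<times> (real \<Rightarrow> complex)) set \<Rightarrow> complex set" where
  "resolvent_set_per P T =
    {z. (\<forall>g\<in>L2_per P. \<exists>!w. (w, \<lambda>x. g x + z * w x) \<in> T) \<and>
        (\<exists>C. \<forall>(w, h)\<in>T. L2_norm_per P w \<le> C * L2_norm_per P (\<lambda>x. h x - z * w x))}"

definition spectrum_per ::
  "real \<Rightarrow> ((real \<Rightarrow> complex) \<times> (real \<Rightarrow> complex)) set \<Rightarrow> complex set" where
  "spectrum_per P T = - resolvent_set_per P T"

definition spectrally_stable :: "(real \<times> real \<Rightarrow> real) \<Rightarrow> real \<Rightarrow> (real \<Rightarrow> real) \<Rightarrow> real \<Rightarrow> bool" where
  "spectrally_stable e c u P \<longleftrightarrow>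
     (\<forall>z \<in> spectrum_per P (lin_graph (add_impulse e c) u P). Re z = 0)"

definition spectrally_unstable :: "(real \<times> real \<Rightarrow> real) \<Rightarrow> real \<Rightarrow> (real \<Rightarrow> real) \<Rightarrow> real \<Rightarrow> bool" where
  "spectrally_unstable e c u P \<longleftrightarrow> \<not> spectrally_stable e c u P"

end

theory Submission
  imports Defs
begin

text \<open>
  At real spectral parameter \<open>r\<close> everything is real. Differentiating the two profile equations along the
  family gives \<open>a v\<^sub>x = 0\<close>, \<open>a v\<^sub>\<mu> = 0\<close>, \<open>a v\<^sub>\<lambda> = 1\<close>, \<open>a v\<^sub>c = - v\<close> and the Wronskians of these functions with
  \<open>v\<^sub>x\<close>. Hence the solutions of \<open>(a w)\<^sub>x = r w\<close> with the initial jets of \<open>v\<^sub>x - r v\<^sub>c\<close>, \<open>v\<^sub>\<mu>\<close>, \<open>v\<^sub>\<lambda>\<close> stay close to these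
  functions. The jumps over a period of \<open>a w\<close> and of \<open>\<kappa> (v\<^sub>x w\<^sub>x - v\<^sub>x\<^sub>x w) + v a w\<close> are \<open>r \<integral> w\<close> and \<open>r \<integral> v w\<close>, which
  produces two factors \<open>r\<close>; the third one comes from the periodicity of \<open>v\<^sub>x\<close>. What remains is the
  Jacobian of \<open>(\<Upsilon>, - \<integral> v, \<integral> v\<^sup>2 / 2)\<close>, which is the gradient of the action.

  For large \<open>r\<close> an energy identity excludes periodic solutions, uniformly along the homotopy from \<open>a\<close> to
  \<open>- \<partial>\<^sub>x\<^sup>2\<close>, so the sign of the determinant is the one for constant coefficients. If the Hessian
  determinant is positive, the intermediate value theorem gives a zero \<open>r > 0\<close> of the Evans function, that
  is, an unstable eigenvalue.
\<close>

section \<open>Linear differential equations\<close>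

text \<open>The Evans function vanishes to third order at r = 0, so a direct expansion of the
  fundamental matrix would call for its derivatives in r. Instead, the monodromy matrix minus the
  identity is multiplied by a matrix of functionals \<open>R\<close> and a matrix of initial jets
  \<open>V0\<close>. The product carries the factor r^3 exactly, for every r other than 0, and what
  is left needs only a Gronwall estimate of order r. This dictates the combination v_x - r v_c:
  since a (v_x - r v_c) = r v has derivative r v_x, it solves the equation up to O(r^2), so its
  difference from v_x may be divided by r.

  The Wronskian of v_x and v_\<mu>, multiplied by \<kappa>, equals 1, so (v_x, v_xx) does not vanish
  at 0; its squared length is the normalization that cancels in the end.

  For large r the growth of solutions is hard to compute when the coefficients vary. To transport a
  sign along a path of coefficients, however, only nonvanishing is needed, and a zero at real r is a
  periodic real solution, to which an integrated quadratic identity applies.\<close>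

lemma gronwall_norm_sq:
  fixes D D' :: "real \<Rightarrow> 'a::real_inner"
  assumes D: "\<And>x. 0 \<le> x \<Longrightarrow> x \<le> T \<Longrightarrow> (D has_vector_derivative D' x) (at x)"
    and D': "\<And>x. 0 \<le> x \<Longrightarrow> x \<le> T \<Longrightarrow> norm (D' x) \<le> M * norm (D x) + \<epsilon>"
    and "D 0 = 0" "0 \<le> M" "0 \<le> x" "x \<le> T"
  shows "(norm (D x))\<^sup>2 \<le> \<epsilon>\<^sup>2 * T * exp ((2 * M + 1) * T)"
proof -
  \<comment> \<open>The squared norm stays differentiable where \<open>D\<close> vanishes. The
    weight absorbs \<open>2 * M\<close>; its extra 1 comes from 2 |D| \<epsilon> \<le> |D|^2 +
    \<epsilon>^2, and the subtracted \<open>\<epsilon>\<^sup>2 * y\<close> pays for the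
    rest.\<close>
  define K where "K = 2 * M + 1"
  define \<phi> where "\<phi> y = (D y \<bullet> D y) * exp (- K * y) - \<epsilon>\<^sup>2 * y" for y
  have "\<phi> x \<le> \<phi> 0"
  proof (rule DERIV_nonpos_imp_nonincreasing[OF \<open>0 \<le> x\<close>])
    fix y assume "0 \<le> y" "y \<le> x"
    then have y: "0 \<le> y" "y \<le> T" using assms by auto
    have 1: "((\<lambda>y. D y \<bullet> D y) has_real_derivative 2 * (D y \<bullet> D' y)) (at y)"
      using has_derivative_inner[OF D[OF y, unfolded has_vector_derivative_def] D[OF y, unfolded has_vector_derivative_def]]
      unfolding has_field_derivative_def
      by (rule has_derivative_eq_rhs) (auto simp: fun_eq_iff inner_commute algebra_simps)
    have 2: "(\<phi> has_real_derivative
        2 * (D y \<bullet> D' y) * exp (- K * y) - K * exp (- K * y) * (D y \<bullet> D y) - \<epsilon>\<^sup>2) (at y)"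
      unfolding \<phi>_def by (rule derivative_eq_intros 1 refl)+ (simp add: algebra_simps)
    have "2 * (D y \<bullet> D' y) \<le> 2 * (norm (D y) * norm (D' y))"
      using norm_cauchy_schwarz[of "D y" "D' y"] by simp
    also have "\<dots> \<le> 2 * (norm (D y) * (M * norm (D y) + \<epsilon>))"
      using D'[OF y] by (intro mult_left_mono) auto
    also have "\<dots> \<le> K * (norm (D y))\<^sup>2 + \<epsilon>\<^sup>2"
      using zero_le_power2[of "norm (D y) - \<epsilon>"]
      unfolding K_def by (simp add: power2_eq_square algebra_simps)
    finally have 3: "2 * (D y \<bullet> D' y) - K * (D y \<bullet> D y) \<le> \<epsilon>\<^sup>2"
      by (simp add: power2_norm_eq_inner)
    have "0 \<le> K * y" using y \<open>0 \<le> M\<close> by (simp add: K_def)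
    then have "exp (- K * y) \<le> 1" by simp
    have "(2 * (D y \<bullet> D' y) - K * (D y \<bullet> D y)) * exp (- K * y) \<le> \<epsilon>\<^sup>2 * exp (- K * y)"
      using 3 by (intro mult_right_mono) auto
    also have "\<dots> \<le> \<epsilon>\<^sup>2 * 1" using \<open>exp (- K * y) \<le> 1\<close> by (intro mult_left_mono) auto
    finally have "2 * (D y \<bullet> D' y) * exp (- K * y) - K * exp (- K * y) * (D y \<bullet> D y) - \<epsilon>\<^sup>2 \<le> 0"
      by (simp add: algebra_simps)
    with 2 show "\<exists>z. (\<phi> has_real_derivative z) (at y) \<and> z \<le> 0" by blast
  qed
  then have "(D x \<bullet> D x) * exp (- K * x) \<le> \<epsilon>\<^sup>2 * x" by (simp add: \<phi>_def \<open>D 0 = 0\<close>)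
  then have "(D x \<bullet> D x) * exp (- K * x) * exp (K * x) \<le> \<epsilon>\<^sup>2 * x * exp (K * x)"
    by (intro mult_right_mono) auto
  then have "(norm (D x))\<^sup>2 \<le> \<epsilon>\<^sup>2 * x * exp (K * x)"
    by (simp add: power2_norm_eq_inner mult.assoc flip: exp_add)
  also have "\<dots> \<le> \<epsilon>\<^sup>2 * T * exp (K * T)"
    using assms unfolding K_def by (intro mult_mono) auto
  finally show ?thesis by (simp add: K_def)
qed

lemma continuous_has_antiderivative:
  fixes f :: "real \<Rightarrow> 'a::banach"
  assumes "continuous_on UNIV f"
  shows "\<exists>G. G 0 = 0 \<and> (\<forall>x. (G has_vector_derivative f x) (at x))"
proof -
  define G where "G x = (if 0 \<le> x then integral {0..x} f else - integral {x..0} f)" for x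
  have int: "f integrable_on {c..d}" for c d
    by (intro integrable_continuous_real continuous_on_subset[OF assms]) auto
  \<comment> \<open>A base point \<open>-T\<close> to the left of everything replaces the case
    distinction, so that the fundamental theorem applies across 0.\<close>
  have G: "G x = integral {-T..x} f - integral {-T..0} f" if "x \<in> {-T..T}" "0 < T" for x T
  proof (cases "0 \<le> x")
    case True
    then have "integral {-T..0} f + integral {0..x} f = integral {-T..x} f"
      using that by (intro Henstock_Kurzweil_Integration.integral_combine int) auto
    then show ?thesis using True by (simp add: G_def algebra_simps)
  next
    case False
    then have "integral {-T..x} f + integral {x..0} f = integral {-T..0} f"
      using that by (intro Henstock_Kurzweil_Integration.integral_combine int) auto
    then show ?thesis using False by (simp add: G_def algebra_simps)
  qed
  have "(G has_vector_derivative f x) (at x)" for x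
  proof -
    define T where "T = \<bar>x\<bar> + 1"
    have T: "0 < T" "x \<in> {-T<..<T}" by (auto simp: T_def)
    have "((\<lambda>y. integral {-T..y} f) has_vector_derivative f x) (at x within {-T..T})"
      using T by (intro integral_has_vector_derivative continuous_on_subset[OF assms]) auto
    then have "((\<lambda>y. integral {-T..y} f - integral {-T..0} f) has_vector_derivative f x) (at x)"
      using T at_within_interior[of x "{-T..T}"] by (auto intro!: derivative_eq_intros)
    then show ?thesis
      by (rule has_vector_derivative_transform_within_open[where S = "{-T<..<T}"])
        (use T in \<open>auto intro!: G[symmetric]\<close>)
  qed
  then show ?thesis by (intro exI[of _ G]) (simp add: G_def)
qed

lemma has_vector_derivative_reflect:
  assumes "(f has_vector_derivative f') (at (- x))"
  shows "((\<lambda>y. f (- y)) has_vector_derivative - f') (at x)"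
proof -
  have "((\<lambda>y::real. - y) has_vector_derivative - 1) (at x)"
    using has_vector_derivative_minus[OF has_vector_derivative_id] .
  from vector_diff_chain_at[OF this assms] show ?thesis by (simp add: o_def)
qed

text \<open>The weight exp (L |x|) reproduces itself under integration with a gain of 1 / L. A large
  \<open>L\<close> therefore makes the Picard operator contract on a whole interval, in both time
  directions.\<close>

lemma norm_le_exp_of_norm_deriv_le:
  fixes f f' :: "real \<Rightarrow> 'a::real_normed_vector"
  assumes f: "\<And>x. (f has_vector_derivative f' x) (at x)"
    and f': "\<And>x. \<bar>x\<bar> \<le> T \<Longrightarrow> norm (f' x) \<le> B * L * exp (L * \<bar>x\<bar>)"
    and "f 0 = 0" "0 \<le> B" "\<bar>x\<bar> \<le> T"
  shows "norm (f x) \<le> B * exp (L * \<bar>x\<bar>)"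
proof -
  have pos: "norm (g b) \<le> B * exp (L * b)"
    if g: "\<And>x. (g has_vector_derivative g' x) (at x)"
      and g': "\<And>x. \<bar>x\<bar> \<le> T \<Longrightarrow> norm (g' x) \<le> B * L * exp (L * \<bar>x\<bar>)"
      and b: "0 < b" "b \<le> T" and "g 0 = 0" for g g' :: "real \<Rightarrow> 'a" and b
  proof -
    have "norm (g b - g 0) \<le> B * exp (L * b) - B * exp (L * 0)"
    proof (rule differentiable_bound_general[OF \<open>0 < b\<close>])
      show "continuous_on {0..b} g"
        by (rule continuous_on_vector_derivative)
          (rule has_vector_derivative_at_within[OF g])
      fix x assume x: "0 < x" "x < b"
      show "(g has_vector_derivative g' x) (at x)" by fact
      show "((\<lambda>x. B * exp (L * x)) has_vector_derivative B * L * exp (L * x)) (at x)"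
        unfolding has_real_derivative_iff_has_vector_derivative[symmetric]
        by (rule derivative_eq_intros refl)+ simp
      show "norm (g' x) \<le> B * L * exp (L * x)" using g'[of x] x b by simp
    qed (intro continuous_intros)
    then show ?thesis using \<open>0 \<le> B\<close> \<open>g 0 = 0\<close> by simp
  qed
  consider "x = 0" | "0 < x" | "x < 0" by linarith
  then show ?thesis
  proof cases
    case 2
    then show ?thesis using pos[OF f f', of x] assms(3-5) by simp
  next
    case 3
    have "((\<lambda>y. f (- y)) has_vector_derivative - f' (- y)) (at y)" for y
      by (rule has_vector_derivative_reflect[OF f])
    from pos[OF this, of "-x"] have "norm (f (- (- x))) \<le> B * exp (L * - x)"
      using 3 assms(3-5) f'[of "- y" for y] by fastforce
    then show ?thesis using 3 by simp
  qed (use assms in simp)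
qed

lemma continuous_on_interval_bounded:
  fixes f :: "real \<Rightarrow> 'a::real_normed_vector"
  assumes "continuous_on {a..b} f"
  shows "\<exists>M>0. \<forall>x\<in>{a..b}. norm (f x) \<le> M"
proof -
  have "bounded (f ` {a..b})"
    by (intro compact_imp_bounded compact_continuous_image assms compact_Icc)
  then show ?thesis unfolding bounded_pos by blast
qed

text \<open>The solution is the series of Picard increments: the constant \<open>y0\<close>, then
  repeatedly the antiderivative of \<open>h\<close> applied to \<open>A\<close> and the previous
  term. The bilinear \<open>h\<close> covers matrix-vector and matrix-matrix systems at
  once.\<close>

lemma linear_ode_exists:
  fixes h :: "'a::real_normed_vector \<Rightarrow> 'b::banach \<Rightarrow> 'b"
  assumes h: "bounded_bilinear h" and A: "continuous_on UNIV (A :: real \<Rightarrow> 'a)"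
  shows "\<exists>y. y 0 = y0 \<and> (\<forall>x. (y has_vector_derivative h (A x) (y x)) (at x))"
proof -
  interpret bounded_bilinear h by fact
  obtain K where K: "0 < K" "\<And>a b. norm (h a b) \<le> norm a * norm b * K"
    using pos_bounded by blast
  define ad where "ad f = (SOME G. G 0 = 0 \<and> (\<forall>x. (G has_vector_derivative f x) (at x)))"
    for f :: "real \<Rightarrow> 'b"
  have ad: "ad f 0 = 0" "(ad f has_vector_derivative f x) (at x)" if "continuous_on UNIV f" for f x
    using someI_ex[OF continuous_has_antiderivative[OF that]] unfolding ad_def by auto
  define d where "d n = ((\<lambda>f. ad (\<lambda>s. h (A s) (f s))) ^^ n) (\<lambda>_. y0)" for n
  have d_Suc: "d (Suc n) = ad (\<lambda>s. h (A s) (d n s))" for n by (simp add: d_def)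
  have d_cont: "continuous_on UNIV (d n)" for n
  proof (induction n)
    case 0
    then show ?case by (simp add: d_def)
  next
    case (Suc n)
    have "continuous_on UNIV (\<lambda>s. h (A s) (d n s))"
      by (intro continuous_on A Suc)
    from ad(2)[OF this] show ?case
      unfolding d_Suc by (intro continuous_on_vector_derivative) (auto)
  qed
  have hd_cont: "continuous_on UNIV (\<lambda>s. h (A s) (d n s))" for n
    by (intro continuous_on A d_cont)
  note dS = ad[OF hd_cont, folded d_Suc]
  define Y where "Y x = (\<Sum>n. d n x)" for x
  have main: "(\<lambda>n. d n x) sums Y x \<and> (Y has_vector_derivative h (A x) (Y x)) (at x)" for x
  proof -
    define T where "T = \<bar>x\<bar> + 1"
    define S where "S = {-T<..<T}"
    have T: "0 < T" "x \<in> S" "open S" "convex S" by (auto simp: T_def S_def)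
    obtain M where M: "0 < M" "\<And>y. y \<in> {-T..T} \<Longrightarrow> norm (A y) \<le> M"
      using continuous_on_interval_bounded[OF continuous_on_subset[OF A subset_UNIV]] by metis
    \<comment> \<open>The factor 2 halves the bound at each increment in the weighted norm, so a
      geometric series dominates on [-T, T].\<close>
    define L where "L = 2 * K * M"
    have L: "L > 0" using K M by (simp add: L_def)
    have bnd: "\<bar>y\<bar> \<le> T \<Longrightarrow> norm (d n y) \<le> norm y0 * (1/2) ^ n * exp (L * \<bar>y\<bar>)" for n y
    proof (induction n arbitrary: y)
      case 0
      have "norm y0 * 1 \<le> norm y0 * exp (L * \<bar>y\<bar>)"
        using L by (intro mult_left_mono) auto
      then show ?case by (simp add: d_def)
    next
      case (Suc n)
      show ?case
      proof (rule norm_le_exp_of_norm_deriv_le[OF dS(2) _ dS(1) _ Suc.prems])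
        fix z assume z: "\<bar>z\<bar> \<le> T"
        have Az: "norm (A z) \<le> M" using z by (intro M(2)) auto
        have "norm (h (A z) (d n z)) \<le> norm (A z) * norm (d n z) * K" by (rule K)
        also have "\<dots> \<le> M * (norm y0 * (1/2) ^ n * exp (L * \<bar>z\<bar>)) * K"
          using Az Suc.IH[OF z] K(1) M(1) by (intro mult_right_mono mult_mono) auto
        finally show "norm (h (A z) (d n z)) \<le> norm y0 * (1/2) ^ Suc n * L * exp (L * \<bar>z\<bar>)"
          by (simp add: L_def algebra_simps)
      qed auto
    qed
    have bnd': "norm (d n y) \<le> norm y0 * exp (L * T) * (1/2) ^ n" if "y \<in> {-T..T}" for n y
    proof -
      have "norm (d n y) \<le> norm y0 * (1/2) ^ n * exp (L * \<bar>y\<bar>)" using that by (intro bnd) auto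
      also have "\<dots> \<le> norm y0 * (1/2) ^ n * exp (L * T)"
        using that L by (intro mult_left_mono) auto
      finally show ?thesis by (simp add: algebra_simps)
    qed
    have sm: "summable (\<lambda>n. norm y0 * exp (L * T) * (1/2) ^ n)"
      by (intro summable_mult summable_geometric) auto
    have ul: "uniform_limit {-T..T} (\<lambda>n y. \<Sum>i<n. d i y) Y sequentially"
      unfolding Y_def by (rule Weierstrass_m_test[OF bnd' sm])
    have sums: "(\<lambda>n. d n y) sums Y y" if "y \<in> {-T..T}" for y
      unfolding sums_def using tendsto_uniform_limitI[OF ul that] .
    \<comment> \<open>The zeroth increment is constant, so termwise derivatives are shifted by one
      index: the derivative of a partial sum is \<open>h\<close> of \<open>A\<close> and the partial
      sum with one term fewer. Uniform convergence of the derivatives thus reduces to that of the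
      series.\<close>
    have sumsA: "(\<Sum>i<Suc n. if i = 0 then 0 else h (A y) (d (i - 1) y)) = h (A y) (\<Sum>i<n. d i y)" for n y
      by (subst sum.lessThan_Suc_shift) (simp add: sum_right)
    have "\<exists>g. \<forall>y\<in>S. (\<lambda>n. d n y) sums (g y) \<and>
        (g has_derivative (\<lambda>t. t *\<^sub>R h (A y) (Y y))) (at y within S)"
    proof (rule has_derivative_series[where x = x and f' = "\<lambda>n y t. t *\<^sub>R (if n = 0 then 0 else h (A y) (d (n - 1) y))"])
      fix n y assume "y \<in> S"
      show "(d n has_derivative (\<lambda>t. t *\<^sub>R (if n = 0 then 0 else h (A y) (d (n - 1) y)))) (at y within S)"
      proof (cases n)
        case 0
        then show ?thesis by (simp add: d_def)
      next
        case (Suc k)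
        then show ?thesis using dS(2)[of k y]
          by (simp add: has_vector_derivative_def has_derivative_at_withinI)
      qed
    next
      fix \<epsilon> :: real assume "\<epsilon> > 0"
      then have "\<forall>\<^sub>F n in sequentially. \<forall>y\<in>{-T..T}. dist (\<Sum>i<n. d i y) (Y y) < \<epsilon> / (M * K)"
        using K M by (intro uniform_limitD[OF ul]) auto
      then have "\<forall>\<^sub>F n in sequentially. \<forall>y\<in>S. \<forall>t.
          norm ((\<Sum>i<Suc n. t *\<^sub>R (if i = 0 then 0 else h (A y) (d (i - 1) y))) - t *\<^sub>R h (A y) (Y y)) \<le> \<epsilon> * norm t"
      proof eventually_elim
        case (elim n)
        show ?case
        proof (intro ballI allI)
          fix y t assume y: "y \<in> S"
          have "norm ((\<Sum>i<Suc n. t *\<^sub>R (if i = 0 then 0 else h (A y) (d (i - 1) y))) - t *\<^sub>R h (A y) (Y y))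
              = norm t * norm (h (A y) ((\<Sum>i<n. d i y) - Y y))"
            unfolding scaleR_sum_right[symmetric] sumsA
            by (simp flip: scaleR_diff_right diff_right)
          also have "\<dots> \<le> norm t * (norm (A y) * norm ((\<Sum>i<n. d i y) - Y y) * K)"
            by (intro mult_left_mono K) auto
          also have "\<dots> \<le> norm t * (M * (\<epsilon> / (M * K)) * K)"
            using y elim M K \<open>\<epsilon> > 0\<close>
            by (intro mult_left_mono mult_right_mono mult_mono) (auto simp: S_def dist_norm less_imp_le)
          finally show "norm ((\<Sum>i<Suc n. t *\<^sub>R (if i = 0 then 0 else h (A y) (d (i - 1) y))) - t *\<^sub>R h (A y) (Y y)) \<le> \<epsilon> * norm t"
            using M K by (simp add: algebra_simps)
        qed
      qed
      then show "\<forall>\<^sub>F n in sequentially. \<forall>y\<in>S. \<forall>t.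
          norm ((\<Sum>i<n. t *\<^sub>R (if i = 0 then 0 else h (A y) (d (i - 1) y))) - t *\<^sub>R h (A y) (Y y)) \<le> \<epsilon> * norm t"
        by (subst eventually_sequentially_Suc[symmetric])
    next
      show "(\<lambda>n. d n x) sums Y x" using T by (intro sums) (auto simp: S_def)
    qed (use T in auto)
    then obtain g where g: "\<And>y. y \<in> S \<Longrightarrow> (\<lambda>n. d n y) sums g y"
      "\<And>y. y \<in> S \<Longrightarrow> (g has_derivative (\<lambda>t. t *\<^sub>R h (A y) (Y y))) (at y within S)" by blast
    have gY: "g y = Y y" if "y \<in> S" for y
      using g(1)[OF that] by (simp add: Y_def sums_iff)
    have "(g has_vector_derivative h (A x) (Y x)) (at x)"
      using g(2)[of x] T at_within_open[of x S] by (simp add: has_vector_derivative_def)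
    then have "(Y has_vector_derivative h (A x) (Y x)) (at x)"
      by (rule has_vector_derivative_transform_within_open[where S = S]) (use T gY in auto)
    moreover have "(\<lambda>n. d n x) sums Y x" using T by (intro sums) (auto simp: S_def)
    ultimately show ?thesis by blast
  qed
  have "Y 0 = (\<Sum>n\<in>{0::nat}. d n 0)"
    unfolding Y_def by (intro suminf_finite) (use dS(1) in \<open>auto simp: gr0_conv_Suc\<close>)
  then have "Y 0 = y0" by (simp add: d_def)
  with main show ?thesis by blast
qed

text \<open>Forward in time this is Gronwall with zero error; backward in time the reflected
  function solves an equation of the same kind with coefficient -A(-t).\<close>

lemma linear_ode_unique_zero:
  fixes h :: "'a::real_normed_vector \<Rightarrow> 'b::real_inner \<Rightarrow> 'b"
  assumes h: "bounded_bilinear h" and A: "continuous_on UNIV (A :: real \<Rightarrow> 'a)"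
    and y: "\<And>x. (y has_vector_derivative h (A x) (y x)) (at x)" and "y 0 = 0"
  shows "y x = 0"
proof -
  interpret bounded_bilinear h by fact
  obtain K where K: "0 < K" "\<And>a b. norm (h a b) \<le> norm a * norm b * K"
    using pos_bounded by blast
  have fwd: "z T = 0" if B: "continuous_on UNIV B" and "0 \<le> T" "z 0 = 0"
    and z: "\<And>x. (z has_vector_derivative h (B x) (z x)) (at x)" for B z T
  proof -
    obtain M where M: "0 < M" "\<And>y. y \<in> {0..T} \<Longrightarrow> norm (B y) \<le> M"
      using continuous_on_interval_bounded[OF continuous_on_subset[OF B subset_UNIV]] by metis
    have "(norm (z T))\<^sup>2 \<le> 0\<^sup>2 * T * exp ((2 * (M * K) + 1) * T)"
    proof (rule gronwall_norm_sq[OF z])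
      fix x assume x: "0 \<le> x" "x \<le> T"
      have "norm (h (B x) (z x)) \<le> norm (B x) * norm (z x) * K" by (rule K)
      also have "\<dots> \<le> M * norm (z x) * K" using M(2)[of x] x K(1) by (intro mult_right_mono) auto
      finally show "norm (h (B x) (z x)) \<le> M * K * norm (z x) + 0" by (simp add: algebra_simps)
    qed (use that(2,3) M(1) K(1) in auto)
    then show ?thesis by simp
  qed
  show ?thesis
  proof (cases "0 \<le> x")
    case True
    show ?thesis by (rule fwd[of A x y, OF A True \<open>y 0 = 0\<close> y])
  next
    case False
    have "((\<lambda>t. y (- t)) has_vector_derivative h (- A (- t)) (y (- t))) (at t)" for t
      unfolding minus_left by (rule has_vector_derivative_reflect[OF y])
    moreover have "continuous_on UNIV (\<lambda>t. - A (- t))"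
      by (intro continuous_intros continuous_on_compose2[OF A]) auto
    ultimately have "y (- (- x)) = 0"
      using False \<open>y 0 = 0\<close> fwd[of "\<lambda>t. - A (- t)" "- x" "\<lambda>t. y (- t)"] by simp
    then show ?thesis by simp
  qed
qed

section \<open>Matrix systems: fundamental matrix and dependence on parameters\<close>

lemma bounded_bilinear_matrix_matrix_mult:
  "bounded_bilinear ((**) :: 'a::{real_normed_algebra_1,euclidean_space}^'n^'m \<Rightarrow> 'a^'p^'n \<Rightarrow> 'a^'p^'m)"
  unfolding bilinear_conv_bounded_bilinear[symmetric] bilinear_def
  by (auto simp: linear_iff matrix_matrix_mult_def vec_eq_iff sum.distrib algebra_simps scaleR_sum_right)

lemma bounded_bilinear_matrix_vector_mult:
  "bounded_bilinear ((*v) :: 'a::{real_normed_algebra_1,euclidean_space}^'n^'m \<Rightarrow> 'a^'n \<Rightarrow> 'a^'m)"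
  unfolding bilinear_conv_bounded_bilinear[symmetric] bilinear_def
  by (auto simp: linear_iff matrix_vector_mult_def vec_eq_iff sum.distrib algebra_simps scaleR_sum_right)

lemma has_vector_derivative_vec_iff:
  fixes Y :: "real \<Rightarrow> real^'n"
  shows "(Y has_vector_derivative Y') (at x) \<longleftrightarrow>
    (\<forall>i. ((\<lambda>x. Y x $ i) has_real_derivative Y' $ i) (at x))"
proof
  assume "(Y has_vector_derivative Y') (at x)"
  then show "\<forall>i. ((\<lambda>x. Y x $ i) has_real_derivative Y' $ i) (at x)"
    unfolding has_real_derivative_iff_has_vector_derivative
    by (auto intro!: bounded_linear.has_vector_derivative[OF bounded_linear_vec_nth])
next
  assume *: "\<forall>i. ((\<lambda>x. Y x $ i) has_real_derivative Y' $ i) (at x)"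
  have "((\<lambda>x. \<Sum>i\<in>UNIV. (Y x $ i) *\<^sub>R axis i (1::real)) has_vector_derivative
      (\<Sum>i\<in>UNIV. (Y' $ i) *\<^sub>R axis i (1::real))) (at x)"
    using * by (auto intro!: has_vector_derivative_sum derivative_eq_intros)
  moreover have "(\<Sum>i\<in>UNIV. (z $ i) *\<^sub>R axis i (1::real)) = z" for z :: "real^'n"
    using basis_expansion[of z] by (simp add: scalar_mult_eq_scaleR)
  ultimately show "(Y has_vector_derivative Y') (at x)" by simp
qed

lemma continuous_on_matrix:
  fixes A :: "'a::topological_space \<Rightarrow> 'b::topological_space^'n^'m"
  assumes "\<And>i j. continuous_on S (\<lambda>x. A x $ i $ j)"
  shows "continuous_on S A"
proof -
  have "continuous_on S (\<lambda>x. \<chi> i j. A x $ i $ j)" by (intro continuous_on_vec_lambda assms)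
  then show ?thesis by simp
qed

lemma continuous_on_companion:
  fixes f g h :: "'a::topological_space \<Rightarrow> real"
  assumes "continuous_on S f" "continuous_on S g" "continuous_on S h"
  shows "continuous_on S (\<lambda>x. vector [vector [0, 1, 0], vector [0, 0, 1], vector [f x, g x, h x]] :: real^3^3)"
proof (rule continuous_on_matrix)
  fix i j :: 3
  show "continuous_on S (\<lambda>x. (vector [vector [0, 1, 0], vector [0, 0, 1], vector [f x, g x, h x]] :: real^3^3) $ i $ j)"
    using exhaust_3[of i] exhaust_3[of j] assms by (elim disjE) simp_all
qed

definition fund :: "(real \<Rightarrow> real^'n^'n) \<Rightarrow> real \<Rightarrow> real^'n^'n" where
  "fund A = (SOME F. F 0 = mat 1 \<and> (\<forall>x. (F has_vector_derivative A x ** F x) (at x)))"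

lemma fund:
  assumes "continuous_on UNIV A"
  shows fund_0: "fund A 0 = mat 1"
    and fund_deriv: "(fund A has_vector_derivative A x ** fund A x) (at x)"
  using someI_ex[OF linear_ode_exists[OF bounded_bilinear_matrix_matrix_mult assms, of "mat 1"]]
  unfolding fund_def[symmetric] by auto

lemma fund_vec_deriv:
  assumes "continuous_on UNIV A"
  shows "((\<lambda>x. fund A x *v y) has_vector_derivative A x *v (fund A x *v y)) (at x)"
  using bounded_bilinear.has_vector_derivative[OF bounded_bilinear_matrix_vector_mult
      fund_deriv[OF assms] has_vector_derivative_const[of y]]
  by (simp add: matrix_vector_mul_assoc)

lemma linear_system_unique:
  fixes A :: "real \<Rightarrow> real^'n^'n"
  assumes A: "continuous_on UNIV A"
    and Y: "\<And>x. (Y has_vector_derivative A x *v Y x) (at x)"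
    and Z: "\<And>x. (Z has_vector_derivative A x *v Z x) (at x)" and "Y 0 = Z 0"
  shows "Y x = Z x"
proof -
  have "((\<lambda>x. Y x - Z x) has_vector_derivative A x *v (Y x - Z x)) (at x)" for x
    using has_vector_derivative_diff[OF Y Z] by (simp add: matrix_vector_mult_diff_distrib)
  from linear_ode_unique_zero[OF bounded_bilinear_matrix_vector_mult A this, of x]
  show ?thesis using assms by simp
qed

text \<open>\<open>J\<close> solves the system up to the residual \<open>f\<close>. The constant
  depends on \<open>T\<close> and \<open>M\<close> only and is uniform over all systems with this
  bound; it serves both the continuity in a parameter and the limit r to 0.\<close>

lemma fund_approx:
  fixes T M :: real
  assumes "0 \<le> T"
  shows "\<exists>C>0. \<forall>(A :: real \<Rightarrow> real^'n^'n) J f \<epsilon>. \<forall>x\<in>{0..T}. continuous_on UNIV A \<longrightarrow> 0 \<le> \<epsilon> \<longrightarrow>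
    (\<forall>x\<in>{0..T}. norm (A x) \<le> M) \<longrightarrow> (\<forall>x\<in>{0..T}. norm (f x) \<le> \<epsilon>) \<longrightarrow>
    (\<forall>x\<in>{0..T}. (J has_vector_derivative A x *v J x + f x) (at x)) \<longrightarrow>
    norm (fund A x *v J 0 - J x) \<le> C * \<epsilon>"
proof -
  obtain K where K: "0 < K" "\<And>(A::real^'n^'n) b. norm (A *v b) \<le> norm A * norm b * K"
    using bounded_bilinear.pos_bounded[OF bounded_bilinear_matrix_vector_mult] by blast
  define C where "C = sqrt (T * exp ((2 * (\<bar>M\<bar> * K) + 1) * T)) + 1"
  have C: "C > 0" using assms by (simp add: C_def add_nonneg_pos)
  show ?thesis
  proof (intro exI[of _ C] conjI allI ballI impI C)
    fix A :: "real \<Rightarrow> real^'n^'n" and J f \<epsilon> x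
    assume x: "x \<in> {0..T}" and A: "continuous_on UNIV A" and \<epsilon>: "0 \<le> \<epsilon>"
      and M: "\<forall>x\<in>{0..T}. norm (A x) \<le> M" and f: "\<forall>x\<in>{0..T}. norm (f x) \<le> \<epsilon>"
      and J: "\<forall>x\<in>{0..T}. (J has_vector_derivative A x *v J x + f x) (at x)"
    define D where "D x = fund A x *v J 0 - J x" for x
    have "(norm (D x))\<^sup>2 \<le> \<epsilon>\<^sup>2 * T * exp ((2 * (\<bar>M\<bar> * K) + 1) * T)"
    proof (rule gronwall_norm_sq[where D' = "\<lambda>x. A x *v D x - f x"])
      fix y assume y: "0 \<le> y" "y \<le> T"
      then have "(J has_vector_derivative A y *v J y + f y) (at y)" using J by simp
      from has_vector_derivative_diff[OF fund_vec_deriv[OF A] this]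
      show "(D has_vector_derivative A y *v D y - f y) (at y)"
        unfolding D_def by (simp add: matrix_vector_mult_diff_distrib algebra_simps)
      have "norm (A y *v D y - f y) \<le> norm (A y *v D y) + norm (f y)" by (rule norm_triangle_ineq4)
      also have "norm (A y *v D y) \<le> norm (A y) * norm (D y) * K" by (rule K)
      also have "\<dots> \<le> \<bar>M\<bar> * norm (D y) * K"
        using M y K(1) by (intro mult_right_mono) (auto intro: order_trans[OF _ abs_ge_self])
      finally show "norm (A y *v D y - f y) \<le> \<bar>M\<bar> * K * norm (D y) + \<epsilon>"
        using f y by (auto simp: algebra_simps intro: add_left_mono order_trans)
    qed (use x K(1) in \<open>auto simp: D_def fund_0[OF A]\<close>)
    also have "\<dots> = (\<epsilon> * (C - 1))\<^sup>2"
      using assms by (simp add: C_def power_mult_distrib)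
    finally have "norm (D x) \<le> \<epsilon> * (C - 1)"
      by (rule power2_le_imp_le) (use \<epsilon> assms in \<open>simp add: C_def\<close>)
    also have "\<dots> \<le> C * \<epsilon>" using \<epsilon> by (simp add: algebra_simps)
    finally show "norm (fund A x *v J 0 - J x) \<le> C * \<epsilon>" unfolding D_def .
  qed
qed

text \<open>A solution for the parameter s solves the system for a nearby t with residual (A s - A
  t) J, which uniform continuity on the compact set makes small on the whole interval.\<close>

lemma fund_continuous_param:
  fixes A :: "real \<Rightarrow> real \<Rightarrow> real^'n^'n"
  assumes S: "compact S" and "0 \<le> T"
    and cont: "continuous_on (S \<times> {0..T}) (\<lambda>(s, x). A s x)"
    and A: "\<And>s. s \<in> S \<Longrightarrow> continuous_on UNIV (A s)"
  shows "continuous_on S (\<lambda>s. fund (A s) T)"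
proof -
  have cpt: "compact (S \<times> {0..T})" using S by (intro compact_Times) auto
  then have "bounded ((\<lambda>(s, x). A s x) ` (S \<times> {0..T}))"
    by (intro compact_imp_bounded compact_continuous_image cont)
  then obtain M where M: "\<And>s x. s \<in> S \<Longrightarrow> x \<in> {0..T} \<Longrightarrow> norm (A s x) \<le> M"
    unfolding bounded_iff by fastforce
  obtain C where C: "C > 0" and approx: "\<And>A :: real \<Rightarrow> real^'n^'n. \<And>J f \<epsilon> x. \<lbrakk>x \<in> {0..T};
     continuous_on UNIV A; 0 \<le> \<epsilon>; \<forall>x\<in>{0..T}. norm (A x) \<le> M; \<forall>x\<in>{0..T}. norm (f x) \<le> \<epsilon>;
     \<forall>x\<in>{0..T}. (J has_vector_derivative A x *v J x + f x) (at x)\<rbrakk>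
     \<Longrightarrow> norm (fund A x *v J 0 - J x) \<le> C * \<epsilon>"
    using fund_approx[OF \<open>0 \<le> T\<close>, of M, where 'n = 'n] by metis
  obtain K where K: "0 < K" "\<And>(A::real^'n^'n) b. norm (A *v b) \<le> norm A * norm b * K"
    using bounded_bilinear.pos_bounded[OF bounded_bilinear_matrix_vector_mult] by blast
  have uc: "uniformly_continuous_on (S \<times> {0..T}) (\<lambda>(s, x). A s x)"
    using compact_uniformly_continuous[OF cont cpt] .
  have "continuous_on S (\<lambda>s. fund (A s) T *v v)" for v
    unfolding continuous_on_iff
  proof (intro ballI allI impI)
    fix s and \<epsilon> :: real assume s: "s \<in> S" and \<epsilon>: "0 < \<epsilon>"
    define J where "J x = fund (A s) x *v v" for x
    have J: "(J has_vector_derivative A s x *v J x) (at x)" for x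
      unfolding J_def by (rule fund_vec_deriv[OF A[OF s]])
    have "continuous_on {0..T} J"
      by (rule continuous_on_vector_derivative) (rule has_vector_derivative_at_within[OF J])
    then obtain B where B: "0 < B" "\<And>x. x \<in> {0..T} \<Longrightarrow> norm (J x) \<le> B"
      using continuous_on_interval_bounded by metis
    \<comment> \<open>Chosen so that \<open>C\<close> times the residual bound is \<epsilon> /
      2.\<close>
    define \<eta> where "\<eta> = \<epsilon> / (2 * C * B * K)"
    have \<eta>: "\<eta> > 0" using \<epsilon> C B K by (simp add: \<eta>_def)
    obtain \<delta> where \<delta>: "\<delta> > 0" "\<And>p q. p \<in> S \<times> {0..T} \<Longrightarrow> q \<in> S \<times> {0..T} \<Longrightarrow> dist q p < \<delta> \<Longrightarrow>
        dist ((\<lambda>(s, x). A s x) q) ((\<lambda>(s, x). A s x) p) < \<eta>"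
      using uc \<eta> unfolding uniformly_continuous_on_def by metis
    show "\<exists>\<delta>>0. \<forall>t\<in>S. dist t s < \<delta> \<longrightarrow> dist (fund (A t) T *v v) (fund (A s) T *v v) < \<epsilon>"
    proof (intro exI[of _ \<delta>] conjI ballI impI \<delta>(1))
      fix t assume t: "t \<in> S" "dist t s < \<delta>"
      have "norm (fund (A t) T *v J 0 - J T) \<le> C * (\<eta> * B * K)"
      proof (rule approx[where f = "\<lambda>x. (A s x - A t x) *v J x"])
        show "\<forall>x\<in>{0..T}. norm ((A s x - A t x) *v J x) \<le> \<eta> * B * K"
        proof
          fix x assume x: "x \<in> {0..T}"
          have "norm (A s x - A t x) \<le> \<eta>"
            using \<delta>(2)[of "(t, x)" "(s, x)"] s t x
            by (auto simp: dist_Pair_Pair dist_commute dist_norm)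
          then have "norm (A s x - A t x) * norm (J x) * K \<le> \<eta> * B * K"
            using B(2)[OF x] K(1) \<eta> by (intro mult_right_mono mult_mono) auto
          with K(2) show "norm ((A s x - A t x) *v J x) \<le> \<eta> * B * K" by (rule order_trans)
        qed
        show "\<forall>x\<in>{0..T}. (J has_vector_derivative A t x *v J x + (A s x - A t x) *v J x) (at x)"
          using J by (simp add: matrix_vector_mult_diff_rdistrib)
      qed (use M A t \<eta> B(1) K(1) \<open>0 \<le> T\<close> in auto)
      also have "\<dots> < \<epsilon>" using \<epsilon> C B(1) K(1) by (simp add: \<eta>_def)
      finally show "dist (fund (A t) T *v v) (fund (A s) T *v v) < \<epsilon>"
        by (simp add: dist_norm J_def fund_0[OF A[OF s]])
    qed
  qed
  then have "continuous_on S (\<lambda>s. (fund (A s) T *v axis j 1) $ i)" for i j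
    by (intro continuous_intros)
  then have "continuous_on S (\<lambda>s. fund (A s) T $ i $ j)" for i j
    by (simp add: matrix_vector_mult_basis column_def)
  then show ?thesis by (rule continuous_on_matrix)
qed

lemma continuous_on_det_3:
  fixes A :: "'a::topological_space \<Rightarrow> real^3^3"
  assumes "continuous_on S A"
  shows "continuous_on S (\<lambda>x. det (A x))"
  unfolding det_3 by (intro continuous_intros assms)

section \<open>The third-order equation with periodic coefficients\<close>

lemma periodic_bounded:
  fixes f :: "real \<Rightarrow> real"
  assumes "continuous_on UNIV f" "\<And>x. f (x + P) = f x" "0 < P"
  shows "\<exists>M>0. \<forall>x. \<bar>f x\<bar> \<le> M"
proof -
  obtain M where M: "0 < M" "\<And>x. x \<in> {0..P} \<Longrightarrow> norm (f x) \<le> M"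
    using continuous_on_interval_bounded[OF continuous_on_subset[OF assms(1)]] by (metis subset_UNIV)
  interpret periodic_fun_simple f P by standard (rule assms)
  have "\<bar>f x\<bar> \<le> M" for x
  proof -
    define y where "y = x - of_int \<lfloor>x / P\<rfloor> * P"
    have "of_int \<lfloor>x / P\<rfloor> * P \<le> x" "x < (of_int \<lfloor>x / P\<rfloor> + 1) * P"
      using of_int_floor_le[of "x / P"] real_of_int_floor_add_one_gt[of "x / P"] \<open>0 < P\<close>
      by (simp_all only: pos_le_divide_eq pos_divide_less_eq)
    then have "y \<in> {0..P}" by (simp add: y_def algebra_simps)
    moreover have "f x = f y" using plus_of_int[of y "\<lfloor>x / P\<rfloor>"] by (simp add: y_def)
    ultimately show ?thesis using M by auto
  qed
  with M show ?thesis by blast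
qed

lemma periodic_deriv:
  fixes f f' :: "real \<Rightarrow> real"
  assumes "\<And>x. (f has_real_derivative f' x) (at x)" "\<And>x. f (x + P) = f x"
  shows "f' (x + P) = f' x"
  using DERIV_unique[OF assms(1)[of x]] DERIV_shift[of f "f' (x + P)" x P] assms by simp

definition comp_mat ::
  "(real \<Rightarrow> real) \<Rightarrow> (real \<Rightarrow> real) \<Rightarrow> (real \<Rightarrow> real) \<Rightarrow> (real \<Rightarrow> real) \<Rightarrow> (real \<Rightarrow> real) \<Rightarrow> real \<Rightarrow> real \<Rightarrow> real^3^3" where
  "comp_mat a a1 k k1 k2 r x = vector
     [vector [0, 1, 0], vector [0, 0, 1],
      vector [(a1 x - r) / k x, (a x - k2 x) / k x, - 2 * k1 x / k x]]"

lemma comp_mat_mult: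
  "comp_mat a a1 k k1 k2 r x *v Y =
    vector [Y $ 2, Y $ 3, ((a1 x - r) * Y $ 1 + (a x - k2 x) * Y $ 2 - 2 * k1 x * Y $ 3) / k x]"
  by (simp add: vec_eq_iff forall_3 comp_mat_def matrix_vector_mult_def sum_3 add_divide_distrib diff_divide_distrib left_diff_distrib)

definition monodromy_det ::
  "(real \<Rightarrow> real) \<Rightarrow> (real \<Rightarrow> real) \<Rightarrow> (real \<Rightarrow> real) \<Rightarrow> (real \<Rightarrow> real) \<Rightarrow> (real \<Rightarrow> real) \<Rightarrow> real \<Rightarrow> real \<Rightarrow> real" where
  "monodromy_det a a1 k k1 k2 P r = det (fund (comp_mat a a1 k k1 k2 r) P - mat 1)"

text \<open>The equation is \<open>(L w)' = r w\<close> with \<open>L w = a w - (k w')'\<close>; \<open>a1\<close>, \<open>k1\<close>, \<open>k2\<close> are the derivatives of the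
  coefficients, and \<open>comp_mat\<close> is the matrix of the system for \<open>(w, w', w'')\<close>.\<close>

locale third_order =
  fixes a a1 k k1 k2 :: "real \<Rightarrow> real" and P :: real
  assumes P_pos: "0 < P"
    and a_deriv: "\<And>x. (a has_real_derivative a1 x) (at x)"
    and k_deriv: "\<And>x. (k has_real_derivative k1 x) (at x)"
    and k1_deriv: "\<And>x. (k1 has_real_derivative k2 x) (at x)"
    and a1_cont: "continuous_on UNIV a1"
    and k2_cont: "continuous_on UNIV k2"
    and k_pos: "\<And>x. 0 < k x"
    and a_periodic: "\<And>x. a (x + P) = a x"
    and k_periodic: "\<And>x. k (x + P) = k x"
begin

abbreviation "A \<equiv> comp_mat a a1 k k1 k2"
abbreviation "d \<equiv> monodromy_det a a1 k k1 k2 P"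

definition "L Y x = a x * Y x $ 1 - k1 x * Y x $ 2 - k x * Y x $ 3"
  for Y :: "real \<Rightarrow> real^3"

lemmas periodic = a_periodic k_periodic periodic_deriv[OF a_deriv a_periodic]
  periodic_deriv[OF k_deriv k_periodic]
  periodic_deriv[OF k1_deriv periodic_deriv[OF k_deriv k_periodic]]

lemma conts: "continuous_on S a" "continuous_on S k" "continuous_on S k1"
  "continuous_on S a1" "continuous_on S k2"
  using DERIV_continuous_on[of S a a1] DERIV_continuous_on[of S k k1] DERIV_continuous_on[of S k1 k2]
    a_deriv k_deriv k1_deriv continuous_on_subset[OF a1_cont] continuous_on_subset[OF k2_cont]
  by (simp_all add: has_field_derivative_at_within)

lemma A_cont: "continuous_on S (A r)"
proof -
  have "k x \<noteq> 0" for x using k_pos[of x] by simp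
  then show ?thesis
    unfolding comp_mat_def by (intro continuous_on_companion continuous_intros conts) auto
qed

lemma A_cont_joint: "continuous_on S (\<lambda>(r, x). A r x)"
proof -
  have k0: "k x \<noteq> 0" for x using k_pos[of x] by simp
  have snd: "continuous_on S (\<lambda>z. f (snd z))" if "continuous_on UNIV f" for f :: "real \<Rightarrow> real"
    by (rule continuous_on_compose2[OF that]) (auto intro!: continuous_intros)
  show ?thesis
    unfolding case_prod_beta comp_mat_def
    by (intro continuous_on_companion continuous_intros conts snd) (auto simp: k0)
qed

lemma A_periodic: "A r (x + P) = A r x"
  by (simp add: comp_mat_def periodic)

text \<open>\<open>w\<close> need not solve the equation: its failure appears only in the last
  component, divided by the leading coefficient. This is the residual that is fed into
  \<open>fund_approx\<close>.\<close>

lemma jet_ode: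
  assumes "(w has_real_derivative w1 x) (at x)" "(w1 has_real_derivative w2 x) (at x)"
    "(w2 has_real_derivative w3) (at x)" "(L (\<lambda>x. vector [w x, w1 x, w2 x]) has_real_derivative h) (at x)"
  shows "((\<lambda>x. vector [w x, w1 x, w2 x] :: real^3) has_vector_derivative
    A r x *v vector [w x, w1 x, w2 x] + vector [0, 0, (r * w x - h) / k x]) (at x)"
proof -
  have "(L (\<lambda>x. vector [w x, w1 x, w2 x]) has_real_derivative
      (a1 x * w x + a x * w1 x) - (k2 x * w1 x + k1 x * w2 x) - (k1 x * w2 x + k x * w3)) (at x)"
    unfolding L_def by (auto intro!: derivative_eq_intros assms a_deriv k_deriv k1_deriv)
  from DERIV_unique[OF assms(4) this]
  have "w3 = ((a1 x - r) * w x + (a x - k2 x) * w1 x - 2 * k1 x * w2 x) / k x + (r * w x - h) / k x"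
    using k_pos[of x] by (simp add: nonzero_eq_divide_eq algebra_simps flip: add_divide_distrib)
  then show ?thesis
    unfolding has_vector_derivative_vec_iff forall_3 comp_mat_mult using assms by simp
qed

context
  fixes r and Y :: "real \<Rightarrow> real^3"
  assumes Y: "\<And>x. (Y has_vector_derivative A r x *v Y x) (at x)"
begin

lemma sol_deriv:
  "((\<lambda>x. Y x $ 1) has_real_derivative Y x $ 2) (at x)"
  "((\<lambda>x. Y x $ 2) has_real_derivative Y x $ 3) (at x)"
  "((\<lambda>x. Y x $ 3) has_real_derivative
     ((a1 x - r) * Y x $ 1 + (a x - k2 x) * Y x $ 2 - 2 * k1 x * Y x $ 3) / k x) (at x)"
  using Y[of x] unfolding has_vector_derivative_vec_iff forall_3 comp_mat_mult by simp_all

lemma sol_L: "(L Y has_real_derivative r * Y x $ 1) (at x)"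
  unfolding L_def
  by (rule derivative_eq_intros sol_deriv a_deriv k_deriv k1_deriv refl)+
    (use k_pos[of x] in \<open>simp add: field_simps\<close>)

lemma sol_periodic:
  assumes "Y P = Y 0"
  shows "Y (x + P) = Y x"
proof (rule linear_system_unique[OF A_cont])
  fix x
  show "((\<lambda>x. Y (x + P)) has_vector_derivative A r x *v Y (x + P)) (at x)"
    using Y[of "x + P"] unfolding has_vector_derivative_vec_iff A_periodic DERIV_shift .
qed (use Y assms in auto)

end

lemma singular_imp_periodic_solution:
  assumes "d r = 0"
  shows "\<exists>Y. (\<forall>x. (Y has_vector_derivative A r x *v Y x) (at x)) \<and> (\<forall>x. Y (x + P) = Y x) \<and> Y 0 \<noteq> 0"
proof -
  from assms obtain y where y: "y \<noteq> 0" "(fund (A r) P - mat 1) *v y = 0"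
    unfolding monodromy_det_def using invertible_det_nz matrix_left_invertible_ker invertible_left_inverse
    by metis
  define Y where "Y x = fund (A r) x *v y" for x
  have Y: "(Y has_vector_derivative A r x *v Y x) (at x)" for x
    unfolding Y_def by (rule fund_vec_deriv[OF A_cont])
  have "Y P = Y 0" "Y 0 = y"
    using y by (simp_all add: Y_def fund_0[OF A_cont] matrix_vector_mult_diff_rdistrib)
  with Y sol_periodic[OF Y] y show ?thesis by metis
qed

text \<open>A nonzero periodic solution would make \<open>\<Psi>\<close> below periodic and nondecreasing, hence constant.\<close>

lemma d_nonzero:
  assumes "0 < r" and wpos: "\<And>x. 0 < r - a1 x / 2 + C * a x" and w1pos: "\<And>x. 0 \<le> C * k x - k1 x / 2"
  shows "d r \<noteq> 0"
proof
  assume "d r = 0"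
  then obtain Y where Y: "\<And>x. (Y has_vector_derivative A r x *v Y x) (at x)"
    and per: "\<And>x. Y (x + P) = Y x" and "Y 0 \<noteq> 0"
    using singular_imp_periodic_solution by blast
  \<comment> \<open>The first three terms come from multiplying the equation by w and integrating by
    parts; their derivative is (r - a'/2) w^2 - k'/2 w'^2, whose last term has no sign. The bracket
    after \<open>C\<close> has derivative a w^2 + k w'^2, so a suitable \<open>C\<close> compensates
    it at the price of a larger r.\<close>
  define \<Psi> where "\<Psi> x = Y x $ 1 * L Y x - a x * (Y x $ 1)\<^sup>2 / 2 + k x * (Y x $ 2)\<^sup>2 / 2
    + C * (k x * Y x $ 1 * Y x $ 2 + (L Y x)\<^sup>2 / (2 * r))" for x
  define \<Psi>' where "\<Psi>' x = (r - a1 x / 2 + C * a x) * (Y x $ 1)\<^sup>2 + (C * k x - k1 x / 2) * (Y x $ 2)\<^sup>2" for x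
  have \<Psi>: "(\<Psi> has_real_derivative \<Psi>' x) (at x)" for x
  proof -
    have 1: "((\<lambda>x. Y x $ 1 * L Y x) has_real_derivative Y x $ 2 * L Y x + r * (Y x $ 1)\<^sup>2) (at x)"
      by (rule derivative_eq_intros sol_deriv[OF Y] sol_L[OF Y] refl)+ (simp add: power2_eq_square)
    have 2: "((\<lambda>x. a x * (Y x $ 1)\<^sup>2 / 2) has_real_derivative
        a1 x * (Y x $ 1)\<^sup>2 / 2 + a x * Y x $ 1 * Y x $ 2) (at x)"
      by (rule derivative_eq_intros sol_deriv[OF Y] a_deriv refl)+ (simp_all add: field_simps)
    have 3: "((\<lambda>x. k x * (Y x $ 2)\<^sup>2 / 2) has_real_derivative
        k1 x * (Y x $ 2)\<^sup>2 / 2 + k x * Y x $ 2 * Y x $ 3) (at x)"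
      by (rule derivative_eq_intros sol_deriv[OF Y] k_deriv refl)+ (simp_all add: field_simps)
    have 4: "((\<lambda>x. k x * Y x $ 1 * Y x $ 2) has_real_derivative
        k1 x * Y x $ 1 * Y x $ 2 + k x * (Y x $ 2)\<^sup>2 + k x * Y x $ 1 * Y x $ 3) (at x)"
      by (rule derivative_eq_intros sol_deriv[OF Y] k_deriv refl)+
        (simp add: algebra_simps power2_eq_square)
    have 5: "((\<lambda>x. (L Y x)\<^sup>2 / (2 * r)) has_real_derivative Y x $ 1 * L Y x) (at x)"
      by (rule derivative_eq_intros sol_L[OF Y] refl)+ (use \<open>0 < r\<close> in simp_all)
    have "\<Psi>' x = (Y x $ 2 * L Y x + r * (Y x $ 1)\<^sup>2) - (a1 x * (Y x $ 1)\<^sup>2 / 2 + a x * Y x $ 1 * Y x $ 2)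
        + (k1 x * (Y x $ 2)\<^sup>2 / 2 + k x * Y x $ 2 * Y x $ 3)
        + C * ((k1 x * Y x $ 1 * Y x $ 2 + k x * (Y x $ 2)\<^sup>2 + k x * Y x $ 1 * Y x $ 3) + Y x $ 1 * L Y x)"
      by (simp add: \<Psi>'_def L_def power2_eq_square algebra_simps)
    then show ?thesis
      unfolding \<Psi>_def by (simp only:) (intro DERIV_add DERIV_diff DERIV_cmult 1 2 3 4 5)
  qed
  have nonneg: "0 \<le> \<Psi>' x" for x
    using wpos[of x] w1pos[of x] by (simp add: \<Psi>'_def)
  have mono: "\<Psi> x \<le> \<Psi> y" if "x \<le> y" for x y
    using DERIV_nonneg_imp_nondecreasing[OF that, of \<Psi>] \<Psi> nonneg by blast
  have "\<Psi> (x + P) = \<Psi> x" for x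
    by (simp add: \<Psi>_def L_def per periodic)
  then have const: "\<Psi> y = \<Psi> x" if "x \<le> y" "y \<le> x + P" for x y
    using mono[OF that(1)] mono[OF that(2)] by simp
  have w: "Y x $ 1 = 0" for x
  proof -
    have "(\<Psi> has_real_derivative 0) (at x)"
    proof (rule has_field_derivative_transform_within_open)
      show "((\<lambda>_. \<Psi> (x - P / 2)) has_real_derivative 0) (at x)" by simp
      show "\<Psi> (x - P / 2) = \<Psi> y" if "y \<in> {x - P/2<..<x + P/2}" for y
        using that P_pos by (intro const[symmetric]) auto
    qed (use P_pos in auto)
    then have "\<Psi>' x = 0" using DERIV_unique \<Psi> by blast
    moreover have "0 \<le> (C * k x - k1 x / 2) * (Y x $ 2)\<^sup>2" using w1pos[of x] by simp
    moreover have "0 \<le> (r - a1 x / 2 + C * a x) * (Y x $ 1)\<^sup>2" using wpos[of x] by simp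
    ultimately have "(r - a1 x / 2 + C * a x) * (Y x $ 1)\<^sup>2 = 0" unfolding \<Psi>'_def by linarith
    then show ?thesis using wpos[of x] by simp
  qed
  have w1: "Y x $ 2 = 0" for x
    using sol_deriv(1)[OF Y, of x] DERIV_unique[of "\<lambda>_. 0::real"] by (simp add: w)
  have "Y x $ 3 = 0" for x
    using sol_deriv(2)[OF Y, of x] DERIV_unique[of "\<lambda>_. 0::real"] by (simp add: w1)
  then have "Y 0 = 0" using w w1 by (simp add: vec_eq_iff forall_3)
  with \<open>Y 0 \<noteq> 0\<close> show False ..
qed

lemma d_continuous: "continuous_on {p..q} d"
proof -
  have "continuous_on {p..q} (\<lambda>r. fund (A r) P)"
    by (rule fund_continuous_param[OF compact_Icc _ A_cont_joint]) (use P_pos A_cont in auto)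
  then show ?thesis unfolding monodromy_det_def
    by (intro continuous_on_det_3 continuous_intros)
qed

end

text \<open>Write \<open>r = q\<^sup>3\<close> and \<open>l = sqrt 3 / 2 * q\<close>. The columns of \<open>V\<close> are the initial jets of the solutions
  \<open>exp (- q x)\<close>, \<open>exp (q x / 2) cos (l x)\<close> and \<open>exp (q x / 2) sin (l x)\<close>, each of
  which has third derivative \<open>- r\<close> times itself.\<close>

lemma monodromy_det_constant_coeff:
  assumes "0 < r" "0 < P"
  shows "monodromy_det (\<lambda>_. 0) (\<lambda>_. 0) (\<lambda>_. 1) (\<lambda>_. 0) (\<lambda>_. 0) P r < 0"
proof -
  define A where "A = comp_mat (\<lambda>_. 0) (\<lambda>_. 0) (\<lambda>_. 1) (\<lambda>_. 0) (\<lambda>_. 0) r"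
  interpret third_order "\<lambda>_. 0" "\<lambda>_. 0" "\<lambda>_. 1" "\<lambda>_. 0" "\<lambda>_. 0" P
    by standard (use assms in auto)
  have A_cont: "continuous_on UNIV A" unfolding A_def by (rule A_cont)
  define q where "q = root 3 r"
  define l where "l = sqrt 3 / 2 * q"
  have q: "0 < q" "q * (q * q) = r" and l: "0 < l" "l * l = 3 / 4 * (q * q)"
    using assms real_root_pow_pos2[of 3 r]
    by (simp_all add: q_def l_def power3_eq_cube mult.assoc mult.left_commute)
  have l': "l * (l * z) = 3 / 4 * (q * (q * z))" for z
    using l by (simp flip: mult.assoc)
  have q': "q * (q * (q * z)) = r * z" for z
    using q by (simp flip: mult.assoc)
  define V :: "real^3^3" where "V = vector [vector [1, 1, 0], vector [- q, q / 2, l], vector [q * q, - (q * q) / 2, q * l]]"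
  \<comment> \<open>In the basis \<open>V\<close> the constant matrix takes the real normal form
    \<open>\<Lambda>\<close> of the eigenvalues -q, q/2 + i l and q/2 - i l, and \<open>B x\<close>
    is the exponential of x times \<open>\<Lambda>\<close>.\<close>
  define \<Lambda> :: "real^3^3" where "\<Lambda> = vector [vector [- q, 0, 0], vector [0, q / 2, l], vector [0, - l, q / 2]]"
  define B :: "real \<Rightarrow> real^3^3" where "B x = vector [vector [exp (- q * x), 0, 0],
      vector [0, exp (q / 2 * x) * cos (l * x), exp (q / 2 * x) * sin (l * x)],
      vector [0, - exp (q / 2 * x) * sin (l * x), exp (q / 2 * x) * cos (l * x)]]" for x
  have AV: "A x ** V = V ** \<Lambda>" for x
    unfolding A_def comp_mat_def V_def \<Lambda>_def using q(2) l(2)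
    by (simp add: vec_eq_iff forall_3 matrix_matrix_mult_def sum_3 algebra_simps l' q')
  have B_deriv: "((\<lambda>x. B x *v y) has_vector_derivative \<Lambda> *v (B x *v y)) (at x)" for x y
    unfolding has_vector_derivative_vec_iff forall_3 B_def \<Lambda>_def matrix_vector_mult_def sum_3
    by (auto intro!: derivative_eq_intros simp: algebra_simps)
  have FV: "fund A x *v (V *v y) = V *v (B x *v y)" for x y
  proof (rule linear_system_unique[OF A_cont])
    fix x
    show "((\<lambda>x. fund A x *v (V *v y)) has_vector_derivative A x *v (fund A x *v (V *v y))) (at x)"
      by (rule fund_vec_deriv[OF A_cont])
    show "((\<lambda>x. V *v (B x *v y)) has_vector_derivative A x *v (V *v (B x *v y))) (at x)"
      using bounded_bilinear.has_vector_derivative[OF bounded_bilinear_matrix_vector_mult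
          has_vector_derivative_const[of V] B_deriv[of y x]]
      by (simp add: matrix_vector_mul_assoc AV matrix_mul_assoc)
    have "B 0 = mat 1" by (simp add: B_def vec_eq_iff forall_3 mat_def)
    then show "fund A 0 *v (V *v y) = V *v (B 0 *v y)" by (simp add: fund_0[OF A_cont])
  qed
  have "(fund A P - mat 1) ** V = V ** (B P - mat 1)"
    using FV[of P]
    by (simp add: matrix_eq matrix_vector_mult_diff_rdistrib matrix_vector_mult_diff_distrib
        flip: matrix_vector_mul_assoc)
  then have "det (fund A P - mat 1) * det V = det V * det (B P - mat 1)"
    by (metis det_mul)
  moreover have "det V = 3 * q * q * l"
    unfolding V_def det_3 by (simp add: algebra_simps)
  then have "det V \<noteq> 0" using q l by simp
  ultimately have "det (fund A P - mat 1) = det (B P - mat 1)" by simp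
  \<comment> \<open>The second factor is |exp ((q/2 + i l) P) - 1|^2. It is positive because the
    exponential has modulus above 1, so the decaying mode alone fixes the sign.\<close>
  also have "\<dots> = (exp (- q * P) - 1) *
      ((exp (q / 2 * P) * cos (l * P) - 1)\<^sup>2 + (exp (q / 2 * P) * sin (l * P))\<^sup>2)"
    unfolding B_def det_3 by (simp add: mat_def algebra_simps power2_eq_square)
  also have "\<dots> < 0"
  proof (rule mult_neg_pos)
    show "exp (- q * P) - 1 < 0" using q assms by simp
    have "(exp (q / 2 * P) * cos (l * P) - 1)\<^sup>2 + (exp (q / 2 * P) * sin (l * P))\<^sup>2 \<noteq> 0"
    proof
      define E where "E = exp (q / 2 * P)"
      have E: "1 < E" unfolding E_def using q assms by simp
      assume "(exp (q / 2 * P) * cos (l * P) - 1)\<^sup>2 + (exp (q / 2 * P) * sin (l * P))\<^sup>2 = 0"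
      then have c: "E * cos (l * P) = 1" and s: "E * sin (l * P) = 0"
        by (auto simp: sum_power2_eq_zero_iff E_def)
      have "E\<^sup>2 = (E * cos (l * P))\<^sup>2 + (E * sin (l * P))\<^sup>2"
        by (simp add: power_mult_distrib flip: distrib_left)
      then have "E\<^sup>2 = 1" using c s by simp
      then show False using E by (simp add: power2_eq_1_iff)
    qed
    then show "(exp (q / 2 * P) * cos (l * P) - 1)\<^sup>2 + (exp (q / 2 * P) * sin (l * P))\<^sup>2 > 0"
      by (metis sum_power2_gt_zero_iff sum_power2_eq_zero_iff)
  qed
  finally show ?thesis unfolding monodromy_det_def A_def .
qed

section \<open>Sign of the determinant for large spectral parameter\<close>

context third_order
begin

text \<open>The coefficients move linearly from a = 0, k = 1 to the given ones.
  \<open>d_nonzero\<close> holds along the whole path with one \<open>C\<close> and one bound on r,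
  so the sign at the start persists.\<close>

lemma d_negative: "\<exists>R>0. \<forall>r>R. d r < 0"
proof -
  obtain B1 where B1: "\<And>x. \<bar>a x\<bar> \<le> B1" using periodic_bounded[OF conts(1) periodic(1) P_pos] by blast
  obtain B2 where B2: "\<And>x. \<bar>a1 x\<bar> \<le> B2" using periodic_bounded[OF conts(4) periodic(3) P_pos] by blast
  obtain B3 where B3: "\<And>x. \<bar>k1 x\<bar> \<le> B3" using periodic_bounded[OF conts(3) periodic(4) P_pos] by blast
  have k0: "k x \<noteq> 0" for x using k_pos[of x] by simp
  have "continuous_on UNIV (\<lambda>x. 1 / k x)" by (intro continuous_intros conts) (use k0 in auto)
  then obtain N where N: "N > 0" "\<And>x. \<bar>1 / k x\<bar> \<le> N"
    using periodic_bounded[of "\<lambda>x. 1 / k x" P] periodic P_pos by auto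
  \<comment> \<open>A lower bound for k and for the constant 1, hence for all their convex
    combinations.\<close>
  define q where "q = min 1 (1 / N)"
  have q: "0 < q" "q \<le> 1" "q \<le> 1 / N" using N by (auto simp: q_def)
  have kq: "q \<le> k x" for x
  proof -
    have "1 / N \<le> k x" using N(1) N(2)[of x] k_pos[of x] by (simp add: field_simps)
    then show ?thesis using q by simp
  qed
  \<comment> \<open>C q = B3 / 2 dominates k'/2 along the path; \<open>R\<close> below is then large
    enough to dominate a'/2 and C a.\<close>
  define C where "C = B3 / (2 * q)"
  have B: "0 \<le> B1" "0 \<le> B2" "0 \<le> B3" using B1[of 0] B2[of 0] B3[of 0] by auto
  then have C: "0 \<le> C" using q by (simp add: C_def)
  define R where "R = B2 / 2 + C * B1 + 1"
  have R: "0 < R" using B C by (simp add: R_def add_nonneg_pos)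
  have "d r < 0" if r: "r > R" for r
  proof -
    define A' where "A' s = comp_mat (\<lambda>x. s * a x) (\<lambda>x. s * a1 x) (\<lambda>x. 1 - s + s * k x) (\<lambda>x. s * k1 x) (\<lambda>x. s * k2 x) r" for s
    define D where "D s = monodromy_det (\<lambda>x. s * a x) (\<lambda>x. s * a1 x) (\<lambda>x. 1 - s + s * k x) (\<lambda>x. s * k1 x) (\<lambda>x. s * k2 x) P r" for s
    have ks: "q \<le> 1 - s + s * k x" if "s \<in> {0..1}" for s x
    proof -
      have "(1 - s) * q + s * q \<le> (1 - s) * 1 + s * k x"
        using that q kq[of x] by (intro add_mono mult_left_mono) auto
      then show ?thesis by (simp add: algebra_simps)
    qed
    have to: "third_order (\<lambda>x. s * a x) (\<lambda>x. s * a1 x) (\<lambda>x. 1 - s + s * k x) (\<lambda>x. s * k1 x) (\<lambda>x. s * k2 x) P"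
      if s: "s \<in> {0..1}" for s
    proof
      show "0 < 1 - s + s * k x" for x using ks[OF s, of x] q by linarith
    qed (auto intro!: derivative_eq_intros a_deriv k_deriv k1_deriv continuous_intros conts simp: periodic P_pos)
    have nz: "D s \<noteq> 0" if s: "s \<in> {0..1}" for s
      unfolding D_def
    proof (rule third_order.d_nonzero[OF to[OF s], where C = C])
      show "0 < r" using r R by simp
      fix x
      have scale: "s * y \<le> M" if "\<bar>y\<bar> \<le> M" for y M
      proof -
        have "s * y \<le> s * \<bar>y\<bar>" using s by (intro mult_left_mono) auto
        also have "\<dots> \<le> \<bar>y\<bar>" using s by (simp add: mult_left_le_one_le)
        finally show ?thesis using that by simp
      qed
      have "C * (s * - a x) \<le> C * B1" using B1[of x] C by (intro mult_left_mono scale) auto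
      with scale[OF B2[of x]] show "0 < r - s * a1 x / 2 + C * (s * a x)" using r by (simp add: R_def)
      have "s * k1 x \<le> B3" using B3[of x] by (rule scale)
      moreover have "C * q \<le> C * (1 - s + s * k x)" using C ks[OF s] by (intro mult_left_mono)
      moreover have "C * q = B3 / 2" using q by (simp add: C_def)
      ultimately show "0 \<le> C * (1 - s + s * k x) - s * k1 x / 2" by simp
    qed
    have cont: "continuous_on {0..1} D"
    proof -
      have "continuous_on {0..1} (\<lambda>s. fund (A' s) P)"
      proof (rule fund_continuous_param)
        have snd: "continuous_on S (\<lambda>z. f (snd z))" if "continuous_on UNIV f"
          for f :: "real \<Rightarrow> real" and S :: "(real \<times> real) set"
          by (rule continuous_on_compose2[OF that]) (auto intro!: continuous_intros)
        have ne: "1 - s + s * k x \<noteq> 0" if "s \<in> {0..1}" for s x using ks[OF that, of x] q by linarith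
        show "continuous_on ({0..1} \<times> {0..P}) (\<lambda>(s, x). A' s x)"
          unfolding case_prod_beta comp_mat_def A'_def
          by (intro continuous_on_companion continuous_intros conts snd) (use ne in auto)
        show "continuous_on UNIV (A' s)" if "s \<in> {0..1}" for s
          unfolding A'_def by (rule third_order.A_cont[OF to[OF that]])
      qed (use P_pos in auto)
      then show ?thesis unfolding D_def monodromy_det_def A'_def
        by (intro continuous_on_det_3 continuous_intros)
    qed
    have "D 0 < 0" unfolding D_def using monodromy_det_constant_coeff[OF _ P_pos, of r] r R by simp
    have "D 1 < 0"
    proof (rule ccontr)
      assume "\<not> D 1 < 0"
      then obtain s where "0 \<le> s" "s \<le> 1" "D s = 0"
        using IVT'[of D 0 0 1] cont \<open>D 0 < 0\<close> by auto
      then show False using nz[of s] by simp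
    qed
    then show ?thesis by (simp add: D_def)
  qed
  with R show ?thesis by blast
qed

end

section \<open>From real to complex fundamental matrices\<close>

definition cmat :: "real^'n^'m \<Rightarrow> complex^'n^'m" where
  "cmat M = (\<chi> i j. complex_of_real (M $ i $ j))"

lemma cmat_mult: "cmat (M ** N) = cmat M ** cmat N"
  by (simp add: cmat_def matrix_matrix_mult_def vec_eq_iff)

lemma cmat_mat_1: "cmat (mat 1) = mat 1"
  by (simp add: cmat_def mat_def vec_eq_iff)

lemma cmat_diff: "cmat (M - N) = cmat M - cmat N"
  by (simp add: cmat_def vec_eq_iff)

lemma det_cmat: "det (cmat M) = complex_of_real (det M)"
  by (simp add: det_def cmat_def)

lemma bounded_linear_cmat: "bounded_linear (cmat :: real^'n^'m \<Rightarrow> _)"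
  unfolding linear_conv_bounded_linear[symmetric]
  by (simp add: linear_iff cmat_def vec_eq_iff of_real_def scaleR_left_distrib)

text \<open>The entrywise embedding satisfies the defining conditions, and uniqueness for the
  complex matrix system makes the definite description denote it.\<close>

lemma fundamental_solution_cmat:
  fixes A :: "real \<Rightarrow> real^'n^'n"
  assumes A: "continuous_on UNIV A"
  shows "fundamental_solution (\<lambda>x. cmat (A x)) = (\<lambda>x. cmat (fund A x))"
  unfolding fundamental_solution_def
proof (rule the_equality)
  have d: "((\<lambda>x. cmat (fund A x)) has_vector_derivative cmat (A x) ** cmat (fund A x)) (at x)" for x
    using bounded_linear.has_vector_derivative[OF bounded_linear_cmat fund_deriv[OF A]]
    by (simp add: cmat_mult)
  then show "cmat (fund A 0) = mat 1 \<and>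
      (\<forall>x. ((\<lambda>x. cmat (fund A x)) has_vector_derivative cmat (A x) ** cmat (fund A x)) (at x))"
    by (simp add: fund_0[OF A] cmat_mat_1)
  fix F assume F: "F 0 = mat 1 \<and> (\<forall>x. (F has_vector_derivative cmat (A x) ** F x) (at x))"
  have cA: "continuous_on UNIV (\<lambda>x. cmat (A x))"
    by (intro bounded_linear.continuous_on[OF bounded_linear_cmat] A)
  have "((\<lambda>x. F x - cmat (fund A x)) has_vector_derivative cmat (A x) ** (F x - cmat (fund A x))) (at x)" for x
    using has_vector_derivative_diff[OF conjunct2[OF F, rule_format] d]
    by (simp add: bounded_bilinear.diff_right[OF bounded_bilinear_matrix_matrix_mult])
  from linear_ode_unique_zero[OF bounded_bilinear_matrix_matrix_mult cA this]
  show "F = (\<lambda>x. cmat (fund A x))"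
    using F by (auto simp: fun_eq_iff fund_0[OF A] cmat_mat_1)
qed

section \<open>Small spectral parameter\<close>

text \<open>\<open>v\<close> stands for the wave profile, \<open>w j\<close> for its derivative with respect to the parameter \<open>j\<close>
  and \<open>Y j\<close> for that of the period; \<open>v1\<close>, \<open>w1\<close>, ... are derivatives in \<open>x\<close>.\<close>

locale modulated_wave = third_order +
  fixes v v1 v2 v3 v4 :: "real \<Rightarrow> real" and w w1 w2 w3 :: "3 \<Rightarrow> real \<Rightarrow> real" and Y :: "3 \<Rightarrow> real"
  assumes v_deriv: "\<And>x. (v has_real_derivative v1 x) (at x)" "\<And>x. (v1 has_real_derivative v2 x) (at x)"
      "\<And>x. (v2 has_real_derivative v3 x) (at x)" "\<And>x. (v3 has_real_derivative v4 x) (at x)"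
    and v_periodic: "\<And>x. v (x + P) = v x"
    and w_deriv: "\<And>j x. (w j has_real_derivative w1 j x) (at x)" "\<And>j x. (w1 j has_real_derivative w2 j x) (at x)"
      "\<And>j x. (w2 j has_real_derivative w3 j x) (at x)"
    and L_v1: "\<And>x. a x * v1 x - k1 x * v2 x - k x * v3 x = 0"
    and L_w1: "\<And>x. a x * w 1 x - k1 x * w1 1 x - k x * w2 1 x = 0"
    and L_w2: "\<And>x. a x * w 2 x - k1 x * w1 2 x - k x * w2 2 x = 1"
    and L_w3: "\<And>x. a x * w 3 x - k1 x * w1 3 x - k x * w2 3 x = - v x"
    and wronskian1: "k 0 * (v1 0 * w1 1 0 - v2 0 * w 1 0) = 1"
    and wronskian2: "k 0 * (v1 0 * w1 2 0 - v2 0 * w 2 0) = - v 0"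
    and wronskian3: "k 0 * (v1 0 * w1 3 0 - v2 0 * w 3 0) = (v 0)\<^sup>2 / 2"
    and jump: "\<And>j. w j P - w j 0 = - Y j * v1 0" "\<And>j. w1 j P - w1 j 0 = - Y j * v2 0"
begin

lemmas v_periodics = v_periodic periodic_deriv[OF v_deriv(1) v_periodic]
  periodic_deriv[OF v_deriv(2) periodic_deriv[OF v_deriv(1) v_periodic]]
  periodic_deriv[OF v_deriv(3) periodic_deriv[OF v_deriv(2) periodic_deriv[OF v_deriv(1) v_periodic]]]

lemma per_0: "v P = v 0" "v1 P = v1 0" "v2 P = v2 0" "v3 P = v3 0"
  "a P = a 0" "k P = k 0" "k1 P = k1 0"
  using v_periodics[of 0] periodic[of 0] by simp_all

lemma v_w_conts: "continuous_on S v" "continuous_on S v1" "continuous_on S v2" "continuous_on S v3"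
  "continuous_on S (w j)" "continuous_on S (w1 j)" "continuous_on S (w2 j)"
  by (rule DERIV_continuous_on, rule has_field_derivative_at_within, rule v_deriv w_deriv)+

definition Jx :: "real \<Rightarrow> real^3" where "Jx x = vector [v1 x, v2 x, v3 x]"
definition Jw :: "3 \<Rightarrow> real \<Rightarrow> real^3" where "Jw j x = vector [w j x, w1 j x, w2 j x]"

text \<open>\<open>V0 r\<close> are initial jets, \<open>y\<close> the corresponding solutions, the first one rescaled to have the limit \<open>y0\<close> as
  \<open>r\<close> tends to \<open>0\<close>. The rows of \<open>R\<close> are linear functionals of the jet at \<open>0\<close>; the last two are the quantities
  whose jumps over a period are multiples of \<open>r\<close>.\<close>

definition V0 :: "real \<Rightarrow> 3 \<Rightarrow> real^3" where
  "V0 r j = (if j = 1 then Jx 0 - r *\<^sub>R Jw 3 0 else if j = 2 then Jw 1 0 else Jw 2 0)"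

abbreviation F where "F r \<equiv> fund (A r)"

definition y :: "3 \<Rightarrow> real \<Rightarrow> real \<Rightarrow> real^3" where
  "y j r x = (if j = 1 then (1 / r) *\<^sub>R (F r x *v V0 r 1 - Jx x) else F r x *v V0 r j)"

definition y0 :: "3 \<Rightarrow> real \<Rightarrow> real^3" where
  "y0 j x = (if j = 1 then - Jw 3 x else if j = 2 then Jw 1 x else Jw 2 x)"

definition R :: "real^3^3" where
  "R = vector [vector [v1 0, v2 0, 0],
     vector [v 0 * a 0 - k 0 * v2 0, k 0 * v1 0 - v 0 * k1 0, - v 0 * k 0],
     vector [a 0, - k1 0, - k 0]]"

definition s :: real where "s = (v1 0)\<^sup>2 + (v2 0)\<^sup>2"

text \<open>If v_x and v_xx both vanished at 0, so would their Wronskian with v_\<mu>, which is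
  nonzero.\<close>

lemma s_nonzero: "s \<noteq> 0"
  using wronskian1 by (auto simp: s_def sum_power2_eq_zero_iff)

text \<open>The hypothesis holds for \<mu> and \<lambda>, where \<open>L\<close> yields the
  constants 0 and 1: these functions solve the equation at r = 0, hence at r up to a residual of
  order r.\<close>

lemma Jw_ode:
  assumes "\<And>x. (L (Jw j) has_real_derivative 0) (at x)"
  shows "(Jw j has_vector_derivative A r x *v Jw j x + vector [0, 0, r * w j x / k x]) (at x)"
  using jet_ode[OF w_deriv assms[unfolded Jw_def[abs_def]], where x = x and r = r] by (simp add: Jw_def[abs_def])

text \<open>\<open>L\<close> maps v_x - r v_c to r v, with derivative r v_x; compared with r (v_x -
  r v_c) only -r^2 v_c is missing. The correction by v_c is what raises the residual to second
  order.\<close>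

lemma Jx_Jw3_ode:
  "((\<lambda>x. Jx x - r *\<^sub>R Jw 3 x) has_vector_derivative
     A r x *v (Jx x - r *\<^sub>R Jw 3 x) + vector [0, 0, - (r\<^sup>2 * w 3 x / k x)]) (at x)"
proof -
  have eq: "Jx x - r *\<^sub>R Jw 3 x = vector [v1 x - r * w 3 x, v2 x - r * w1 3 x, v3 x - r * w2 3 x]" for x
    by (simp add: Jx_def Jw_def vec_eq_iff forall_3)
  have L: "L (\<lambda>x. vector [v1 x - r * w 3 x, v2 x - r * w1 3 x, v3 x - r * w2 3 x]) = (\<lambda>x. r * v x)"
    unfolding L_def fun_eq_iff
  proof
    fix x
    have "a x * (v1 x - r * w 3 x) - k1 x * (v2 x - r * w1 3 x) - k x * (v3 x - r * w2 3 x)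
        = (a x * v1 x - k1 x * v2 x - k x * v3 x) - r * (a x * w 3 x - k1 x * w1 3 x - k x * w2 3 x)"
      by (simp add: algebra_simps)
    also have "\<dots> = r * v x" unfolding L_v1 L_w3 by simp
    finally show "a x * vector [v1 x - r * w 3 x, v2 x - r * w1 3 x, v3 x - r * w2 3 x] $ (1::3)
        - k1 x * vector [v1 x - r * w 3 x, v2 x - r * w1 3 x, v3 x - r * w2 3 x] $ (2::3)
        - k x * vector [v1 x - r * w 3 x, v2 x - r * w1 3 x, v3 x - r * w2 3 x] $ (3::3) = r * v x"
      by simp
  qed
  have "((\<lambda>x. vector [v1 x - r * w 3 x, v2 x - r * w1 3 x, v3 x - r * w2 3 x] :: real^3) has_vector_derivative
    A r x *v vector [v1 x - r * w 3 x, v2 x - r * w1 3 x, v3 x - r * w2 3 x]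
      + vector [0, 0, (r * (v1 x - r * w 3 x) - r * v1 x) / k x]) (at x)"
    by (rule jet_ode) (auto intro!: derivative_eq_intros v_deriv w_deriv simp: L)
  moreover have "(r * (v1 x - r * w 3 x) - r * v1 x) / k x = - (r\<^sup>2 * w 3 x / k x)"
    by (simp add: algebra_simps power2_eq_square)
  ultimately show ?thesis by (simp add: eq)
qed

lemma norm_vector_00: "norm (vector [0, 0, c] :: real^3) = \<bar>c\<bar>"
  by (simp add: norm_vec_def L2_set_def sum_3)

text \<open>The first column is divided by r, which its residual of order r^2 permits; the other two
  have residuals of order r. All three errors are therefore of order r.\<close>

lemma y_approx: "\<exists>C>0. \<forall>j r. \<forall>x\<in>{0..P}. r \<noteq> 0 \<longrightarrow> \<bar>r\<bar> \<le> 1 \<longrightarrow> norm (y j r x - y0 j x) \<le> C * \<bar>r\<bar>"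
proof -
  have "bounded ((\<lambda>(r, x). A r x) ` ({-1..1} \<times> {0..P}))"
    by (intro compact_imp_bounded compact_continuous_image A_cont_joint compact_Times compact_Icc)
  then obtain M where M: "\<And>r x. r \<in> {-1..1} \<Longrightarrow> x \<in> {0..P} \<Longrightarrow> norm (A r x) \<le> M"
    unfolding bounded_iff by fastforce
  obtain C where C: "C > 0" and approx: "\<And>A :: real \<Rightarrow> real^3^3. \<And>J f \<epsilon> x. \<lbrakk>x \<in> {0..P};
     continuous_on UNIV A; 0 \<le> \<epsilon>; \<forall>x\<in>{0..P}. norm (A x) \<le> M; \<forall>x\<in>{0..P}. norm (f x) \<le> \<epsilon>;
     \<forall>x\<in>{0..P}. (J has_vector_derivative A x *v J x + f x) (at x)\<rbrakk>
     \<Longrightarrow> norm (fund A x *v J 0 - J x) \<le> C * \<epsilon>"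
    using fund_approx[of P M, where 'n = 3] P_pos by (metis less_imp_le)
  have "k x \<noteq> 0" for x using k_pos[of x] by simp
  then have "continuous_on {0..P} (\<lambda>x. \<bar>w 1 x / k x\<bar> + \<bar>w 2 x / k x\<bar> + \<bar>w 3 x / k x\<bar>)"
    by (intro continuous_intros v_w_conts conts) auto
  from continuous_on_interval_bounded[OF this]
  obtain B where B: "B > 0" "\<And>x. x \<in> {0..P} \<Longrightarrow> norm (\<bar>w 1 x / k x\<bar> + \<bar>w 2 x / k x\<bar> + \<bar>w 3 x / k x\<bar>) \<le> B"
    by blast
  have Bw: "\<bar>w 1 x / k x\<bar> \<le> B" "\<bar>w 2 x / k x\<bar> \<le> B" "\<bar>w 3 x / k x\<bar> \<le> B" if "x \<in> {0..P}" for x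
    using B(2)[OF that] abs_ge_zero[of "w 1 x / k x"] abs_ge_zero[of "w 2 x / k x"]
      abs_ge_zero[of "w 3 x / k x"] unfolding real_norm_def by linarith+
  have main: "norm (y j r x - y0 j x) \<le> C * B * \<bar>r\<bar>" if x: "x \<in> {0..P}" and r: "r \<noteq> 0" "\<bar>r\<bar> \<le> 1" for j r x
  proof -
    have Ar: "\<forall>x\<in>{0..P}. norm (A r x) \<le> M" using r by (intro ballI M) auto
    have rw2: "\<bar>- (r\<^sup>2 * w i x / k x)\<bar> = r\<^sup>2 * \<bar>w i x / k x\<bar>" for i x by (simp add: abs_mult)
    have rw: "\<bar>r * w i x / k x\<bar> = \<bar>r\<bar> * \<bar>w i x / k x\<bar>" for i x by (simp add: abs_mult)
    consider "j = 1" | "j = 2" | "j = 3" using exhaust_3[of j] by blast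
    then show ?thesis
    proof cases
      case 1
      define J where "J x = Jx x - r *\<^sub>R Jw 3 x" for x
      have "norm (F r x *v J 0 - J x) \<le> C * (r\<^sup>2 * B)"
      proof (rule approx[OF x A_cont _ Ar, where f = "\<lambda>x. vector [0, 0, - (r\<^sup>2 * w 3 x / k x)]"])
        show "\<forall>x\<in>{0..P}. norm (vector [0, 0, - (r\<^sup>2 * w 3 x / k x)] :: real^3) \<le> r\<^sup>2 * B"
          unfolding norm_vector_00 rw2 by (intro ballI mult_left_mono Bw) auto
      qed (use B Jx_Jw3_ode in \<open>auto simp: J_def[abs_def]\<close>)
      moreover have "y j r x - y0 j x = (1 / r) *\<^sub>R (F r x *v J 0 - J x)"
        using 1 r(1) by (simp add: y_def y0_def V0_def J_def scaleR_diff_right)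
      ultimately have "norm (y j r x - y0 j x) \<le> (1 / \<bar>r\<bar>) * (C * (r\<^sup>2 * B))"
        by (simp add: divide_right_mono)
      also have "r\<^sup>2 = \<bar>r\<bar> * \<bar>r\<bar>" by (simp add: power2_eq_square)
      also have "(1 / \<bar>r\<bar>) * (C * (\<bar>r\<bar> * \<bar>r\<bar> * B)) = C * B * \<bar>r\<bar>" using r(1) by (simp add: field_simps del: abs_mult_self_eq)
      finally show ?thesis .
    next
      case 2
      have "norm (F r x *v Jw 1 0 - Jw 1 x) \<le> C * (\<bar>r\<bar> * B)"
      proof (rule approx[OF x A_cont _ Ar, where f = "\<lambda>x. vector [0, 0, r * w 1 x / k x]"])
        show "\<forall>x\<in>{0..P}. norm (vector [0, 0, r * w 1 x / k x] :: real^3) \<le> \<bar>r\<bar> * B"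
          unfolding norm_vector_00 rw by (intro ballI mult_left_mono Bw) auto
        show "\<forall>x\<in>{0..P}. (Jw 1 has_vector_derivative A r x *v Jw 1 x + vector [0, 0, r * w 1 x / k x]) (at x)"
          by (intro ballI Jw_ode) (simp add: L_def[abs_def] Jw_def L_w1)
      qed (use B in auto)
      then show ?thesis using 2 by (simp add: y_def y0_def V0_def mult_ac)
    next
      case 3
      have "norm (F r x *v Jw 2 0 - Jw 2 x) \<le> C * (\<bar>r\<bar> * B)"
      proof (rule approx[OF x A_cont _ Ar, where f = "\<lambda>x. vector [0, 0, r * w 2 x / k x]"])
        show "\<forall>x\<in>{0..P}. norm (vector [0, 0, r * w 2 x / k x] :: real^3) \<le> \<bar>r\<bar> * B"
          unfolding norm_vector_00 rw by (intro ballI mult_left_mono Bw) auto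
        show "\<forall>x\<in>{0..P}. (Jw 2 has_vector_derivative A r x *v Jw 2 x + vector [0, 0, r * w 2 x / k x]) (at x)"
          by (intro ballI Jw_ode) (simp add: L_def[abs_def] Jw_def L_w2)
      qed (use B in auto)
      then show ?thesis using 3 by (simp add: y_def y0_def V0_def mult_ac)
    qed
  qed
  then show ?thesis using C B(1) by (intro exI[of _ "C * B"]) auto
qed

lemma y_uniform: "uniform_limit {0..P} (y j) (y0 j) (at 0)"
proof -
  obtain C where C: "C > 0"
    "\<And>j r x. x \<in> {0..P} \<Longrightarrow> r \<noteq> 0 \<Longrightarrow> \<bar>r\<bar> \<le> 1 \<Longrightarrow> norm (y j r x - y0 j x) \<le> C * \<bar>r\<bar>"
    using y_approx by metis
  show ?thesis
  proof (rule uniform_limitI)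
    fix \<epsilon> :: real assume "\<epsilon> > 0"
    have "\<forall>\<^sub>F r in at (0::real). r \<noteq> 0 \<and> \<bar>r\<bar> < min 1 (\<epsilon> / C)"
      unfolding eventually_at using \<open>\<epsilon> > 0\<close> C(1) by (intro exI[of _ "min 1 (\<epsilon> / C)"]) auto
    then show "\<forall>\<^sub>F r in at 0. \<forall>x\<in>{0..P}. dist (y j r x) (y0 j x) < \<epsilon>"
    proof eventually_elim
      case (elim r)
      then have "C * \<bar>r\<bar> < \<epsilon>" using C(1) by (simp add: field_simps)
      then show ?case using C(2)[of _ r j] elim by (fastforce simp: dist_norm)
    qed
  qed
qed

lemma y_cont: "continuous_on S (y j r)"
proof -
  have "continuous_on UNIV (\<lambda>x. F r x *v z)" for z
    by (rule continuous_on_vector_derivative) (use fund_vec_deriv[OF A_cont] in blast)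
  then have F: "continuous_on S (\<lambda>x. F r x *v z)" for z by (rule continuous_on_subset) auto
  have "Jx = (\<lambda>x. v1 x *\<^sub>R axis 1 1 + v2 x *\<^sub>R axis 2 1 + v3 x *\<^sub>R axis 3 1)"
    by (auto simp: Jx_def vec_eq_iff forall_3 axis_def)
  then have "continuous_on S Jx"
    by (simp only:) (intro continuous_intros v_w_conts)
  with F show ?thesis unfolding y_def by (cases "j = 1") (auto intro!: continuous_intros)
qed

text \<open>This is what remains of \<open>R\<close> times the jumps of the solutions once the
  explicit powers of r are taken out. It is written for arbitrary functions so that it also applies
  to the limit \<open>y0\<close>.\<close>

definition N :: "(3 \<Rightarrow> real \<Rightarrow> real^3) \<Rightarrow> real^3^3" where
  "N z = vector
    [\<chi> j. v1 0 * (z j P - z j 0) $ 1 + v2 0 * (z j P - z j 0) $ 2,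
     \<chi> j. integral {0..P} (\<lambda>x. v x * z j x $ 1),
     \<chi> j. integral {0..P} (\<lambda>x. z j x $ 1)]"

lemma tendsto_integral_y:
  assumes "continuous_on {0..P} \<phi>"
  shows "((\<lambda>r. integral {0..P} (\<lambda>x. \<phi> x * y j r x $ 1)) \<longlongrightarrow> integral {0..P} (\<lambda>x. \<phi> x * y0 j x $ 1)) (at 0)"
proof -
  have bl: "bounded_linear (\<lambda>z::real^3. z $ 1)" by auto
  have "uniform_limit {0..P} (\<lambda>r x. \<phi> x * y j r x $ 1) (\<lambda>x. \<phi> x * y0 j x $ 1) (at 0)"
  proof (rule bounded_bilinear.bounded_uniform_limit[OF bounded_bilinear_mult])
    show "uniform_limit {0..P} (\<lambda>r x. y j r x $ 1) (\<lambda>x. y0 j x $ 1) (at 0)"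
      by (rule bounded_linear.uniform_limit[OF bl y_uniform])
    show "bounded (\<phi> ` {0..P})" by (intro compact_imp_bounded compact_continuous_image assms compact_Icc)
    have "continuous_on {0..P} (\<lambda>x. y0 j x $ 1)"
      using exhaust_3[of j] by (elim disjE) (auto simp: y0_def Jw_def intro!: continuous_intros v_w_conts)
    then show "bounded ((\<lambda>x. y0 j x $ 1) ` {0..P})"
      by (intro compact_imp_bounded compact_continuous_image compact_Icc)
  qed (rule uniform_limit_const)
  then obtain I J where I: "\<And>r. ((\<lambda>x. \<phi> x * y j r x $ 1) has_integral I r) {0..P}"
    and J: "((\<lambda>x. \<phi> x * y0 j x $ 1) has_integral J) {0..P}" and "(I \<longlongrightarrow> J) (at 0)"
    by (rule uniform_limit_integral) (auto intro!: continuous_intros assms y_cont)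
  then show ?thesis by (simp add: integral_unique[OF I] integral_unique[OF J])
qed

lemma tendsto_N: "((\<lambda>r. det (N (\<lambda>j. y j r))) \<longlongrightarrow> det (N y0)) (at 0)"
proof -
  have y: "((\<lambda>r. y j r x) \<longlongrightarrow> y0 j x) (at 0)" if "x \<in> {0..P}" for x j
    using tendsto_uniform_limitI[OF y_uniform that] .
  have 1: "((\<lambda>r. N (\<lambda>j. y j r) $ 1 $ j) \<longlongrightarrow> N y0 $ 1 $ j) (at 0)" for j
    unfolding N_def using P_pos by (auto intro!: tendsto_intros y)
  have 2: "((\<lambda>r. N (\<lambda>j. y j r) $ 2 $ j) \<longlongrightarrow> N y0 $ 2 $ j) (at 0)" for j
    unfolding N_def using tendsto_integral_y[OF v_w_conts(1), of j] by simp
  have 3: "((\<lambda>r. N (\<lambda>j. y j r) $ 3 $ j) \<longlongrightarrow> N y0 $ 3 $ j) (at 0)" for j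
    unfolding N_def using tendsto_integral_y[of "\<lambda>_. 1" j] by simp
  show ?thesis unfolding det_3 by (intro tendsto_add tendsto_diff tendsto_mult 1 2 3)
qed

text \<open>Since the coefficients and v are periodic, \<open>R\<close>, built from values at 0,
  computes boundary quantities at both ends of the period. Rows 2 and 3 give the jumps of
  \<open>b\<close> and of \<open>L Z\<close>, which are integrals of their derivatives.\<close>

lemma sol_jump:
  assumes Z: "\<And>x. (Z has_vector_derivative A r x *v Z x) (at x)"
  shows "R *v (Z P - Z 0) = vector
    [v1 0 * (Z P - Z 0) $ 1 + v2 0 * (Z P - Z 0) $ 2,
     r * integral {0..P} (\<lambda>x. v x * Z x $ 1), r * integral {0..P} (\<lambda>x. Z x $ 1)]"
proof -
  note dZ = sol_deriv[OF Z]
  have "((\<lambda>x. r * Z x $ 1) has_integral L Z P - L Z 0) {0..P}"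
    using sol_L[OF Z] P_pos
    by (intro fundamental_theorem_of_calculus)
      (auto simp: has_real_derivative_iff_has_vector_derivative intro: has_vector_derivative_at_within)
  then have L: "r * integral {0..P} (\<lambda>x. Z x $ 1) = L Z P - L Z 0"
    by (simp add: integral_unique flip: integral_mult_right)
  \<comment> \<open>By the Lagrange identity the derivative of k (v_x w_x - v_xx w) is w L v_x - v_x
    L w. The first term is 0, and the second cancels when the factor v of v L w is differentiated,
    which leaves r v w.\<close>
  define b where "b x = k x * (v1 x * Z x $ 2 - v2 x * Z x $ 1) + v x * L Z x" for x
  have "(b has_real_derivative v x * (r * Z x $ 1)) (at x)" for x
  proof -
    have "(b has_real_derivative
       k1 x * (v1 x * Z x $ 2 - v2 x * Z x $ 1) + k x * (v1 x * Z x $ 3 - v3 x * Z x $ 1)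
       + v1 x * L Z x + v x * (r * Z x $ 1)) (at x)"
      unfolding b_def
      by (rule derivative_eq_intros v_deriv dZ sol_L[OF Z] k_deriv refl)+ (simp add: algebra_simps)
    moreover have "k1 x * (v1 x * Z x $ 2 - v2 x * Z x $ 1) + k x * (v1 x * Z x $ 3 - v3 x * Z x $ 1)
        + v1 x * L Z x = Z x $ 1 * (a x * v1 x - k1 x * v2 x - k x * v3 x)"
      by (simp add: L_def algebra_simps)
    ultimately show ?thesis by (simp add: L_v1)
  qed
  then have "((\<lambda>x. v x * (r * Z x $ 1)) has_integral b P - b 0) {0..P}"
    using P_pos
    by (intro fundamental_theorem_of_calculus)
      (auto simp: has_real_derivative_iff_has_vector_derivative intro: has_vector_derivative_at_within)
  then have b: "r * integral {0..P} (\<lambda>x. v x * Z x $ 1) = b P - b 0"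
    by (simp add: integral_unique mult.left_commute flip: integral_mult_right)
  show ?thesis
    unfolding L b
    by (simp add: vec_eq_iff forall_3 R_def matrix_vector_mult_def sum_3 b_def L_def per_0 algebra_simps)
qed

text \<open>Both integrands are derivatives of periodic functions. Hence removing v_x from the first
  solution does not change its integrals against 1 and v, and the remainder contributes the third
  factor r.\<close>

lemma integral_v1: "integral {0..P} v1 = 0" "integral {0..P} (\<lambda>x. v x * v1 x) = 0"
proof -
  have "(v1 has_integral v P - v 0) {0..P}"
    using v_deriv P_pos
    by (intro fundamental_theorem_of_calculus)
      (auto simp: has_real_derivative_iff_has_vector_derivative intro: has_vector_derivative_at_within)
  then show "integral {0..P} v1 = 0" by (simp add: per_0 integral_unique)
  have "((\<lambda>x. (v x)\<^sup>2 / 2) has_real_derivative v x * v1 x) (at x)" for x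
    by (auto intro!: derivative_eq_intros v_deriv)
  then have "((\<lambda>x. v x * v1 x) has_integral (v P)\<^sup>2 / 2 - (v 0)\<^sup>2 / 2) {0..P}"
    using P_pos
    by (intro fundamental_theorem_of_calculus)
      (auto simp: has_real_derivative_iff_has_vector_derivative intro: has_vector_derivative_at_within)
  then show "integral {0..P} (\<lambda>x. v x * v1 x) = 0" by (simp add: per_0 integral_unique)
qed

lemma y_integrable: "(\<lambda>x. y j r x $ 1) integrable_on {0..P}" "(\<lambda>x. v x * y j r x $ 1) integrable_on {0..P}"
  by (intro integrable_continuous_real continuous_intros v_w_conts y_cont)+

text \<open>Rows 2 and 3 of the product each carry a factor r by \<open>sol_jump\<close>. Column 1
  carries another one, because v_x has no jump and drops out of both integrals.\<close>

lemma d_times_det: 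
  assumes "r \<noteq> 0"
  shows "d r * det (R ** (\<chi> i j. V0 r j $ i)) = r ^ 3 * det (N (\<lambda>j. y j r))"
proof -
  define V where "V = (\<chi> i j. V0 r j $ i)"
  define X where "X = F r P - mat 1"
  define M where "M = R ** (X ** V)"
  have col: "V *v axis j 1 = V0 r j" for j
    by (simp add: matrix_vector_mult_basis V_def column_def vec_eq_iff)
  have sol: "((\<lambda>x. F r x *v z) has_vector_derivative A r x *v (F r x *v z)) (at x)" for x z
    by (rule fund_vec_deriv[OF A_cont])
  have X: "X *v V0 r j = F r P *v V0 r j - F r 0 *v V0 r j" for j
    by (simp add: X_def matrix_vector_mult_diff_rdistrib fund_0[OF A_cont])
  have M: "M $ i $ j = (R *v (F r P *v V0 r j - F r 0 *v V0 r j)) $ i" for i j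
  proof -
    have "M $ i $ j = (M *v axis j 1) $ i" by (simp add: matrix_vector_mult_basis column_def)
    also have "M *v axis j 1 = R *v (X *v (V *v axis j 1))"
      by (simp add: M_def matrix_vector_mul_assoc)
    finally show ?thesis by (simp add: col X)
  qed
  have y1: "F r x *v V0 r 1 = r *\<^sub>R y 1 r x + Jx x" for x
    using assms by (simp add: y_def)
  have J: "Jx P = Jx 0" by (simp add: Jx_def per_0)
  have Jx1: "Jx x $ 1 = v1 x" for x by (simp add: Jx_def)
  have i1: "integral {0..P} (\<lambda>x. (F r x *v V0 r 1) $ 1) = r * integral {0..P} (\<lambda>x. y 1 r x $ 1)"
    unfolding y1 by (simp add: Jx1 integral_add y_integrable integrable_continuous_real v_w_conts integral_v1
        integrable_on_mult_right)
  have "integral {0..P} (\<lambda>x. v x * (F r x *v V0 r 1) $ 1)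
      = integral {0..P} (\<lambda>x. r * (v x * y 1 r x $ 1) + v x * v1 x)"
    unfolding y1 by (simp add: Jx1 algebra_simps)
  also have "\<dots> = r * integral {0..P} (\<lambda>x. v x * y 1 r x $ 1)"
    by (subst integral_add) (auto intro!: integrable_on_mult_right y_integrable integrable_continuous_real
        continuous_intros v_w_conts y_cont simp: integral_v1)
  finally have i2: "integral {0..P} (\<lambda>x. v x * (F r x *v V0 r 1) $ 1) = r * integral {0..P} (\<lambda>x. v x * y 1 r x $ 1)" .
  have M1: "M $ 1 $ 1 = r * N (\<lambda>j. y j r) $ 1 $ 1" "M $ 2 $ 1 = r * (r * N (\<lambda>j. y j r) $ 2 $ 1)"
    "M $ 3 $ 1 = r * (r * N (\<lambda>j. y j r) $ 3 $ 1)"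
    unfolding M sol_jump[OF sol] i1 i2 N_def by (simp_all add: y1 J algebra_simps)
  have M2: "M $ 1 $ j = N (\<lambda>j. y j r) $ 1 $ j" "M $ 2 $ j = r * N (\<lambda>j. y j r) $ 2 $ j"
    "M $ 3 $ j = r * N (\<lambda>j. y j r) $ 3 $ j" if "j \<noteq> 1" for j
    unfolding M sol_jump[OF sol] N_def using that by (simp_all add: y_def)
  have "det M = r ^ 3 * det (N (\<lambda>j. y j r))"
    unfolding det_3 by (simp add: M1 M2 power3_eq_cube algebra_simps)
  moreover have "det M = det X * det (R ** V)" by (simp add: M_def det_mul)
  ultimately show ?thesis by (simp add: monodromy_det_def X_def V_def)
qed

text \<open>The functionals in \<open>R\<close> are adapted to the jets: by the values of
  \<open>L\<close> and of the Wronskians, the matrix at r = 0 is upper triangular with diagonal s,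
  1, 1. In particular it is invertible.\<close>

lemma tendsto_det_RV: "((\<lambda>r. det (R ** (\<chi> i j. V0 r j $ i))) \<longlongrightarrow> s) (at 0)"
proof -
  have RV: "(R ** (\<chi> i j. V0 r j $ i)) $ i $ j = (R *v V0 r j) $ i" for r i j
    by (simp add: matrix_matrix_mult_def matrix_vector_mult_def)
  have Rx: "R *v Jx 0 = vector [s, 0, 0]"
  proof -
    have "(v 0 * a 0 - k 0 * v2 0) * v1 0 + (k 0 * v1 0 - v 0 * k1 0) * v2 0 - v 0 * k 0 * v3 0
        = v 0 * (a 0 * v1 0 - k1 0 * v2 0 - k 0 * v3 0)" by (simp add: algebra_simps)
    then show ?thesis
      using L_v1[of 0]
      by (simp add: vec_eq_iff forall_3 R_def Jx_def matrix_vector_mult_def sum_3 s_def power2_eq_square)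
  qed
  have Rw: "R *v Jw j 0 = vector [v1 0 * w j 0 + v2 0 * w1 j 0,
      k 0 * (v1 0 * w1 j 0 - v2 0 * w j 0) + v 0 * (a 0 * w j 0 - k1 0 * w1 j 0 - k 0 * w2 j 0),
      a 0 * w j 0 - k1 0 * w1 j 0 - k 0 * w2 j 0]" for j
    by (simp add: vec_eq_iff forall_3 R_def Jw_def matrix_vector_mult_def sum_3 algebra_simps)
  define p where "p j = v1 0 * w j 0 + v2 0 * w1 j 0" for j
  have Rw1: "R *v Jw 1 0 = vector [p 1, 1, 0]" unfolding Rw L_w1 wronskian1 p_def by simp
  have Rw2: "R *v Jw 2 0 = vector [p 2, 0, 1]" unfolding Rw L_w2 wronskian2 p_def by simp
  have Rw3: "R *v Jw 3 0 = vector [p 3, - ((v 0)\<^sup>2 / 2), - v 0]"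
    unfolding Rw L_w3 wronskian3 p_def by (simp add: power2_eq_square)
  have R1: "R *v V0 r 1 = vector [s - r * p 3, r * ((v 0)\<^sup>2 / 2), r * v 0]" for r
    by (simp add: V0_def matrix_vector_mult_diff_distrib matrix_vector_mult_scaleR Rx Rw3 vec_eq_iff forall_3)
  have R2: "R *v V0 r 2 = vector [p 1, 1, 0]" "R *v V0 r 3 = vector [p 2, 0, 1]" for r
    by (simp_all add: V0_def Rw1 Rw2)
  have "det (R ** (\<chi> i j. V0 r j $ i)) = s - r * p 3 - p 1 * (r * ((v 0)\<^sup>2 / 2)) - p 2 * (r * v 0)" for r
    unfolding det_3 RV R1 R2 by simp
  moreover have "((\<lambda>r. s - r * p 3 - p 1 * (r * ((v 0)\<^sup>2 / 2)) - p 2 * (r * v 0)) \<longlongrightarrow>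
      s - 0 * p 3 - p 1 * (0 * ((v 0)\<^sup>2 / 2)) - p 2 * (0 * v 0)) (at 0)"
    by (intro tendsto_intros)
  ultimately show ?thesis by simp
qed

text \<open>Row i is the derivative of the period, of minus the integral of v and of half the
  integral of v^2 in the i-th parameter; the terms with v(0) come from the moving endpoint.\<close>

definition G :: "real^3^3" where
  "G = (\<chi> i. vector [Y i, - (Y i * v 0 + integral {0..P} (w i)),
      Y i * ((v 0)\<^sup>2 / 2) + integral {0..P} (\<lambda>x. v x * w i x)])"

text \<open>The v(0) terms of \<open>G\<close> are multiples of its first column and do not affect
  the determinant. The columns of \<open>N y0\<close> follow the order c, \<mu>, \<lambda>, a cyclic
  and thus even permutation. The signs from -w_c, from the jumps, from exchanging the two integral
  rows and from the minus in \<open>G\<close> cancel.\<close>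

lemma det_N_y0: "det (N y0) = s * det G"
proof -
  have N1: "N y0 $ 1 $ 1 = Y 3 * s" "N y0 $ 1 $ 2 = - Y 1 * s" "N y0 $ 1 $ 3 = - Y 2 * s"
  proof -
    have "v1 0 * (w j P - w j 0) + v2 0 * (w1 j P - w1 j 0) = - Y j * s" for j
      by (simp add: jump s_def power2_eq_square algebra_simps)
    from this[of 1] this[of 2] this[of 3]
    show "N y0 $ 1 $ 1 = Y 3 * s" "N y0 $ 1 $ 2 = - Y 1 * s" "N y0 $ 1 $ 3 = - Y 2 * s"
      unfolding N_def y0_def Jw_def by (simp_all add: algebra_simps)
  qed
  have N2: "N y0 $ 2 $ 1 = - integral {0..P} (\<lambda>x. v x * w 3 x)"
    "N y0 $ 2 $ 2 = integral {0..P} (\<lambda>x. v x * w 1 x)"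
    "N y0 $ 2 $ 3 = integral {0..P} (\<lambda>x. v x * w 2 x)"
    by (simp_all add: N_def y0_def Jw_def)
  have N3: "N y0 $ 3 $ 1 = - integral {0..P} (w 3)"
    "N y0 $ 3 $ 2 = integral {0..P} (w 1)"
    "N y0 $ 3 $ 3 = integral {0..P} (w 2)"
    by (simp_all add: N_def y0_def Jw_def)
  define q where "q = (v 0)\<^sup>2 / 2"
  show ?thesis
    unfolding det_3 N1 N2 N3 G_def q_def[symmetric] by (simp add: algebra_simps)
qed

lemma d_asymptotics: "((\<lambda>r. d r / r ^ 3) \<longlongrightarrow> det G) (at 0)"
proof -
  let ?D = "\<lambda>r. det (R ** (\<chi> i j. V0 r j $ i))"
  have "((\<lambda>r. det (N (\<lambda>j. y j r)) / ?D r) \<longlongrightarrow> det (N y0) / s) (at 0)"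
    by (intro tendsto_divide tendsto_N tendsto_det_RV s_nonzero)
  moreover have "\<forall>\<^sub>F r in at 0. ?D r \<noteq> 0 \<and> r \<noteq> 0"
    using tendsto_imp_eventually_ne[OF tendsto_det_RV s_nonzero] eventually_neq_at_within[of 0]
    by eventually_elim simp
  then have "\<forall>\<^sub>F r in at 0. det (N (\<lambda>j. y j r)) / ?D r = d r / r ^ 3"
  proof eventually_elim
    case (elim r)
    then show ?case using d_times_det[of r] by (simp add: field_simps)
  qed
  ultimately have "((\<lambda>r. d r / r ^ 3) \<longlongrightarrow> det (N y0) / s) (at 0)" by (rule Lim_transform_eventually)
  then show ?thesis using s_nonzero by (simp add: det_N_y0)
qed

end

section \<open>Smooth functions and their partial derivatives\<close>

lemma smooth_on_differentiable: "smooth_on S f \<Longrightarrow> x \<in> S \<Longrightarrow> f differentiable (at x)"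
  unfolding smooth_on_def by (metis Ck_on.simps(2))

lemma smooth_on_continuous: "smooth_on S f \<Longrightarrow> continuous_on S f"
  unfolding smooth_on_def by (metis Ck_on.simps(1))

lemma smooth_on_frechet: "smooth_on S f \<Longrightarrow> smooth_on S (\<lambda>x. frechet_derivative f (at x) h)"
  unfolding smooth_on_def by (metis Ck_on.simps(2))

lemma smooth_on_has_derivative:
  "smooth_on S f \<Longrightarrow> x \<in> S \<Longrightarrow> (f has_derivative frechet_derivative f (at x)) (at x)"
  using smooth_on_differentiable frechet_derivative_works by blast

lemma has_real_derivative_along:
  fixes G :: "'a::real_normed_vector \<Rightarrow> real"
  assumes "smooth_on S G" "p t \<in> S" "(p has_vector_derivative p') (at t)"
  shows "((\<lambda>t. G (p t)) has_real_derivative frechet_derivative G (at (p t)) p') (at t)"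
proof -
  have G: "(G has_derivative frechet_derivative G (at (p t))) (at (p t))"
    using smooth_on_has_derivative assms by blast
  have "((\<lambda>t. G (p t)) has_derivative (\<lambda>h. frechet_derivative G (at (p t)) (h *\<^sub>R p'))) (at t)"
    using has_derivative_compose[OF assms(3)[unfolded has_vector_derivative_def] G] .
  then show ?thesis
    unfolding has_field_derivative_def
    by (rule has_derivative_eq_rhs)
      (simp add: fun_eq_iff linear_scale[OF has_derivative_linear[OF G]] mult.commute)
qed

lemma frechet_derivative_prod:
  fixes G :: "'a::real_normed_vector \<times> 'b::real_normed_vector \<Rightarrow> real"
  assumes "smooth_on S G" "p \<in> S"
  shows "frechet_derivative G (at p) (h, c *\<^sub>R k)
    = frechet_derivative G (at p) (h, 0) + c * frechet_derivative G (at p) (0, k)"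
proof -
  have "linear (frechet_derivative G (at p))"
    using smooth_on_has_derivative[OF assms] has_derivative_linear by blast
  moreover have "(h, c *\<^sub>R k) = (h, 0) + c *\<^sub>R (0, k)" by simp
  ultimately show ?thesis by (simp only: linear_add linear_scale real_scaleR_def)
qed

text \<open>\<open>pd_v\<close> differentiates a one-variable slice, while smoothness speaks of
  Frechet derivatives; this identification lets smoothness pass to the partial derivatives.\<close>

lemma pd_v_eq_frechet:
  assumes "smooth_on UNIV E"
  shows "pd_v E = (\<lambda>p. frechet_derivative E (at p) (1, 0))"
proof (rule ext, clarify)
  fix v q
  have "((\<lambda>s. E (s, q)) has_real_derivative frechet_derivative E (at (v, q)) (1, 0)) (at v)"
    by (rule has_real_derivative_along[OF assms, where p = "\<lambda>s. (s, q)"])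
      (auto intro!: has_vector_derivative_Pair derivative_eq_intros)
  then show "pd_v E (v, q) = frechet_derivative E (at (v, q)) (1, 0)"
    by (simp add: pd_v_def DERIV_imp_deriv)
qed

lemma pd_vx_eq_frechet:
  assumes "smooth_on UNIV E"
  shows "pd_vx E = (\<lambda>p. frechet_derivative E (at p) (0, 1))"
proof (rule ext, clarify)
  fix v q
  have "((\<lambda>s. E (v, s)) has_real_derivative frechet_derivative E (at (v, q)) (0, 1)) (at q)"
    by (rule has_real_derivative_along[OF assms, where p = "\<lambda>s. (v, s)"])
      (auto intro!: has_vector_derivative_Pair derivative_eq_intros)
  then show "pd_vx E (v, q) = frechet_derivative E (at (v, q)) (0, 1)"
    by (simp add: pd_vx_def DERIV_imp_deriv)
qed

lemma smooth_on_pd: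
  assumes "smooth_on UNIV E"
  shows "smooth_on UNIV (pd_v E)" "smooth_on UNIV (pd_vx E)"
  using smooth_on_frechet[OF assms] pd_v_eq_frechet[OF assms] pd_vx_eq_frechet[OF assms] by simp_all

lemma DERIV_pd_chain:
  assumes E: "smooth_on UNIV E"
    and f: "(f has_real_derivative f') (at x)" and g: "(g has_real_derivative g') (at x)"
  shows "((\<lambda>x. E (f x, g x)) has_real_derivative pd_v E (f x, g x) * f' + pd_vx E (f x, g x) * g') (at x)"
proof -
  have "((\<lambda>x. E (f x, g x)) has_real_derivative frechet_derivative E (at (f x, g x)) (f', g')) (at x)"
    by (rule has_real_derivative_along[OF E, where p = "\<lambda>x. (f x, g x)"])
      (use f g in \<open>auto intro!: has_vector_derivative_Pair simp flip: has_real_derivative_iff_has_vector_derivative\<close>)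
  moreover have "frechet_derivative E (at (f x, g x)) (f', g')
      = frechet_derivative E (at (f x, g x)) (f' *\<^sub>R (1, 0) + g' *\<^sub>R (0, 1))" by simp
  moreover have "linear (frechet_derivative E (at (f x, g x)))"
    using smooth_on_has_derivative[OF E UNIV_I] has_derivative_linear by blast
  ultimately show ?thesis
    by (simp add: pd_v_eq_frechet[OF E] pd_vx_eq_frechet[OF E] linear_add linear_scale mult.commute
        del: scaleR_Pair)
qed

text \<open>Differentiate \<open>f t x = f t b + \<integral> g t\<close> with respect to \<open>t\<close> under the integral sign.\<close>

lemma swap_derivatives:
  fixes f g gt :: "real \<Rightarrow> real \<Rightarrow> real"
  assumes "0 < \<delta>"
    and f: "\<And>t x. \<bar>t\<bar> < \<delta> \<Longrightarrow> (f t has_real_derivative g t x) (at x)"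
    and ft: "\<And>x. ((\<lambda>t. f t x) has_real_derivative ft x) (at 0)"
    and gt: "\<And>t x. \<bar>t\<bar> < \<delta> \<Longrightarrow> ((\<lambda>t. g t x) has_real_derivative gt t x) (at t)"
    and cont: "continuous_on ({-\<delta><..<\<delta>} \<times> UNIV) (\<lambda>(t, x). gt t x)"
  shows "(ft has_real_derivative gt 0 x) (at x)"
proof -
  \<comment> \<open>Any base point to the left of x serves: x becomes interior, and one-sided
    derivatives of the integral are two-sided.\<close>
  define b where "b = x - 1"
  have int: "(g t has_integral f t z - f t b) {b..z}" if "\<bar>t\<bar> < \<delta>" "b \<le> z" for t z
    using f[OF that(1)] that(2)
    by (intro fundamental_theorem_of_calculus)
      (auto simp: has_real_derivative_iff_has_vector_derivative intro: has_vector_derivative_at_within)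
  have ft_eq: "ft z = ft b + integral {b..z} (gt 0)" if "b \<le> z" for z
  proof -
    have "((\<lambda>t. integral (cbox b z) (g t)) has_real_derivative integral (cbox b z) (gt 0))
        (at 0 within {-\<delta><..<\<delta>})"
    proof (rule leibniz_rule_field_derivative)
      show "continuous_on ({-\<delta><..<\<delta>} \<times> cbox b z) (\<lambda>(t, x). gt t x)"
        by (rule continuous_on_subset[OF cont]) auto
      show "((\<lambda>t. g t x) has_real_derivative gt t x) (at t within {-\<delta><..<\<delta>})"
        if "t \<in> {-\<delta><..<\<delta>}" for t x
        by (rule has_field_derivative_at_within, rule gt) (use that in auto)
      show "g t integrable_on cbox b z" if "t \<in> {-\<delta><..<\<delta>}" for t
        using has_integral_integrable[OF int[of t z]] that \<open>b \<le> z\<close> by auto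
    qed (use \<open>0 < \<delta>\<close> in auto)
    then have "((\<lambda>t. integral {b..z} (g t)) has_real_derivative integral {b..z} (gt 0)) (at 0)"
      using \<open>0 < \<delta>\<close> at_within_open[of 0 "{-\<delta><..<\<delta>}"] by simp
    moreover have "((\<lambda>t. integral {b..z} (g t)) has_real_derivative ft z - ft b) (at 0)"
    proof (rule has_field_derivative_transform_within_open[OF DERIV_diff[OF ft ft]])
      show "f t z - f t b = integral {b..z} (g t)" if "t \<in> {-\<delta><..<\<delta>}" for t
        using integral_unique[OF int[of t z]] that \<open>b \<le> z\<close> by auto
    qed (use \<open>0 < \<delta>\<close> in auto)
    ultimately show ?thesis using DERIV_unique by fastforce
  qed
  have "continuous_on {b..x + 1} (\<lambda>x. (\<lambda>(t, x). gt t x) (0, x))"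
    by (rule continuous_on_compose2[OF cont]) (use \<open>0 < \<delta>\<close> in \<open>auto intro!: continuous_intros\<close>)
  then have "continuous_on {b..x + 1} (gt 0)" by simp
  then have "((\<lambda>z. integral {b..z} (gt 0)) has_real_derivative gt 0 x) (at x within {b..x + 1})"
    by (rule integral_has_real_derivative) (simp add: b_def)
  then have "((\<lambda>z. integral {b..z} (gt 0)) has_real_derivative gt 0 x) (at x)"
    using at_within_interior[of x "{b..x + 1}"] by (simp add: b_def)
  then have "((\<lambda>z. ft b + integral {b..z} (gt 0)) has_real_derivative gt 0 x) (at x)"
    by (auto intro!: derivative_eq_intros)
  then show ?thesis
  proof (rule has_field_derivative_transform_within_open[where S = "{b<..}"])
    show "ft b + integral {b..z} (gt 0) = ft z" if "z \<in> {b<..}" for z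
      using ft_eq[of z] that by simp
  qed (auto simp: b_def)
qed

text \<open>Symmetry of the mixed derivatives is an instance of \<open>swap_derivatives\<close>,
  with the shift of the first variable as t.\<close>

lemma pd_commute:
  assumes E: "smooth_on UNIV E"
  shows "pd_vx (pd_v E) = pd_v (pd_vx E)"
proof (rule ext, clarify)
  fix v q
  note E1 = smooth_on_pd(2)[OF E]
  have "((\<lambda>q. pd_v E (v, q)) has_real_derivative pd_v (pd_vx E) (v + 0, q)) (at q)"
  proof (rule swap_derivatives[where \<delta> = 1 and f = "\<lambda>t q. E (v + t, q)" and g = "\<lambda>t q. pd_vx E (v + t, q)"
        and gt = "\<lambda>t q. pd_v (pd_vx E) (v + t, q)"])
    show "((\<lambda>q. E (v + t, q)) has_real_derivative pd_vx E (v + t, q)) (at q)" for t q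
      using DERIV_pd_chain[OF E, of "\<lambda>_. v + t" 0 q "\<lambda>q. q" 1] by simp
    show "((\<lambda>t. E (v + t, q)) has_real_derivative pd_v E (v, q)) (at 0)" for q
      using DERIV_pd_chain[OF E, of "\<lambda>t. v + t" 1 0 "\<lambda>_. q" 0] by (simp add: DERIV_add_const)
    show "((\<lambda>t. pd_vx E (v + t, q)) has_real_derivative pd_v (pd_vx E) (v + t, q)) (at t)" for t q
      using DERIV_pd_chain[OF E1, of "\<lambda>t. v + t" 1 t "\<lambda>_. q" 0] by (simp add: DERIV_add_const)
    have "continuous_on ({-1<..<1} \<times> UNIV) (\<lambda>p. pd_v (pd_vx E) (v + fst p, snd p))"
      by (rule continuous_on_compose2[OF smooth_on_continuous[OF smooth_on_pd(1)[OF E1]]])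
        (auto intro!: continuous_intros)
    then show "continuous_on ({-1<..<1} \<times> UNIV) (\<lambda>(t, q). pd_v (pd_vx E) (v + t, q))"
      by (simp add: case_prod_beta)
  qed simp
  then show "pd_vx (pd_v E) (v, q) = pd_v (pd_vx E) (v, q)"
    using DERIV_imp_deriv by (fastforce simp: pd_vx_def[of "pd_v E"])
qed

text \<open>The integral is first treated as a function of t and an independent endpoint z. It is
  jointly differentiable because the z-derivative is continuous; the chain rule along (t, Y t) then
  gives the result.\<close>

lemma DERIV_integral_upper:
  fixes f ft :: "real \<Rightarrow> real \<Rightarrow> real"
  assumes "0 < \<delta>"
    and ft: "\<And>t x. \<bar>t\<bar> < \<delta> \<Longrightarrow> ((\<lambda>t. f t x) has_real_derivative ft t x) (at t)"
    and cont: "continuous_on ({-\<delta><..<\<delta>} \<times> UNIV) (\<lambda>(t, x). f t x)"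
    and cont_ft: "continuous_on ({-\<delta><..<\<delta>} \<times> UNIV) (\<lambda>(t, x). ft t x)"
    and Y: "(Y has_real_derivative Y') (at 0)" "0 < Y 0"
  shows "((\<lambda>t. integral {0..Y t} (f t)) has_real_derivative
    Y' * f 0 (Y 0) + integral {0..Y 0} (ft 0)) (at 0)"
proof -
  define X where "X = {-\<delta><..<\<delta>}"
  define S where "S = {0<..<2 * Y 0}"
  have X: "0 \<in> X" "open X" "convex X" and S: "Y 0 \<in> S" "open S" "convex S"
    using assms by (auto simp: X_def S_def)
  have fc: "continuous_on T (f t)" if "t \<in> X" for t T
  proof -
    have "continuous_on T (\<lambda>x. (\<lambda>(t, x). f t x) (t, x))"
      by (rule continuous_on_compose2[OF cont]) (use that in \<open>auto simp: X_def intro!: continuous_intros\<close>)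
    then show ?thesis by simp
  qed
  have "((\<lambda>(t, z). integral {0..z} (f t)) has_derivative
      (\<lambda>(h, k). integral {0..Y 0} (ft 0) * h + blinfun_scaleR_left (f 0 (Y 0)) k)) (at (0, Y 0) within X \<times> S)"
  proof (rule has_derivative_partialsI[where fy = "\<lambda>t z. blinfun_scaleR_left (f t z)"])
    have "((\<lambda>t. integral (cbox 0 (Y 0)) (f t)) has_real_derivative integral (cbox 0 (Y 0)) (ft 0)) (at 0 within X)"
    proof (rule leibniz_rule_field_derivative)
      show "continuous_on (X \<times> cbox 0 (Y 0)) (\<lambda>(t, x). ft t x)"
        unfolding X_def by (rule continuous_on_subset[OF cont_ft]) auto
      show "((\<lambda>t. f t x) has_real_derivative ft t x) (at t within X)" if "t \<in> X" for t x
        by (rule has_field_derivative_at_within, rule ft) (use that in \<open>auto simp: X_def\<close>)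
      show "f t integrable_on cbox 0 (Y 0)" if "t \<in> X" for t
        by (intro integrable_continuous fc that)
    qed (use X in auto)
    then show "((\<lambda>t. integral {0..Y 0} (f t)) has_derivative (\<lambda>h. integral {0..Y 0} (ft 0) * h)) (at 0 within X)"
      by (simp add: has_field_derivative_def)
    fix t z assume t: "t \<in> X" and z: "z \<in> S"
    have "((\<lambda>z. integral {0..z} (f t)) has_real_derivative f t z) (at z within {0..2 * Y 0})"
      using z by (intro integral_has_real_derivative fc t) (auto simp: S_def)
    then have "((\<lambda>z. integral {0..z} (f t)) has_real_derivative f t z) (at z within S)"
      by (rule DERIV_subset) (auto simp: S_def)
    then show "((\<lambda>z. integral {0..z} (f t)) has_derivative blinfun_apply (blinfun_scaleR_left (f t z))) (at z within S)"
      unfolding has_real_derivative_iff_has_vector_derivative has_vector_derivative_eq_has_derivative_blinfun .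
  next
    have "continuous_on (X \<times> S) (\<lambda>(t, x). f t x)"
      unfolding X_def by (rule continuous_on_subset[OF cont]) auto
    then have "continuous_on (X \<times> S) (\<lambda>p. blinfun_scaleR_left ((\<lambda>(t, x). f t x) p))"
      by (rule bounded_linear.continuous_on[OF bounded_linear_blinfun_scaleR_left])
    then show "continuous (at (0, Y 0) within X \<times> S) (\<lambda>(t, z). blinfun_scaleR_left (f t z))"
      using X S by (auto simp: continuous_on_eq_continuous_within case_prod_beta')
  qed (use S in auto)
  then have H: "((\<lambda>(t, z). integral {0..z} (f t)) has_derivative
      (\<lambda>(h, k). integral {0..Y 0} (ft 0) * h + k * f 0 (Y 0))) (at (0, Y 0))"
    using X S at_within_open[of "(0, Y 0)" "X \<times> S"] by (simp add: open_Times)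
  have "((\<lambda>t. (t, Y t)) has_derivative (\<lambda>h. (h, Y' * h))) (at 0)"
    using Y(1) by (auto intro!: has_derivative_Pair simp: has_field_derivative_def)
  from has_derivative_compose[OF this H, unfolded prod.case]
  show ?thesis unfolding has_field_derivative_def
    by (rule has_derivative_eq_rhs) (auto simp: fun_eq_iff algebra_simps)
qed

text \<open>This algebra is closed under differentiation, so its members are smooth.\<close>

inductive_set jet_alg :: "(real \<Rightarrow> real) \<Rightarrow> (real \<Rightarrow> real) set" for v where
  iter: "(deriv ^^ i) v \<in> jet_alg v"
| const: "(\<lambda>_. c) \<in> jet_alg v"
| comp: "smooth_on UNIV E \<Longrightarrow> (\<lambda>x. E (jet v x)) \<in> jet_alg v"
| add: "f \<in> jet_alg v \<Longrightarrow> g \<in> jet_alg v \<Longrightarrow> (\<lambda>x. f x + g x) \<in> jet_alg v"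
| mult: "f \<in> jet_alg v \<Longrightarrow> g \<in> jet_alg v \<Longrightarrow> (\<lambda>x. f x * g x) \<in> jet_alg v"

lemma jet_alg_deriv:
  assumes v: "\<And>i x. (deriv ^^ i) v field_differentiable at x" and "f \<in> jet_alg v"
  shows "(\<forall>x. (f has_real_derivative deriv f x) (at x)) \<and> deriv f \<in> jet_alg v"
proof -
  have deriv_in: "(\<forall>x. (f has_real_derivative deriv f x) (at x)) \<and> deriv f \<in> X"
    if f: "\<And>x. (f has_real_derivative f' x) (at x)" and "f' \<in> X" for f f' :: "real \<Rightarrow> real" and X
  proof -
    have "deriv f = f'" using DERIV_imp_deriv[OF f] by auto
    then show ?thesis using that by simp
  qed
  from assms(2) show ?thesis
  proof induction
    case (iter i)
    show ?case using v jet_alg.iter[where i = "Suc i" and v = v]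
      by (simp add: DERIV_deriv_iff_field_differentiable)
  next
    case (const c)
    show ?case by (simp add: jet_alg.const)
  next
    case (comp E)
    have d: "((deriv ^^ i) v has_real_derivative (deriv ^^ Suc i) v x) (at x)" for i x
      using v by (simp add: DERIV_deriv_iff_field_differentiable)
    have "((\<lambda>x. E (jet v x)) has_real_derivative
        pd_v E (jet v x) * (deriv ^^ 1) v x + pd_vx E (jet v x) * (deriv ^^ 2) v x) (at x)" for x
      using DERIV_pd_chain[OF comp d[of 0 x] d[of 1 x]] by (simp add: jet_def numeral_2_eq_2)
    moreover have "(\<lambda>x. pd_v E (jet v x) * (deriv ^^ 1) v x + pd_vx E (jet v x) * (deriv ^^ 2) v x) \<in> jet_alg v"
      by (intro jet_alg.intros smooth_on_pd comp)
    ultimately show ?case by (rule deriv_in)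
  next
    case (add f g)
    then have "((\<lambda>x. f x + g x) has_real_derivative deriv f x + deriv g x) (at x)" for x
      by (auto intro!: derivative_eq_intros)
    moreover have "(\<lambda>x. deriv f x + deriv g x) \<in> jet_alg v" using add by (intro jet_alg.add) auto
    ultimately show ?case by (rule deriv_in)
  next
    case (mult f g)
    then have "((\<lambda>x. f x * g x) has_real_derivative deriv f x * g x + deriv g x * f x) (at x)" for x
      by (auto intro!: derivative_eq_intros)
    moreover have "(\<lambda>x. deriv f x * g x + deriv g x * f x) \<in> jet_alg v"
      using mult by (intro jet_alg.add jet_alg.mult) auto
    ultimately show ?case by (rule deriv_in)
  qed
qed

section \<open>The family of waves\<close>

text \<open>Encoding through the Frechet derivative on the product keeps all iterated x- and
  parameter derivatives smooth by \<open>smooth_on_frechet\<close>.\<close>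

definition dx :: "((real^3) \<times> real \<Rightarrow> real) \<Rightarrow> (real^3) \<times> real \<Rightarrow> real" where
  "dx G = (\<lambda>p. frechet_derivative G (at p) (0, 1))"

definition dpar :: "3 \<Rightarrow> ((real^3) \<times> real \<Rightarrow> real) \<Rightarrow> (real^3) \<times> real \<Rightarrow> real" where
  "dpar j G = (\<lambda>p. frechet_derivative G (at p) (axis j 1, 0))"

lemma add_impulse_pd:
  assumes e: "smooth_on UNIV e"
  shows "pd_v (add_impulse e c) = (\<lambda>(v, q). pd_v e (v, q) + c * v)"
    "pd_vx (add_impulse e c) = pd_vx e"
    "pd_v (pd_v (add_impulse e c)) = (\<lambda>p. pd_v (pd_v e) p + c)"
proof -
  have 1: "((\<lambda>s. E (s, q)) has_real_derivative pd_v E (v, q)) (at v)" if "smooth_on UNIV E" for E v q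
    using DERIV_pd_chain[OF that, of "\<lambda>s. s" 1 v "\<lambda>_. q" 0] by simp
  have 2: "((\<lambda>s. E (v, s)) has_real_derivative pd_vx E (v, q)) (at q)" if "smooth_on UNIV E" for E v q
    using DERIV_pd_chain[OF that, of "\<lambda>_. v" 0 q "\<lambda>s. s" 1] by simp
  have "((\<lambda>s. add_impulse e c (s, q)) has_real_derivative pd_v e (v, q) + c * v) (at v)" for v q
    unfolding add_impulse_def impulse_def by (auto intro!: derivative_eq_intros 1 e)
  then show 3: "pd_v (add_impulse e c) = (\<lambda>(v, q). pd_v e (v, q) + c * v)"
    unfolding pd_v_def[of "add_impulse e c"] using DERIV_imp_deriv by (fastforce simp: fun_eq_iff)
  have "((\<lambda>s. add_impulse e c (v, s)) has_real_derivative pd_vx e (v, q)) (at q)" for v q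
    unfolding add_impulse_def by (auto intro!: derivative_eq_intros 2 e)
  then show "pd_vx (add_impulse e c) = pd_vx e"
    unfolding pd_vx_def[of "add_impulse e c"] using DERIV_imp_deriv by (fastforce simp: fun_eq_iff)
  have "((\<lambda>s. pd_v (add_impulse e c) (s, q)) has_real_derivative pd_v (pd_v e) (v, q) + c) (at v)" for v q
    unfolding 3 by (auto intro!: derivative_eq_intros 1 smooth_on_pd e)
  then show "pd_v (pd_v (add_impulse e c)) = (\<lambda>p. pd_v (pd_v e) p + c)"
    unfolding pd_v_def[of "pd_v (add_impulse e c)"] using DERIV_imp_deriv by (fastforce simp: fun_eq_iff)
qed

locale wave_family =
  fixes e :: "real \<times> real \<Rightarrow> real"
    and \<Omega> :: "(real^3) set"
    and u :: "real^3 \<Rightarrow> real \<Rightarrow> real"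
    and \<Upsilon> :: "real^3 \<Rightarrow> real"
  assumes e_smooth: "smooth_on UNIV e"
    and e_convex: "\<And>v p. pd_vx (pd_vx e) (v, p) > 0"
    and \<Omega>_open: "open \<Omega>"
    and u_smooth: "smooth_on (\<Omega> \<times> UNIV) (\<lambda>(n, x). u n x)"
    and \<Upsilon>_smooth: "smooth_on \<Omega> \<Upsilon>"
    and \<Upsilon>_pos: "\<And>n. n \<in> \<Omega> \<Longrightarrow> \<Upsilon> n > 0"
    and u_periodic: "\<And>n x. n \<in> \<Omega> \<Longrightarrow> u n (x + \<Upsilon> n) = u n x"
    and euler_lagrange: "\<And>n x. n \<in> \<Omega> \<Longrightarrow> var_deriv (add_impulse e (n $ 3)) (u n) x = n $ 2"
    and first_integral: "\<And>n x. n \<in> \<Omega> \<Longrightarrow>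
      u n x * var_deriv e (u n) x + legendre e (u n) x + n $ 3 * impulse (u n x) = n $ 1"
begin

abbreviation U :: "(real^3) \<times> real \<Rightarrow> real" where "U \<equiv> \<lambda>(n, x). u n x"
abbreviation smooth :: "((real^3) \<times> real \<Rightarrow> real) \<Rightarrow> bool" where "smooth \<equiv> smooth_on (\<Omega> \<times> UNIV)"
abbreviation line :: "real^3 \<Rightarrow> 3 \<Rightarrow> real \<Rightarrow> real^3" where "line n j t \<equiv> n + t *\<^sub>R axis j 1"
definition J :: "real^3 \<Rightarrow> real \<Rightarrow> real \<times> real" where "J n x = (U (n, x), dx U (n, x))"

lemma smooth_dx: "smooth G \<Longrightarrow> smooth (dx G)"
  unfolding dx_def by (rule smooth_on_frechet)

lemma smooth_dpar: "smooth G \<Longrightarrow> smooth (dpar j G)"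
  unfolding dpar_def by (rule smooth_on_frechet)

lemmas smooth_intros = u_smooth smooth_dx smooth_dpar

lemma slice_x:
  assumes "smooth G" "n \<in> \<Omega>"
  shows "((\<lambda>x. G (n, x)) has_real_derivative dx G (n, x)) (at x)"
  unfolding dx_def
  by (rule has_real_derivative_along[OF assms(1), where p = "\<lambda>x. (n, x)"])
    (use assms in \<open>auto intro!: has_vector_derivative_Pair derivative_eq_intros\<close>)

lemma slice_t:
  assumes "smooth G" "line n j t \<in> \<Omega>"
  shows "((\<lambda>t. G (line n j t, x)) has_real_derivative dpar j G (line n j t, x)) (at t)"
  unfolding dpar_def
  by (rule has_real_derivative_along[OF assms(1), where p = "\<lambda>t. (line n j t, x)"])
    (use assms in \<open>auto intro!: has_vector_derivative_Pair derivative_eq_intros\<close>)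

lemma slice_t_0:
  assumes "smooth G" "n \<in> \<Omega>"
  shows "((\<lambda>t. G (line n j t, x)) has_real_derivative dpar j G (n, x)) (at 0)"
  using slice_t[OF assms(1), where t = 0 and n = n and j = j and x = x] assms(2) by simp

lemma line_in:
  assumes "n \<in> \<Omega>"
  shows "\<exists>\<delta>>0. \<forall>t. \<bar>t\<bar> < \<delta> \<longrightarrow> line n j t \<in> \<Omega>"
proof -
  obtain \<delta> where "\<delta> > 0" "ball n \<delta> \<subseteq> \<Omega>" using \<Omega>_open assms open_contains_ball by blast
  then show ?thesis by (intro exI[of _ \<delta>]) (auto simp: dist_norm norm_axis_1 subset_iff)
qed

lemma line_nth: "line n j t $ i = n $ i + t * axis j 1 $ i" by simp

lemma cont_line:
  assumes "smooth G" "\<forall>t. \<bar>t\<bar> < \<delta> \<longrightarrow> line n j t \<in> \<Omega>"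
  shows "continuous_on ({-\<delta><..<\<delta>} \<times> UNIV) (\<lambda>p. G (line n j (fst p), snd p))"
  by (rule continuous_on_compose2[OF smooth_on_continuous[OF assms(1)]])
    (use assms(2) in \<open>auto intro!: continuous_intros\<close>)

lemma dx_dpar_commute:
  assumes G: "smooth G" and n: "n \<in> \<Omega>"
  shows "dx (dpar j G) (n, x) = dpar j (dx G) (n, x)"
proof -
  obtain \<delta> where \<delta>: "\<delta> > 0" "\<forall>t. \<bar>t\<bar> < \<delta> \<longrightarrow> line n j t \<in> \<Omega>" using line_in[OF n] by blast
  have "((\<lambda>x. dpar j G (n, x)) has_real_derivative dpar j (dx G) (line n j 0, x)) (at x)"
  proof (rule swap_derivatives[OF \<delta>(1)])
    show "((\<lambda>x. G (line n j t, x)) has_real_derivative dx G (line n j t, x)) (at x)" if "\<bar>t\<bar> < \<delta>" for t x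
      using \<delta> that by (intro slice_x G) auto
    show "((\<lambda>t. G (line n j t, x)) has_real_derivative dpar j G (n, x)) (at 0)" for x
      by (rule slice_t_0[OF G n])
    show "((\<lambda>t. dx G (line n j t, x)) has_real_derivative dpar j (dx G) (line n j t, x)) (at t)"
      if "\<bar>t\<bar> < \<delta>" for t x
      using \<delta> that by (intro slice_t smooth_dx G) auto
    show "continuous_on ({-\<delta><..<\<delta>} \<times> UNIV) (\<lambda>(t, x). dpar j (dx G) (line n j t, x))"
      unfolding case_prod_beta' by (intro cont_line smooth_intros G \<delta>)
  qed
  from DERIV_unique[OF slice_x[OF smooth_dpar[OF G] n] this] show ?thesis by simp
qed

lemma deriv_iter: "n \<in> \<Omega> \<Longrightarrow> (deriv ^^ i) (u n) = (\<lambda>x. (dx ^^ i) U (n, x)) \<and> smooth ((dx ^^ i) U)"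
proof (induction i)
  case (Suc i)
  then have IH: "(deriv ^^ i) (u n) = (\<lambda>x. (dx ^^ i) U (n, x))" and s: "smooth ((dx ^^ i) U)" by auto
  have "deriv (\<lambda>x. (dx ^^ i) U (n, x)) x = dx ((dx ^^ i) U) (n, x)" for x
    by (rule DERIV_imp_deriv[OF slice_x[OF s Suc.prems]])
  then show ?case using IH s by (auto simp: smooth_dx)
qed (simp add: u_smooth)

lemma deriv_u: "n \<in> \<Omega> \<Longrightarrow> deriv (u n) = (\<lambda>x. dx U (n, x))"
  using deriv_iter[of n 1] by simp

lemma jet_u: "n \<in> \<Omega> \<Longrightarrow> jet (u n) x = J n x"
  by (simp add: jet_def J_def deriv_u)

lemma deriv_iter_diff: "n \<in> \<Omega> \<Longrightarrow> (deriv ^^ i) (u n) field_differentiable at x"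
  using deriv_iter[of n i] slice_x[of "(dx ^^ i) U" n x] by (auto simp: field_differentiable_def)

lemma jet_alg_u:
  assumes "n \<in> \<Omega>" "f \<in> jet_alg (u n)"
  shows "(f has_real_derivative deriv f x) (at x)" "deriv f \<in> jet_alg (u n)" "continuous_on S f"
proof -
  show d: "(f has_real_derivative deriv f x) (at x)" and "deriv f \<in> jet_alg (u n)" for x
    using jet_alg_deriv[OF deriv_iter_diff[OF assms(1)] assms(2)] by auto
  show "continuous_on S f"
    by (rule DERIV_continuous_on, rule has_field_derivative_at_within, rule d)
qed

lemma J_deriv_x:
  assumes "smooth_on UNIV E" "n \<in> \<Omega>"
  shows "((\<lambda>x. E (J n x)) has_real_derivative
    pd_v E (J n x) * dx U (n, x) + pd_vx E (J n x) * dx (dx U) (n, x)) (at x)"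
  unfolding J_def by (intro DERIV_pd_chain assms slice_x smooth_intros)

lemma J_deriv_t:
  assumes "smooth_on UNIV E" "line n j t \<in> \<Omega>"
  shows "((\<lambda>t. E (J (line n j t) x)) has_real_derivative
    pd_v E (J (line n j t) x) * dpar j U (line n j t, x)
    + pd_vx E (J (line n j t) x) * dpar j (dx U) (line n j t, x)) (at t)"
  unfolding J_def by (intro DERIV_pd_chain assms slice_t smooth_intros)

lemma J_deriv_t_0:
  assumes "smooth_on UNIV E" "n \<in> \<Omega>"
  shows "((\<lambda>t. E (J (line n j t) x)) has_real_derivative
    pd_v E (J n x) * dpar j U (n, x) + pd_vx E (J n x) * dx (dpar j U) (n, x)) (at 0)"
  using J_deriv_t[OF assms(1), where t = 0 and n = n and j = j and x = x] assms(2)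
  by (simp add: dx_dpar_commute[OF u_smooth])

lemma cont_J:
  assumes "smooth_on UNIV E" "\<forall>t. \<bar>t\<bar> < \<delta> \<longrightarrow> line n j t \<in> \<Omega>"
  shows "continuous_on ({-\<delta><..<\<delta>} \<times> UNIV) (\<lambda>p. E (J (line n j (fst p)) (snd p)))"
proof (rule continuous_on_compose2[OF smooth_on_continuous[OF assms(1)] _ subset_UNIV])
  show "continuous_on ({-\<delta><..<\<delta>} \<times> UNIV) (\<lambda>p. J (line n j (fst p)) (snd p))"
    unfolding J_def by (intro continuous_on_Pair cont_line smooth_intros assms(2))
qed

text \<open>The Euler-Lagrange equation is solved for the total derivative of the momentum;
  smoothness provides the differentiability that \<open>deriv\<close> alone does not assert.\<close>

lemma ep_deriv:
  assumes n: "n \<in> \<Omega>"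
  shows "((\<lambda>y. pd_vx e (J n y)) has_real_derivative pd_v e (J n x) + n $ 3 * u n x - n $ 2) (at x)"
proof -
  have 1: "((\<lambda>y. pd_vx e (J n y)) has_real_derivative deriv (\<lambda>y. pd_vx e (J n y)) x) (at x)"
    using J_deriv_x[OF smooth_on_pd(2)[OF e_smooth] n, of x] DERIV_imp_deriv by fastforce
  have "pd_v (add_impulse e (n $ 3)) (J n x) = pd_v e (J n x) + n $ 3 * u n x"
    by (simp add: add_impulse_pd[OF e_smooth] J_def)
  then have "deriv (\<lambda>y. pd_vx e (J n y)) x = pd_v e (J n x) + n $ 3 * u n x - n $ 2"
    using euler_lagrange[OF n, of x] by (simp add: var_deriv_def jet_u[OF n] add_impulse_pd[OF e_smooth])
  with 1 show ?thesis by simp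
qed

text \<open>Eliminating the variational derivative between the two profile equations leaves a first
  integral. Equivalently, along a profile the integrand of the action equals v_x times the
  momentum.\<close>

lemma energy:
  assumes n: "n \<in> \<Omega>"
  shows "dx U (n, x) * pd_vx e (J n x) - e (J n x) - n $ 3 / 2 * (u n x)\<^sup>2 + n $ 2 * u n x = n $ 1"
proof -
  have vd: "var_deriv e (u n) x = n $ 2 - n $ 3 * u n x"
    using DERIV_imp_deriv[OF ep_deriv[OF n, of x]] by (simp add: var_deriv_def jet_u[OF n])
  then show ?thesis
    using first_integral[OF n, of x]
    by (simp add: vd legendre_def impulse_def jet_u[OF n] deriv_u[OF n] power2_eq_square algebra_simps)
qed

definition al where "al n x = pd_v (pd_v e) (J n x) + n $ 3"
definition be where "be n x = pd_v (pd_vx e) (J n x)"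
definition ka where "ka n x = pd_vx (pd_vx e) (J n x)"

lemma coeffs_in_jet_alg:
  assumes n: "n \<in> \<Omega>"
  shows "al n \<in> jet_alg (u n)" "be n \<in> jet_alg (u n)" "ka n \<in> jet_alg (u n)"
proof -
  have "(\<lambda>x. pd_v (pd_v e) (jet (u n) x) + n $ 3) \<in> jet_alg (u n)"
    by (intro jet_alg.intros smooth_on_pd e_smooth)
  then show "al n \<in> jet_alg (u n)" by (simp add: al_def[abs_def] jet_u[OF n])
  have "(\<lambda>x. pd_v (pd_vx e) (jet (u n) x)) \<in> jet_alg (u n)" "(\<lambda>x. pd_vx (pd_vx e) (jet (u n) x)) \<in> jet_alg (u n)"
    by (intro jet_alg.intros smooth_on_pd e_smooth)+
  then show "be n \<in> jet_alg (u n)" "ka n \<in> jet_alg (u n)"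
    by (simp_all add: be_def[abs_def] ka_def[abs_def] jet_u[OF n])
qed

lemma el_second_order:
  assumes n: "n \<in> \<Omega>"
  shows "be n x * dx U (n, x) + ka n x * dx (dx U) (n, x) = pd_v e (J n x) + n $ 3 * u n x - n $ 2"
  using DERIV_unique[OF J_deriv_x[OF smooth_on_pd(2)[OF e_smooth] n, of x] ep_deriv[OF n, of x]]
  by (simp add: be_def ka_def)

text \<open>Translation invariance: the x-derivative of the Euler-Lagrange equation, whose
  right-hand side is constant in x.\<close>

lemma L_dx:
  assumes n: "n \<in> \<Omega>"
  shows "(al n x - deriv (be n) x) * dx U (n, x) - deriv (ka n) x * dx (dx U) (n, x)
    - ka n x * dx (dx (dx U)) (n, x) = 0"
proof -
  note d = slice_x[OF _ n] smooth_intros jet_alg_u(1)[OF n] coeffs_in_jet_alg[OF n]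
  have "((\<lambda>x. be n x * dx U (n, x) + ka n x * dx (dx U) (n, x)) has_real_derivative
      (deriv (be n) x * dx U (n, x) + dx (dx U) (n, x) * be n x)
      + (deriv (ka n) x * dx (dx U) (n, x) + dx (dx (dx U)) (n, x) * ka n x)) (at x)"
    by (intro DERIV_add DERIV_mult d)
  moreover have "((\<lambda>x. pd_v e (J n x) + n $ 3 * u n x - n $ 2) has_real_derivative
      (pd_v (pd_v e) (J n x) * dx U (n, x) + be n x * dx (dx U) (n, x)) + n $ 3 * dx U (n, x) - 0) (at x)"
    using J_deriv_x[OF smooth_on_pd(1)[OF e_smooth] n, of x] slice_x[OF u_smooth n, of x]
    unfolding pd_commute[OF e_smooth] be_def
    by (intro DERIV_add DERIV_diff DERIV_cmult DERIV_const) simp_all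
  ultimately show ?thesis
    unfolding el_second_order[OF n] using DERIV_unique by (fastforce simp: al_def algebra_simps)
qed

text \<open>Differentiating the Euler-Lagrange equation in a parameter gives the derivative of
  \<lambda> - c v with v frozen; hence 0, 1 and -v for \<mu>, \<lambda> and c.\<close>

lemma L_dpar:
  assumes n: "n \<in> \<Omega>"
  shows "(al n x - deriv (be n) x) * dpar j U (n, x) - deriv (ka n) x * dx (dpar j U) (n, x)
    - ka n x * dx (dx (dpar j U)) (n, x) = axis j 1 $ 2 - axis j 1 $ 3 * u n x"
proof -
  obtain \<delta> where \<delta>: "\<delta> > 0" "\<forall>t. \<bar>t\<bar> < \<delta> \<longrightarrow> line n j t \<in> \<Omega>" using line_in[OF n] by blast
  \<comment> \<open>The parameter derivative of the right-hand side of \<open>ep_deriv\<close>.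
    Exchanging derivatives turns it into the x-derivative of the linearized momentum.\<close>
  define gt where "gt t x = pd_v (pd_v e) (J (line n j t) x) * dpar j U (line n j t, x)
      + pd_vx (pd_v e) (J (line n j t) x) * dpar j (dx U) (line n j t, x)
      + (axis j 1 $ 3 * U (line n j t, x) + line n j t $ 3 * dpar j U (line n j t, x)) - axis j 1 $ 2" for t x
  have "((\<lambda>x. pd_v (pd_vx e) (J n x) * dpar j U (n, x) + pd_vx (pd_vx e) (J n x) * dpar j (dx U) (n, x))
      has_real_derivative gt 0 x) (at x)"
  proof (rule swap_derivatives[OF \<delta>(1), where f = "\<lambda>t x. pd_vx e (J (line n j t) x)"
        and g = "\<lambda>t x. pd_v e (J (line n j t) x) + line n j t $ 3 * U (line n j t, x) - line n j t $ 2"])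
    show "((\<lambda>x. pd_vx e (J (line n j t) x)) has_real_derivative
        pd_v e (J (line n j t) x) + line n j t $ 3 * U (line n j t, x) - line n j t $ 2) (at x)" if "\<bar>t\<bar> < \<delta>" for t x
      using ep_deriv[of "line n j t" x] \<delta> that by simp
    show "((\<lambda>t. pd_vx e (J (line n j t) x)) has_real_derivative
        pd_v (pd_vx e) (J n x) * dpar j U (n, x) + pd_vx (pd_vx e) (J n x) * dpar j (dx U) (n, x)) (at 0)" for x
      unfolding dx_dpar_commute[OF u_smooth n, symmetric]
      by (rule J_deriv_t_0[OF smooth_on_pd(2)[OF e_smooth] n])
    show "((\<lambda>t. pd_v e (J (line n j t) x) + line n j t $ 3 * U (line n j t, x) - line n j t $ 2)
        has_real_derivative gt t x) (at t)" if "\<bar>t\<bar> < \<delta>" for t x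
    proof -
      have l: "line n j t \<in> \<Omega>" using \<delta> that by simp
      have c: "((\<lambda>t. line n j t $ i) has_real_derivative axis j 1 $ i) (at t)" for i
        by (auto intro!: derivative_eq_intros)
      show ?thesis
        unfolding gt_def
        by (rule DERIV_cong[OF DERIV_diff[OF DERIV_add[OF J_deriv_t[OF smooth_on_pd(1)[OF e_smooth] l]
              DERIV_mult[OF c slice_t[OF u_smooth l]]] c]]) (simp add: mult.commute)
    qed
    have eq: "(\<lambda>(t, x). gt t x) = (\<lambda>p. gt (fst p) (snd p))" by auto
    show "continuous_on ({-\<delta><..<\<delta>} \<times> UNIV) (\<lambda>(t, x). gt t x)"
      unfolding eq unfolding gt_def line_nth
      by (intro continuous_on_add continuous_on_diff continuous_on_mult continuous_on_const continuous_on_fst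
          continuous_on_id cont_J[OF _ \<delta>(2)] cont_line[OF _ \<delta>(2)] smooth_intros smooth_on_pd e_smooth)
  qed
  moreover have "((\<lambda>x. be n x * dpar j U (n, x) + ka n x * dx (dpar j U) (n, x)) has_real_derivative
      (deriv (be n) x * dpar j U (n, x) + dx (dpar j U) (n, x) * be n x)
      + (deriv (ka n) x * dx (dpar j U) (n, x) + dx (dx (dpar j U)) (n, x) * ka n x)) (at x)"
    by (intro DERIV_add DERIV_mult slice_x[OF _ n] smooth_intros jet_alg_u(1)[OF n] coeffs_in_jet_alg[OF n])
  ultimately have "gt 0 x = (deriv (be n) x * dpar j U (n, x) + dx (dpar j U) (n, x) * be n x)
      + (deriv (ka n) x * dx (dpar j U) (n, x) + dx (dx (dpar j U)) (n, x) * ka n x)"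
    unfolding be_def ka_def dx_dpar_commute[OF u_smooth n] by (rule DERIV_unique)
  then show ?thesis
    by (simp add: gt_def pd_commute[OF e_smooth] al_def dx_dpar_commute[OF u_smooth n]
        be_def[symmetric] algebra_simps)
qed

text \<open>\<open>energy\<close> holds for each member with its own parameters, so its derivative
  along a parameter line vanishes. The momentum terms cancel there, and replacing
  \<open>pd_v e\<close> by the Euler-Lagrange equation leaves the Wronskian.\<close>

lemma wronskian_dpar:
  assumes n: "n \<in> \<Omega>"
  shows "ka n x * (dx U (n, x) * dx (dpar j U) (n, x) - dx (dx U) (n, x) * dpar j U (n, x))
    = axis j 1 $ 1 - axis j 1 $ 2 * u n x + axis j 1 $ 3 * ((u n x)\<^sup>2 / 2)"
proof -
  obtain \<delta> where \<delta>: "\<delta> > 0" "\<forall>t. \<bar>t\<bar> < \<delta> \<longrightarrow> line n j t \<in> \<Omega>" using line_in[OF n] by blast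
  define H where "H t = dx U (line n j t, x) * pd_vx e (J (line n j t) x) - e (J (line n j t) x)
      - line n j t $ 3 / 2 * (U (line n j t, x))\<^sup>2 + line n j t $ 2 * U (line n j t, x) - line n j t $ 1" for t
  have c: "((\<lambda>t. line n j t $ i) has_real_derivative axis j 1 $ i) (at 0)" for i
    by (auto intro!: derivative_eq_intros)
  have Un: "((\<lambda>t. U (line n j t, x)) has_real_derivative dpar j U (n, x)) (at 0)"
    and Uxn: "((\<lambda>t. dx U (line n j t, x)) has_real_derivative dx (dpar j U) (n, x)) (at 0)"
    using slice_t_0[OF u_smooth n] slice_t_0[OF smooth_dx[OF u_smooth] n]
    unfolding dx_dpar_commute[OF u_smooth n] by blast+
  have E: "((\<lambda>t. e (J (line n j t) x)) has_real_derivative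
      pd_v e (J n x) * dpar j U (n, x) + pd_vx e (J n x) * dx (dpar j U) (n, x)) (at 0)"
    and Ep: "((\<lambda>t. pd_vx e (J (line n j t) x)) has_real_derivative
      be n x * dpar j U (n, x) + ka n x * dx (dpar j U) (n, x)) (at 0)"
    unfolding be_def ka_def
    by (rule J_deriv_t_0[OF e_smooth n] J_deriv_t_0[OF smooth_on_pd(2)[OF e_smooth] n])+
  have "(H has_real_derivative
     (dx (dpar j U) (n, x) * pd_vx e (J n x) + dx U (n, x) * (be n x * dpar j U (n, x) + ka n x * dx (dpar j U) (n, x)))
     - (pd_v e (J n x) * dpar j U (n, x) + pd_vx e (J n x) * dx (dpar j U) (n, x))
     - (axis j 1 $ 3 / 2 * (u n x)\<^sup>2 + n $ 3 * (u n x * dpar j U (n, x)))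
     + (axis j 1 $ 2 * u n x + n $ 2 * dpar j U (n, x)) - axis j 1 $ 1) (at 0)"
  proof -
    have "((\<lambda>t. f1 t * f2 t - f3 t - f4 t / 2 * (f5 t)\<^sup>2 + f6 t * f5 t - f7 t) has_real_derivative
        (g1 * f2 0 + f1 0 * g2) - g3 - (g4 / 2 * (f5 0)\<^sup>2 + f4 0 * (f5 0 * g5)) + (g6 * f5 0 + f6 0 * g5) - g7) (at 0)"
      if "(f1 has_real_derivative g1) (at 0)" "(f2 has_real_derivative g2) (at 0)" "(f3 has_real_derivative g3) (at 0)"
        "(f4 has_real_derivative g4) (at 0)" "(f5 has_real_derivative g5) (at 0)" "(f6 has_real_derivative g6) (at 0)"
        "(f7 has_real_derivative g7) (at 0)" for f1 f2 f3 f4 f5 f6 f7 :: "real \<Rightarrow> real" and g1 g2 g3 g4 g5 g6 g7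
      using that by (auto intro!: derivative_eq_intros simp: field_simps)
    from this[OF Uxn Ep E c Un c c] show ?thesis by (simp add: H_def[abs_def])
  qed
  moreover have "(H has_real_derivative 0) (at 0)"
  proof (rule has_field_derivative_transform_within_open[where S = "{-\<delta><..<\<delta>}"])
    show "((\<lambda>_. 0) has_real_derivative 0) (at 0)" by simp
    show "0 = H t" if "t \<in> {-\<delta><..<\<delta>}" for t
      using energy[of "line n j t" x] \<delta> that by (auto simp: H_def)
  qed (use \<delta> in auto)
  ultimately have "(dx (dpar j U) (n, x) * pd_vx e (J n x) + dx U (n, x) * (be n x * dpar j U (n, x) + ka n x * dx (dpar j U) (n, x)))
     - (pd_v e (J n x) * dpar j U (n, x) + pd_vx e (J n x) * dx (dpar j U) (n, x))
     - (axis j 1 $ 3 / 2 * (u n x)\<^sup>2 + n $ 3 * (u n x * dpar j U (n, x)))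
     + (axis j 1 $ 2 * u n x + n $ 2 * dpar j U (n, x)) - axis j 1 $ 1 = 0"
    by (rule DERIV_unique)
  moreover have "pd_v e (J n x) = be n x * dx U (n, x) + ka n x * dx (dx U) (n, x) - n $ 3 * u n x + n $ 2"
    using el_second_order[OF n, of x] by simp
  ultimately show ?thesis by (simp add: algebra_simps)
qed

definition dY where "dY j n = frechet_derivative \<Upsilon> (at n) (axis j 1)"

lemma \<Upsilon>_line: "n \<in> \<Omega> \<Longrightarrow> ((\<lambda>t. \<Upsilon> (line n j t)) has_real_derivative dY j n) (at 0)"
proof -
  assume "n \<in> \<Omega>"
  moreover have "(line n j has_vector_derivative axis j 1) (at 0)"
    by (auto intro!: derivative_eq_intros)
  ultimately show ?thesis
    using has_real_derivative_along[OF \<Upsilon>_smooth, of "line n j" 0 "axis j 1"] by (simp add: dY_def)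
qed

text \<open>The period varies with the parameter, so the parameter derivative of a periodic family
  is not periodic. Differentiating G(n, \<Upsilon>(n)) = G(n, 0) measures the defect.\<close>

lemma jump_dpar:
  assumes G: "smooth G" and per: "\<And>n x. n \<in> \<Omega> \<Longrightarrow> G (n, x + \<Upsilon> n) = G (n, x)" and n: "n \<in> \<Omega>"
  shows "dpar j G (n, \<Upsilon> n) - dpar j G (n, 0) = - dY j n * dx G (n, 0)"
proof -
  obtain \<delta> where \<delta>: "\<delta> > 0" "\<forall>t. \<bar>t\<bar> < \<delta> \<longrightarrow> line n j t \<in> \<Omega>" using line_in[OF n] by blast
  have "dx G (n, 0 + \<Upsilon> n) = dx G (n, 0)"
    by (rule periodic_deriv[OF slice_x[OF G n] per[OF n]])
  then have dxP: "dx G (n, \<Upsilon> n) = dx G (n, 0)" by simp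
  have "((\<lambda>t. (line n j t, \<Upsilon> (line n j t))) has_vector_derivative (axis j 1, dY j n)) (at 0)"
    using \<Upsilon>_line[OF n, of j] unfolding has_real_derivative_iff_has_vector_derivative
    by (auto intro!: has_vector_derivative_Pair derivative_eq_intros)
  from has_real_derivative_along[OF G _ this] n
  have "((\<lambda>t. G (line n j t, \<Upsilon> (line n j t))) has_real_derivative
      frechet_derivative G (at (n, \<Upsilon> n)) (axis j 1, dY j n *\<^sub>R 1)) (at 0)" by simp
  then have "((\<lambda>t. G (line n j t, \<Upsilon> (line n j t))) has_real_derivative
      dpar j G (n, \<Upsilon> n) + dY j n * dx G (n, \<Upsilon> n)) (at 0)"
    using frechet_derivative_prod[OF G, of "(n, \<Upsilon> n)" "axis j 1" "dY j n" 1] n by (simp add: dpar_def dx_def)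
  moreover have "((\<lambda>t. G (line n j t, \<Upsilon> (line n j t))) has_real_derivative dpar j G (n, 0)) (at 0)"
  proof (rule has_field_derivative_transform_within_open[where S = "{-\<delta><..<\<delta>}"])
    show "((\<lambda>t. G (line n j t, 0)) has_real_derivative dpar j G (n, 0)) (at 0)"
      by (rule slice_t_0[OF G n])
    show "G (line n j t, 0) = G (line n j t, \<Upsilon> (line n j t))" if "t \<in> {-\<delta><..<\<delta>}" for t
      using per[of "line n j t" 0] \<delta> that by auto
  qed (use \<delta> in auto)
  ultimately have "dpar j G (n, \<Upsilon> n) + dY j n * dx G (n, \<Upsilon> n) = dpar j G (n, 0)" by (rule DERIV_unique)
  then show ?thesis by (simp add: dxP algebra_simps)
qed

lemma U_periodic: "n \<in> \<Omega> \<Longrightarrow> U (n, x + \<Upsilon> n) = U (n, x)"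
  by (simp add: u_periodic)

lemma dxU_periodic: "n \<in> \<Omega> \<Longrightarrow> dx U (n, x + \<Upsilon> n) = dx U (n, x)"
  using periodic_deriv[of "\<lambda>x. U (n, x)" "\<lambda>x. dx U (n, x)" "\<Upsilon> n" x] slice_x[OF u_smooth] U_periodic by simp

lemma J_periodic: "n \<in> \<Omega> \<Longrightarrow> J n (x + \<Upsilon> n) = J n x"
  using U_periodic[of n x] dxU_periodic[of n x] by (simp add: J_def)

text \<open>The zeroth-order coefficient is \<alpha> - \<beta>' because the terms \<beta> w' and
  (\<beta> w)' of the Hessian combine to -\<beta>' w.\<close>

lemma wave_modulated:
  assumes n: "n \<in> \<Omega>"
  shows "modulated_wave (\<lambda>x. al n x - deriv (be n) x) (\<lambda>x. deriv (al n) x - deriv (deriv (be n)) x)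
    (ka n) (deriv (ka n)) (deriv (deriv (ka n))) (\<Upsilon> n) (u n) (\<lambda>x. dx U (n, x))
    (\<lambda>x. dx (dx U) (n, x)) (\<lambda>x. dx (dx (dx U)) (n, x)) (\<lambda>x. dx (dx (dx (dx U))) (n, x))
    (\<lambda>j x. dpar j U (n, x)) (\<lambda>j x. dx (dpar j U) (n, x)) (\<lambda>j x. dx (dx (dpar j U)) (n, x))
    (\<lambda>j x. dx (dx (dx (dpar j U))) (n, x)) (\<lambda>j. dY j n)"
proof
  note ca = coeffs_in_jet_alg[OF n]
  note j = jet_alg_u[OF n]
  fix x
  show "0 < \<Upsilon> n" by (rule \<Upsilon>_pos[OF n])
  show "((\<lambda>x. al n x - deriv (be n) x) has_real_derivative deriv (al n) x - deriv (deriv (be n)) x) (at x)"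
    by (intro DERIV_diff j ca)
  show "(ka n has_real_derivative deriv (ka n) x) (at x)" by (intro j ca)
  show "(deriv (ka n) has_real_derivative deriv (deriv (ka n)) x) (at x)" by (intro j ca)
  show "continuous_on UNIV (\<lambda>x. deriv (al n) x - deriv (deriv (be n)) x)"
    by (intro continuous_on_diff j ca)
  show "continuous_on UNIV (deriv (deriv (ka n)))" by (intro j ca)
  show "0 < ka n x" unfolding ka_def J_def by (rule e_convex)
  have "be n (x + \<Upsilon> n) = be n x" for x by (simp add: be_def J_periodic[OF n])
  from periodic_deriv[OF j(1)[OF ca(2)] this]
  show "al n (x + \<Upsilon> n) - deriv (be n) (x + \<Upsilon> n) = al n x - deriv (be n) x"
    by (simp add: al_def J_periodic[OF n])
  show "ka n (x + \<Upsilon> n) = ka n x" by (simp add: ka_def J_periodic[OF n])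
  show "(u n has_real_derivative dx U (n, x)) (at x)" using slice_x[OF u_smooth n] by simp
  show "((\<lambda>x. dx U (n, x)) has_real_derivative dx (dx U) (n, x)) (at x)"
    "((\<lambda>x. dx (dx U) (n, x)) has_real_derivative dx (dx (dx U)) (n, x)) (at x)"
    "((\<lambda>x. dx (dx (dx U)) (n, x)) has_real_derivative dx (dx (dx (dx U))) (n, x)) (at x)"
    by (intro slice_x[OF _ n] smooth_intros)+
  show "u n (x + \<Upsilon> n) = u n x" by (rule u_periodic[OF n])
  show "((\<lambda>x. dpar j U (n, x)) has_real_derivative dx (dpar j U) (n, x)) (at x)"
    "((\<lambda>x. dx (dpar j U) (n, x)) has_real_derivative dx (dx (dpar j U)) (n, x)) (at x)"
    "((\<lambda>x. dx (dx (dpar j U)) (n, x)) has_real_derivative dx (dx (dx (dpar j U))) (n, x)) (at x)" for j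
    by (intro slice_x[OF _ n] smooth_intros)+
  show "dpar j U (n, \<Upsilon> n) - dpar j U (n, 0) = - dY j n * dx U (n, 0)" for j
    by (rule jump_dpar[OF u_smooth U_periodic n])
  show "dx (dpar j U) (n, \<Upsilon> n) - dx (dpar j U) (n, 0) = - dY j n * dx (dx U) (n, 0)" for j
    unfolding dx_dpar_commute[OF u_smooth n]
    by (rule jump_dpar[OF smooth_dx[OF u_smooth] dxU_periodic n])
  show "(al n x - deriv (be n) x) * dx U (n, x) - deriv (ka n) x * dx (dx U) (n, x)
    - ka n x * dx (dx (dx U)) (n, x) = 0" by (rule L_dx[OF n])
qed (use L_dpar[OF n] wronskian_dpar[OF n, of 0] in \<open>simp_all add: axis_def\<close>)

end

section \<open>Gradient and Hessian of the action\<close>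

context wave_family
begin

text \<open>The parameter derivative of the integrand of the action with the profile frozen: 1, -v
  and v^2 / 2.\<close>

definition dens :: "3 \<Rightarrow> real \<Rightarrow> real" where
  "dens j v = axis j 1 $ 1 - axis j 1 $ 2 * v + axis j 1 $ 3 * (v\<^sup>2 / 2)"

lemma line_nth_deriv: "((\<lambda>t. line n j t $ i) has_real_derivative axis j 1 $ i) (at t)"
  by (auto intro!: derivative_eq_intros)

text \<open>Profiles are critical points: varying the profile contributes only the boundary term of
  an integration by parts. The varying period makes this term nonzero, but by \<open>energy\<close>
  it cancels the contribution of the moving endpoint.\<close>

lemma partial_action:
  assumes n: "n \<in> \<Omega>"
  shows "partial j (action e u \<Upsilon>) n = integral {0..\<Upsilon> n} (\<lambda>x. dens j (u n x))"
proof -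
  obtain \<delta> where \<delta>: "\<delta> > 0" "\<forall>t. \<bar>t\<bar> < \<delta> \<longrightarrow> line n j t \<in> \<Omega>" using line_in[OF n] by blast
  define f where "f t x = e (J (line n j t) x) + line n j t $ 3 / 2 * (U (line n j t, x))\<^sup>2
      - line n j t $ 2 * U (line n j t, x) + line n j t $ 1" for t x
  define ft where "ft t x = (pd_v e (J (line n j t) x) * dpar j U (line n j t, x)
        + pd_vx e (J (line n j t) x) * dpar j (dx U) (line n j t, x))
      + (axis j 1 $ 3 / 2 * (U (line n j t, x))\<^sup>2 + line n j t $ 3 * (U (line n j t, x) * dpar j U (line n j t, x)))
      - (axis j 1 $ 2 * U (line n j t, x) + line n j t $ 2 * dpar j U (line n j t, x)) + axis j 1 $ 1" for t x
  have gen: "((\<lambda>t. f1 t + f2 t / 2 * (f3 t)\<^sup>2 - f4 t * f3 t + f5 t) has_real_derivative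
      g1 + (g2 / 2 * (f3 t)\<^sup>2 + f2 t * (f3 t * g3)) - (g4 * f3 t + f4 t * g3) + g5) (at t)"
    if "(f1 has_real_derivative g1) (at t)" "(f2 has_real_derivative g2) (at t)" "(f3 has_real_derivative g3) (at t)"
      "(f4 has_real_derivative g4) (at t)" "(f5 has_real_derivative g5) (at t)"
    for f1 f2 f3 f4 f5 :: "real \<Rightarrow> real" and g1 g2 g3 g4 g5 t
    using that by (auto intro!: derivative_eq_intros simp: field_simps)
  have D: "((\<lambda>t. integral {0..\<Upsilon> (line n j t)} (f t)) has_real_derivative
      dY j n * f 0 (\<Upsilon> (line n j 0)) + integral {0..\<Upsilon> (line n j 0)} (ft 0)) (at 0)"
  proof (rule DERIV_integral_upper[OF \<delta>(1)])
    show "((\<lambda>t. f t x) has_real_derivative ft t x) (at t)" if "\<bar>t\<bar> < \<delta>" for t x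
    proof -
      have l: "line n j t \<in> \<Omega>" using \<delta> that by simp
      show ?thesis unfolding f_def ft_def
        by (rule gen[OF J_deriv_t[OF e_smooth l] line_nth_deriv slice_t[OF u_smooth l] line_nth_deriv line_nth_deriv])
    qed
    have 1: "(\<lambda>(t, x). f t x) = (\<lambda>p. f (fst p) (snd p))" and 2: "(\<lambda>(t, x). ft t x) = (\<lambda>p. ft (fst p) (snd p))"
      by auto
    show "continuous_on ({-\<delta><..<\<delta>} \<times> UNIV) (\<lambda>(t, x). f t x)"
      unfolding 1 unfolding f_def line_nth
      by (intro continuous_on_add continuous_on_diff continuous_on_mult continuous_on_const continuous_on_fst
          continuous_on_divide continuous_on_power continuous_on_id
          cont_J[OF _ \<delta>(2)] cont_line[OF _ \<delta>(2)] smooth_intros smooth_on_pd e_smooth) auto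
    show "continuous_on ({-\<delta><..<\<delta>} \<times> UNIV) (\<lambda>(t, x). ft t x)"
      unfolding 2 unfolding ft_def line_nth
      by (intro continuous_on_add continuous_on_diff continuous_on_mult continuous_on_const continuous_on_fst
          continuous_on_divide continuous_on_power continuous_on_id
          cont_J[OF _ \<delta>(2)] cont_line[OF _ \<delta>(2)] smooth_intros smooth_on_pd e_smooth)
    show "((\<lambda>t. \<Upsilon> (line n j t)) has_real_derivative dY j n) (at 0)" by (rule \<Upsilon>_line[OF n])
    show "0 < \<Upsilon> (line n j 0)" using \<Upsilon>_pos[OF n] by simp
  qed
  \<comment> \<open>Momentum times variation: by the Euler-Lagrange equation its derivative is the
    full variation of the integrand minus the explicit part \<open>dens\<close>.\<close>
  define q where "q x = pd_vx e (J n x) * dpar j U (n, x)" for x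
  have q: "(q has_real_derivative ft 0 x - dens j (u n x)) (at x)" for x
  proof -
    have "(q has_real_derivative (pd_v e (J n x) + n $ 3 * u n x - n $ 2) * dpar j U (n, x)
        + dx (dpar j U) (n, x) * pd_vx e (J n x)) (at x)"
      unfolding q_def by (intro DERIV_mult ep_deriv[OF n] slice_x[OF _ n] smooth_intros)
    moreover have "(pd_v e (J n x) + n $ 3 * u n x - n $ 2) * dpar j U (n, x)
        + dx (dpar j U) (n, x) * pd_vx e (J n x) = ft 0 x - dens j (u n x)"
      by (simp add: ft_def dens_def dx_dpar_commute[OF u_smooth n] algebra_simps)
    ultimately show ?thesis by simp
  qed
  have "((\<lambda>x. ft 0 x - dens j (u n x)) has_integral q (\<Upsilon> n) - q 0) {0..\<Upsilon> n}"
    using \<Upsilon>_pos[OF n] q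
    by (intro fundamental_theorem_of_calculus)
      (auto simp: has_real_derivative_iff_has_vector_derivative intro: has_vector_derivative_at_within)
  moreover have "continuous_on S (u n)" for S
    by (rule DERIV_continuous_on, rule has_field_derivative_at_within) (use slice_x[OF u_smooth n] in simp)
  then have "((\<lambda>x. dens j (u n x)) has_integral integral {0..\<Upsilon> n} (\<lambda>x. dens j (u n x))) {0..\<Upsilon> n}"
    unfolding dens_def by (intro integrable_integral integrable_continuous_real continuous_intros) auto
  ultimately have "((\<lambda>x. ft 0 x - dens j (u n x) + dens j (u n x)) has_integral
      q (\<Upsilon> n) - q 0 + integral {0..\<Upsilon> n} (\<lambda>x. dens j (u n x))) {0..\<Upsilon> n}" by (rule has_integral_add)
  then have I: "integral {0..\<Upsilon> n} (ft 0) = q (\<Upsilon> n) - q 0 + integral {0..\<Upsilon> n} (\<lambda>x. dens j (u n x))"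
    by (simp add: integral_unique)
  have JP: "J n (\<Upsilon> n) = J n 0" using J_periodic[OF n, of 0] by simp
  have uP: "u n (\<Upsilon> n) = u n 0" using u_periodic[OF n, of 0] by simp
  have "q (\<Upsilon> n) - q 0 = pd_vx e (J n 0) * (dpar j U (n, \<Upsilon> n) - dpar j U (n, 0))"
    by (simp add: q_def JP algebra_simps)
  also have "\<dots> = - dY j n * (dx U (n, 0) * pd_vx e (J n 0))"
  proof -
    have "dpar j U (n, \<Upsilon> n) - dpar j U (n, 0) = - dY j n * dx U (n, 0)"
      by (rule jump_dpar[OF u_smooth U_periodic n])
    then show ?thesis by (simp only: mult_ac)
  qed
  also have "dx U (n, 0) * pd_vx e (J n 0) = f 0 (\<Upsilon> n)"
    using energy[OF n, of 0] by (simp add: f_def JP uP)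
  finally have D': "((\<lambda>t. integral {0..\<Upsilon> (line n j t)} (f t)) has_real_derivative
      integral {0..\<Upsilon> n} (\<lambda>x. dens j (u n x))) (at 0)"
    using D I by simp
  have "((\<lambda>t. action e u \<Upsilon> (line n j t)) has_real_derivative
      integral {0..\<Upsilon> n} (\<lambda>x. dens j (u n x))) (at 0)"
  proof (rule has_field_derivative_transform_within_open[OF D', where S = "{-\<delta><..<\<delta>}"])
    fix t assume "t \<in> {-\<delta><..<\<delta>}"
    then have "line n j t \<in> \<Omega>" using \<delta> by auto
    then show "integral {0..\<Upsilon> (line n j t)} (f t) = action e u \<Upsilon> (line n j t)"
      by (simp add: action_def jet_u f_def[abs_def])
  qed (use \<delta> in auto)
  then show ?thesis unfolding partial_def by (rule DERIV_imp_deriv)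
qed

lemma hessian_action:
  assumes n: "n \<in> \<Omega>"
  shows "hessian (action e u \<Upsilon>) n $ i $ j = dY i n * dens j (u n 0)
    + integral {0..\<Upsilon> n} (\<lambda>x. (axis j 1 $ 3 * u n x - axis j 1 $ 2) * dpar i U (n, x))"
proof -
  obtain \<delta> where \<delta>: "\<delta> > 0" "\<forall>t. \<bar>t\<bar> < \<delta> \<longrightarrow> line n i t \<in> \<Omega>" using line_in[OF n] by blast
  define ft where "ft t x = (axis j 1 $ 3 * U (line n i t, x) - axis j 1 $ 2) * dpar i U (line n i t, x)" for t x
  have gen: "((\<lambda>t. dens j (f t)) has_real_derivative (axis j 1 $ 3 * f t - axis j 1 $ 2) * g) (at t)"
    if "(f has_real_derivative g) (at t)" for f g t
    unfolding dens_def using that by (auto intro!: derivative_eq_intros simp: field_simps)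
  have D: "((\<lambda>t. integral {0..\<Upsilon> (line n i t)} (\<lambda>x. dens j (U (line n i t, x)))) has_real_derivative
      dY i n * dens j (U (line n i 0, \<Upsilon> (line n i 0))) + integral {0..\<Upsilon> (line n i 0)} (ft 0)) (at 0)"
  proof (rule DERIV_integral_upper[OF \<delta>(1)])
    show "((\<lambda>t. dens j (U (line n i t, x))) has_real_derivative ft t x) (at t)" if "\<bar>t\<bar> < \<delta>" for t x
      unfolding ft_def by (rule gen, rule slice_t[OF u_smooth]) (use \<delta> that in auto)
    have 1: "(\<lambda>(t, x). dens j (U (line n i t, x))) = (\<lambda>p. dens j (U (line n i (fst p), snd p)))"
      and 2: "(\<lambda>(t, x). ft t x) = (\<lambda>p. ft (fst p) (snd p))" by auto
    show "continuous_on ({-\<delta><..<\<delta>} \<times> UNIV) (\<lambda>(t, x). dens j (U (line n i t, x)))"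
      unfolding 1 unfolding dens_def
      by (intro continuous_on_add continuous_on_diff continuous_on_mult continuous_on_const
          continuous_on_divide continuous_on_power cont_line[OF _ \<delta>(2)] smooth_intros) auto
    show "continuous_on ({-\<delta><..<\<delta>} \<times> UNIV) (\<lambda>(t, x). ft t x)"
      unfolding 2 unfolding ft_def
      by (intro continuous_on_diff continuous_on_mult continuous_on_const cont_line[OF _ \<delta>(2)] smooth_intros)
    show "((\<lambda>t. \<Upsilon> (line n i t)) has_real_derivative dY i n) (at 0)" by (rule \<Upsilon>_line[OF n])
    show "0 < \<Upsilon> (line n i 0)" using \<Upsilon>_pos[OF n] by simp
  qed
  have "((\<lambda>t. partial j (action e u \<Upsilon>) (line n i t)) has_real_derivative
      dY i n * dens j (U (line n i 0, \<Upsilon> (line n i 0))) + integral {0..\<Upsilon> (line n i 0)} (ft 0)) (at 0)"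
  proof (rule has_field_derivative_transform_within_open[OF D, where S = "{-\<delta><..<\<delta>}"])
    fix t assume "t \<in> {-\<delta><..<\<delta>}"
    then have "line n i t \<in> \<Omega>" using \<delta> by auto
    then show "integral {0..\<Upsilon> (line n i t)} (\<lambda>x. dens j (U (line n i t, x)))
        = partial j (action e u \<Upsilon>) (line n i t)"
      by (simp add: partial_action)
  qed (use \<delta> in auto)
  from DERIV_imp_deriv[OF this]
  have "partial i (partial j (action e u \<Upsilon>)) n
      = dY i n * dens j (U (line n i 0, \<Upsilon> (line n i 0))) + integral {0..\<Upsilon> (line n i 0)} (ft 0)"
    by (simp add: partial_def)
  then show ?thesis
    using u_periodic[OF n, of 0] by (simp add: hessian_def ft_def[abs_def])
qed

section \<open>Evans function and spectrum of a single wave\<close>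

context
  fixes n assumes n: "n \<in> \<Omega>"
begin

interpretation W: modulated_wave "\<lambda>x. al n x - deriv (be n) x" "\<lambda>x. deriv (al n) x - deriv (deriv (be n)) x"
  "ka n" "deriv (ka n)" "deriv (deriv (ka n))" "\<Upsilon> n" "u n" "\<lambda>x. dx U (n, x)"
  "\<lambda>x. dx (dx U) (n, x)" "\<lambda>x. dx (dx (dx U)) (n, x)" "\<lambda>x. dx (dx (dx (dx U))) (n, x)"
  "\<lambda>j x. dpar j U (n, x)" "\<lambda>j x. dx (dpar j U) (n, x)" "\<lambda>j x. dx (dx (dpar j U)) (n, x)"
  "\<lambda>j x. dx (dx (dx (dpar j U))) (n, x)" "\<lambda>j. dY j n"
  by (rule wave_modulated[OF n])

lemma hessian_eq_G: "hessian (action e u \<Upsilon>) n = W.G"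
  unfolding vec_eq_iff
proof (intro allI)
  fix i j :: 3
  consider "j = 1" | "j = 2" | "j = 3" using exhaust_3[of j] by blast
  then show "hessian (action e u \<Upsilon>) n $ i $ j = W.G $ i $ j"
    unfolding hessian_action[OF n] W.G_def
    by cases (simp_all add: dens_def axis_def algebra_simps)
qed

lemma companion_coeffs:
  "pd_v (pd_v (add_impulse e (n $ 3))) (jet (u n) y) = al n y"
  "pd_v (pd_vx (add_impulse e (n $ 3))) (jet (u n) y) = be n y"
  "pd_vx (pd_vx (add_impulse e (n $ 3))) (jet (u n) y) = ka n y"
  by (simp_all only: add_impulse_pd(2,3)[OF e_smooth] jet_u[OF n] al_def be_def ka_def)

lemma companion_eq: "companion (add_impulse e (n $ 3)) (u n) (of_real r) = (\<lambda>x. cmat (W.A r x))"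
  unfolding companion_def Let_def companion_coeffs
  by (auto simp: fun_eq_iff vec_eq_iff forall_3 cmat_def comp_mat_def)

lemma evans_eq: "evans e (n $ 3) (u n) (\<Upsilon> n) (of_real r) = of_real (W.d r)"
proof -
  have "evans e (n $ 3) (u n) (\<Upsilon> n) (of_real r) = det (cmat (fund (W.A r) (\<Upsilon> n) - mat 1))"
    unfolding evans_def Let_def companion_eq fundamental_solution_cmat[OF W.A_cont]
    by (simp add: cmat_diff fund_0[OF W.A_cont])
  then show ?thesis by (simp add: det_cmat monodromy_det_def)
qed

text \<open>A zero supplies a nonzero periodic solution, smooth enough to lie in the domain of the
  operator. At such r the resolvent equation loses uniqueness, and r is real and nonzero, hence off
  the imaginary axis.\<close>

lemma zero_imp_unstable:
  assumes "W.d r = 0" "r \<noteq> 0"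
  shows "spectrally_unstable e (n $ 3) (u n) (\<Upsilon> n)"
proof -
  define E where "E = add_impulse e (n $ 3)"
  define P where "P = \<Upsilon> n"
  obtain Y where Y: "\<And>x. (Y has_vector_derivative W.A r x *v Y x) (at x)"
    and per: "\<And>x. Y (x + P) = Y x" and Y0: "Y 0 \<noteq> 0"
    using W.singular_imp_periodic_solution[OF assms(1)] unfolding P_def by blast
  note dY = W.sol_deriv[OF Y]
  define y where "y i x = complex_of_real (Y x $ i)" for i x
  define y3 where "y3 x = complex_of_real ((W.A r x *v Y x) $ 3)" for x
  have d: "(y 1 has_vector_derivative y 2 x) (at x)" "(y 2 has_vector_derivative y 3 x) (at x)"
    "(y 3 has_vector_derivative y3 x) (at x)" for x
    unfolding y_def y3_def comp_mat_mult vector_3 by (rule has_vector_derivative_of_real, rule dY)+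
  have Yc: "continuous_on S Y" for S
    by (rule continuous_on_vector_derivative, rule has_vector_derivative_at_within, rule Y)
  have y3c: "continuous_on S y3" for S
    unfolding y3_def
    by (intro continuous_intros bounded_bilinear.continuous_on[OF bounded_bilinear_matrix_vector_mult] Yc W.A_cont)
  have L2: "f \<in> L2_per P" if "continuous_on UNIV f" "\<And>x. f (x + P) = f x" for f
  proof -
    have "f \<in> borel_measurable borel" using that(1) by (rule borel_measurable_continuous_onI)
    moreover have "set_integrable lborel {0..P} (\<lambda>x. (cmod (f x))\<^sup>2)"
      by (intro borel_integrable_atLeastAtMost' continuous_intros continuous_on_subset[OF that(1)]) auto
    ultimately show ?thesis using that(2) by (simp add: L2_per_def)
  qed
  have weak: "weak_deriv f g" if "\<And>x. (f has_vector_derivative g x) (at x)" for f g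
    unfolding weak_deriv_def
    by (intro allI impI, rule fundamental_theorem_of_calculus, assumption,
        rule has_vector_derivative_at_within, rule that)
  note ja = jet_alg_u[OF n] coeffs_in_jet_alg[OF n]
  have fd: "f field_differentiable at x" if "f \<in> jet_alg (u n)" for f x
    using ja(1)[OF that] by (auto simp: field_differentiable_def)
  have hess: "(hess_op E (u n) (y 1) has_vector_derivative of_real r * y 1 x) (at x)" for x
  proof -
    have "(y 3 has_vector_derivative (companion E (u n) (of_real r) x *v vector [y 1 x, y 2 x, y 3 x]) $ 3) (at x)"
    proof -
      have "(companion E (u n) (of_real r) x *v vector [y 1 x, y 2 x, y 3 x]) $ 3 = y3 x"
        unfolding E_def companion_eq y3_def y_def
        by (simp add: matrix_vector_mult_def cmat_def sum_3)
      then show ?thesis using d(3)[of x] by simp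
    qed
    moreover have "ka n x \<noteq> 0" for x using W.k_pos[of x] by simp
    ultimately show ?thesis
      by (intro iffD2[OF companion_iff[where ?w1.0 = "y 2" and ?w2.0 = "y 3"]])
        (simp_all only: E_def companion_coeffs, simp_all add: fd ja d)
  qed
  have "y 1 \<in> H3_per P"
  proof -
    have "y3 \<in> L2_per P"
      by (rule L2[OF y3c]) (use W.A_periodic[of r] per in \<open>simp add: y3_def P_def\<close>)
    moreover have "y 1 (x + P) = y 1 x" for x by (simp add: y_def per)
    ultimately show ?thesis unfolding H3_per_def using d(1,2) weak[OF d(3)] by blast
  qed
  moreover have rw: "(\<lambda>x. of_real r * y 1 x) \<in> L2_per P"
    by (rule L2) (auto intro!: continuous_intros Yc simp: y_def per)
  ultimately have in1: "(y 1, \<lambda>x. 0 + of_real r * y 1 x) \<in> lin_graph E (u n) P"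
    using weak[OF hess] by (simp add: lin_graph_def)
  have zL2: "(\<lambda>_. 0) \<in> L2_per P" by (rule L2) auto
  have "hess_op E (u n) (\<lambda>_. 0) = (\<lambda>_. 0)" by (simp add: hess_op_def fun_eq_iff)
  moreover have "(\<lambda>_. 0) \<in> H3_per P"
    unfolding H3_per_def using weak[of "\<lambda>_. 0" "\<lambda>_. 0"] zL2
    by (auto intro!: exI[of _ "\<lambda>_. 0 :: complex"])
  ultimately have in0: "(\<lambda>_. 0, \<lambda>x. 0 + of_real r * 0) \<in> lin_graph E (u n) P"
    using weak[of "\<lambda>_. 0" "\<lambda>_. 0"] zL2 by (simp add: lin_graph_def)
  \<comment> \<open>Only the whole jet is known to be nonzero; a vanishing first component would
    make its derivatives vanish as well.\<close>
  have "y 1 \<noteq> (\<lambda>_. 0)"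
  proof
    assume "y 1 = (\<lambda>_. 0)"
    then have 1: "Y x $ 1 = 0" for x by (simp add: y_def fun_eq_iff)
    have 2: "Y x $ 2 = 0" for x using DERIV_unique[OF dY(1)[of x], of 0] by (simp add: 1)
    have 3: "Y x $ 3 = 0" for x using DERIV_unique[OF dY(2)[of x], of 0] by (simp add: 2)
    show False using Y0 1 2 3 by (simp add: vec_eq_iff forall_3)
  qed
  \<comment> \<open>The zero right-hand side has two preimages, the zero function and
    \<open>y 1\<close>.\<close>
  with in0 in1 have "\<not> (\<exists>!w. (w, \<lambda>x. 0 + of_real r * w x) \<in> lin_graph E (u n) P)" by blast
  with zL2 have "of_real r \<in> spectrum_per P (lin_graph E (u n) P)"
    unfolding spectrum_per_def resolvent_set_per_def by fastforce
  with assms(2) show ?thesis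
    unfolding spectrally_unstable_def spectrally_stable_def E_def P_def by fastforce
qed

lemma wave_theorem:
  "(\<lambda>r::real. evans e (n $ 3) (u n) (\<Upsilon> n) (of_real r)
        - of_real (r ^ 3 * det (hessian (action e u \<Upsilon>) n))) \<in> o[at 0](\<lambda>r. of_real (r ^ 3))"
  "\<exists>R>0. \<forall>r>R. evans e (n $ 3) (u n) (\<Upsilon> n) (of_real r) \<in> \<real>
      \<and> Re (evans e (n $ 3) (u n) (\<Upsilon> n) (of_real r)) < 0"
  "det (hessian (action e u \<Upsilon>) n) > 0 \<Longrightarrow> spectrally_unstable e (n $ 3) (u n) (\<Upsilon> n)"
proof -
  show "(\<lambda>r::real. evans e (n $ 3) (u n) (\<Upsilon> n) (of_real r)
        - of_real (r ^ 3 * det (hessian (action e u \<Upsilon>) n))) \<in> o[at 0](\<lambda>r. of_real (r ^ 3))"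
  proof (rule smalloI_tendsto)
    have "((\<lambda>r. complex_of_real (W.d r / r ^ 3 - det W.G)) \<longlongrightarrow> of_real (det W.G - det W.G)) (at 0)"
      by (intro tendsto_intros W.d_asymptotics)
    then have lim: "((\<lambda>r. complex_of_real (W.d r / r ^ 3 - det W.G)) \<longlongrightarrow> 0) (at 0)" by simp
    have "\<forall>\<^sub>F r::real in at 0. r \<noteq> 0" by (rule eventually_neq_at_within)
    then have "\<forall>\<^sub>F r in at 0. complex_of_real (W.d r / r ^ 3 - det W.G) =
        (evans e (n $ 3) (u n) (\<Upsilon> n) (of_real r) - of_real (r ^ 3 * det (hessian (action e u \<Upsilon>) n)))
        / of_real (r ^ 3)"
    proof eventually_elim
      case (elim r)
      then show ?case
        unfolding evans_eq hessian_eq_G of_real_diff[symmetric] of_real_divide[symmetric]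
        by (simp add: field_simps)
    qed
    from Lim_transform_eventually[OF lim this]
    show "((\<lambda>r. (evans e (n $ 3) (u n) (\<Upsilon> n) (of_real r) - of_real (r ^ 3 * det (hessian (action e u \<Upsilon>) n)))
        / of_real (r ^ 3)) \<longlongrightarrow> 0) (at 0)" .
    show "\<forall>\<^sub>F r in at 0. complex_of_real (r ^ 3) \<noteq> 0"
      using \<open>\<forall>\<^sub>F r::real in at 0. r \<noteq> 0\<close> by eventually_elim simp
  qed
  obtain R where R: "R > 0" "\<And>r. r > R \<Longrightarrow> W.d r < 0" using W.d_negative by blast
  then show "\<exists>R>0. \<forall>r>R. evans e (n $ 3) (u n) (\<Upsilon> n) (of_real r) \<in> \<real>
      \<and> Re (evans e (n $ 3) (u n) (\<Upsilon> n) (of_real r)) < 0"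
    unfolding evans_eq by auto
  assume "det (hessian (action e u \<Upsilon>) n) > 0"
  then have "\<forall>\<^sub>F r in at 0. 0 < W.d r / r ^ 3"
    unfolding hessian_eq_G by (rule order_tendstoD(1)[OF W.d_asymptotics])
  then obtain \<delta> where \<delta>: "\<delta> > 0" "\<And>r. r \<noteq> 0 \<Longrightarrow> dist r 0 < \<delta> \<Longrightarrow> 0 < W.d r / r ^ 3"
    unfolding eventually_at by auto
  \<comment> \<open>Below \<delta> the quotient by r^3 is positive, and p \<le> R places p to the
    left of the point R + 1, where the determinant is negative.\<close>
  define p where "p = min \<delta> R / 2"
  have p: "0 < p" "p < \<delta>" "p \<le> R" using \<delta>(1) R(1) by (auto simp: p_def min_def)
  have "0 < W.d p" using \<delta>(2)[of p] p by (simp add: zero_less_divide_iff)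
  moreover have "W.d (R + 1) < 0" by (rule R(2)) simp
  ultimately obtain r where "p \<le> r" "r \<le> R + 1" "W.d r = 0"
    using IVT2'[of W.d "R + 1" 0 p] W.d_continuous p by auto
  with p show "spectrally_unstable e (n $ 3) (u n) (\<Upsilon> n)"
    by (intro zero_imp_unstable) auto
qed

end

end

theorem theorem2:
  fixes e :: "real \<times> real \<Rightarrow> real"
    and \<Omega> :: "(real^3) set"
    and u :: "real^3 \<Rightarrow> real \<Rightarrow> real"
    and \<Upsilon> :: "real^3 \<Rightarrow> real"
    and m :: "real^3"
  assumes "smooth_on UNIV e"
    and "\<And>v p. pd_vx (pd_vx e) (v, p) > 0"
    and "open \<Omega>"
    and "smooth_on (\<Omega> \<times> UNIV) (\<lambda>(n, x). u n x)"
    and "smooth_on \<Omega> \<Upsilon>"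
    and "\<And>n. n \<in> \<Omega> \<Longrightarrow> \<Upsilon> n > 0"
    and "\<And>n x. n \<in> \<Omega> \<Longrightarrow> u n (x + \<Upsilon> n) = u n x"
    and "\<And>n. n \<in> \<Omega> \<Longrightarrow> \<not> (u n) constant_on UNIV"
    and "\<And>n x. n \<in> \<Omega> \<Longrightarrow> var_deriv (add_impulse e (n $ 3)) (u n) x = n $ 2"
    and "\<And>n x. n \<in> \<Omega> \<Longrightarrow>
      u n x * var_deriv e (u n) x + legendre e (u n) x + n $ 3 * impulse (u n x) = n $ 1"
    and "m \<in> \<Omega>"
  shows "(\<lambda>r::real. evans e (m $ 3) (u m) (\<Upsilon> m) (of_real r)
            - of_real (r ^ 3 * det (hessian (action e u \<Upsilon>) m)))
          \<in> o[at 0](\<lambda>r. of_real (r ^ 3))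
    \<and> (\<exists>R>0. \<forall>r>R. evans e (m $ 3) (u m) (\<Upsilon> m) (of_real r) \<in> \<real>
                   \<and> Re (evans e (m $ 3) (u m) (\<Upsilon> m) (of_real r)) < 0)
    \<and> (det (hessian (action e u \<Upsilon>) m) > 0 \<longrightarrow> spectrally_unstable e (m $ 3) (u m) (\<Upsilon> m))"
proof -
  interpret wave_family e \<Omega> u \<Upsilon>
    by standard (use assms in auto)
  show ?thesis using wave_theorem[OF \<open>m \<in> \<Omega>\<close>] by blast
qed

end
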